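(* Let $M$ be an $MV$-algebra. (i) If $L$ is a linearly ordered $MV$-algebra and $f:M\to L$ is an epimorphism in the category of $MV$-algebras, then $L\subseteq f(M)^d$, where $f(M)^d$ denotes the divisible hull of the subalgebra $f(M)$ of $L$. (ii) If $M$ is divisible, then $M$ is epicomplete.
   Context: An $MV$-algebra $(M;\oplus,',0,1)$ is meant in the usual sense: $(M;\oplus,0)$ is a commutative monoid, $1=0'$, $x''=x$, $x\oplus 1=1$, and $x\oplus(x\oplus y')'=y\oplus(y\oplus x')'$. It is partially (lattice) ordered by $x\le y\iff x'\oplus y=1$. $\mathcal{MV}$ is the category of $MV$-algebras and $MV$-homomorphisms. For an integer $n\ge 0$, $0.x=0$, $1.x=x$ and $n.x=(n-1).x\oplus x$ for $n\ge 2$. An epimorphism is a categorical epimorphism in $\mathcal{MV}$: an $MV$-homomorphism $f:M_1\to M_2$ such that for every $MV$-algebra $M_3$ and all $MV$-homomorphisms $\alpha,\beta:M_2\to M_3$, $\alpha\circ f=\beta\circ f$ implies $\alpha=\beta$. An $MV$-algebra $M$ is epicomplete if every epimorphism $\alpha:M\to A$ in $\mathcal{MV}$ (for every $MV$-algebra $A$) is surjective. An $MV$-algebra $M$ is divisible if for all $a\in M$ and all integers $n\ge 1$ there exists $x\in M$ such that $n.x=a$ and $a'\oplus((n-1).x)=x'$. For an Abelian $\ell$-group $G$ (lattice ordered group) with strong unit $u$, $\Gamma(G,u)$ is the $MV$-algebra on $[0,u]=\{g\in G: 0\le g\le u\}$ with $x\oplus y=(x+y)\wedge u$ and $x'=u-x$.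 By Mundici's theorem every $MV$-algebra $M$ is (up to isomorphism) $\Gamma(G,u)$ for a unique unital Abelian $\ell$-group $(G,u)$, and $\Gamma$ is a categorical equivalence. If $M=\Gamma(G,u)$, the divisible hull of $M$ is $M^d:=\Gamma(G^d,u)$, where $G^d$ is the divisible hull of the $\ell$-group $G$. In (i), writing $L=\Gamma(H,v)$, the unital $\ell$-group of $f(M)$ is identified with an $\ell$-subgroup $K$ of $H$ containing $v$, so that $K^d\subseteq H^d$ and both $L$ and $f(M)^d=\Gamma(K^d,v)$ are regarded as subalgebras of $L^d=\Gamma(H^d,v)$; the inclusion $L\subseteq f(M)^d$ is understood in $L^d$. *)

theory Defs
  imports "HOL-Algebra.Group"
begin

section \<open>MV-algebras\<close>

record 'a mv = "'a partial_object" +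
  mv_plus :: "'a \<Rightarrow> 'a \<Rightarrow> 'a"
  mv_neg :: "'a \<Rightarrow> 'a"
  mv_zero :: 'a

definition mv_one :: "('a, 'm) mv_scheme \<Rightarrow> 'a" where
  "mv_one M = mv_neg M (mv_zero M)"

definition mv_monoid :: "('a, 'm) mv_scheme \<Rightarrow> 'a monoid" where
  "mv_monoid M = \<lparr>carrier = carrier M, mult = mv_plus M, one = mv_zero M\<rparr>"

locale mv_algebra =
  fixes M :: "('a, 'm) mv_scheme"
  assumes monoid: "comm_monoid (mv_monoid M)"
    and neg_closed: "x \<in> carrier M \<Longrightarrow> mv_neg M x \<in> carrier M"
    and neg_neg: "x \<in> carrier M \<Longrightarrow> mv_neg M (mv_neg M x) = x"
    and plus_one: "x \<in> carrier M \<Longrightarrow> mv_plus M x (mv_one M) = mv_one M"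
    and lukasiewicz: "\<lbrakk>x \<in> carrier M; y \<in> carrier M\<rbrakk> \<Longrightarrow>
      mv_plus M x (mv_neg M (mv_plus M x (mv_neg M y))) =
      mv_plus M y (mv_neg M (mv_plus M y (mv_neg M x)))"

definition mv_le :: "('a, 'm) mv_scheme \<Rightarrow> 'a \<Rightarrow> 'a \<Rightarrow> bool" where
  "mv_le M x y \<longleftrightarrow> mv_plus M (mv_neg M x) y = mv_one M"

definition mv_linear :: "('a, 'm) mv_scheme \<Rightarrow> bool" where
  "mv_linear M \<longleftrightarrow> (\<forall>x\<in>carrier M. \<forall>y\<in>carrier M. mv_le M x y \<or> mv_le M y x)"

primrec mv_nmult :: "('a, 'm) mv_scheme \<Rightarrow> nat \<Rightarrow> 'a \<Rightarrow> 'a" where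
  "mv_nmult M 0 x = mv_zero M"
| "mv_nmult M (Suc n) x = mv_plus M (mv_nmult M n x) x"

definition mv_divisible :: "('a, 'm) mv_scheme \<Rightarrow> bool" where
  "mv_divisible M \<longleftrightarrow> (\<forall>a\<in>carrier M. \<forall>n\<ge>1. \<exists>x\<in>carrier M.
     mv_nmult M n x = a \<and>
     mv_plus M (mv_neg M a) (mv_nmult M (n - 1) x) = mv_neg M x)"

definition mv_hom :: "('a, 'm) mv_scheme \<Rightarrow> ('b, 'n) mv_scheme \<Rightarrow> ('a \<Rightarrow> 'b) set" where
  "mv_hom M N = {h \<in> carrier M \<rightarrow> carrier N.
     (\<forall>x\<in>carrier M. \<forall>y\<in>carrier M. h (mv_plus M x y) = mv_plus N (h x) (h y)) \<and>
     (\<forall>x\<in>carrier M. h (mv_neg M x) = mv_neg N (h x)) \<and>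
     h (mv_zero M) = mv_zero N}"

definition mv_iso :: "('a, 'm) mv_scheme \<Rightarrow> ('b, 'n) mv_scheme \<Rightarrow> ('a \<Rightarrow> 'b) set" where
  "mv_iso M N = {h \<in> mv_hom M N. bij_betw h (carrier M) (carrier N)}"


section \<open>Epimorphisms\<close>

text \<open>Right cancellability against the MV-algebras with carrier in one fixed type.\<close>

definition mv_epi_wrt ::
    "'c itself \<Rightarrow> ('a, 'm) mv_scheme \<Rightarrow> ('b, 'n) mv_scheme \<Rightarrow> ('a \<Rightarrow> 'b) \<Rightarrow> bool" where
  "mv_epi_wrt TYPE('c) M N f \<longleftrightarrow> f \<in> mv_hom M N \<and>
     (\<forall>(K :: 'c mv) \<alpha> \<beta>. mv_algebra K \<longrightarrow> \<alpha> \<in> mv_hom N K \<longrightarrow> \<beta> \<in> mv_hom N K \<longrightarrow>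
        (\<forall>x\<in>carrier M. \<alpha> (f x) = \<beta> (f x)) \<longrightarrow> (\<forall>y\<in>carrier N. \<alpha> y = \<beta> y))"

text \<open>
  A formula cannot quantify over types, but testing against a single sufficiently large type
  is enough: two homomorphisms out of \<open>N\<close> take their values in a subalgebra generated by two
  copies of \<open>N\<close>, and such an algebra can be carried by a set of MV-terms over \<open>'b + 'b\<close>.
  The lemma \<open>mv_epi_wrt_any\<close> below shows that \<open>mv_epi\<close> implies right cancellability against
  MV-algebras over every type, so that it is the categorical notion.
\<close>

datatype 'g mv_term = Gen 'g | TZero | TNeg "'g mv_term" | TPlus "'g mv_term" "'g mv_term"

definition mv_epi :: "('a, 'm) mv_scheme \<Rightarrow> ('b, 'n) mv_scheme \<Rightarrow> ('a \<Rightarrow> 'b) \<Rightarrow> bool" where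
  "mv_epi M N f \<longleftrightarrow> mv_epi_wrt TYPE(('b + 'b) mv_term) M N f"

primrec mv_eval :: "('c, 'k) mv_scheme \<Rightarrow> ('g \<Rightarrow> 'c) \<Rightarrow> 'g mv_term \<Rightarrow> 'c" where
  "mv_eval K e (Gen g) = e g"
| "mv_eval K e TZero = mv_zero K"
| "mv_eval K e (TNeg t) = mv_neg K (mv_eval K e t)"
| "mv_eval K e (TPlus s t) = mv_plus K (mv_eval K e s) (mv_eval K e t)"

lemma (in mv_algebra) plus_closed:
  "\<lbrakk>x \<in> carrier M; y \<in> carrier M\<rbrakk> \<Longrightarrow> mv_plus M x y \<in> carrier M"
  using comm_monoid.axioms(1)[OF monoid] monoid.m_closed[of "mv_monoid M" x y]
  by (simp add: mv_monoid_def)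

lemma (in mv_algebra) zero_closed: "mv_zero M \<in> carrier M"
  using comm_monoid.axioms(1)[OF monoid] monoid.one_closed[of "mv_monoid M"]
  by (simp add: mv_monoid_def)

lemma (in mv_algebra) plus_assoc:
  "\<lbrakk>x \<in> carrier M; y \<in> carrier M; z \<in> carrier M\<rbrakk> \<Longrightarrow>
   mv_plus M (mv_plus M x y) z = mv_plus M x (mv_plus M y z)"
  using comm_monoid.axioms(1)[OF monoid] monoid.m_assoc[of "mv_monoid M" x y z]
  by (simp add: mv_monoid_def)

lemma (in mv_algebra) plus_comm:
  "\<lbrakk>x \<in> carrier M; y \<in> carrier M\<rbrakk> \<Longrightarrow> mv_plus M x y = mv_plus M y x"
  using comm_monoid.m_comm[OF monoid, of x y] by (simp add: mv_monoid_def)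

lemma (in mv_algebra) zero_plus: "x \<in> carrier M \<Longrightarrow> mv_plus M (mv_zero M) x = x"
  using comm_monoid.axioms(1)[OF monoid] monoid.l_one[of "mv_monoid M" x]
  by (simp add: mv_monoid_def)

lemma (in mv_algebra) one_closed: "mv_one M \<in> carrier M"
  by (simp add: mv_one_def neg_closed zero_closed)

lemma mv_algebraI:
  assumes "\<And>x y. \<lbrakk>x \<in> carrier M; y \<in> carrier M\<rbrakk> \<Longrightarrow> mv_plus M x y \<in> carrier M"
    and "mv_zero M \<in> carrier M"
    and "\<And>x y z. \<lbrakk>x \<in> carrier M; y \<in> carrier M; z \<in> carrier M\<rbrakk> \<Longrightarrow>
       mv_plus M (mv_plus M x y) z = mv_plus M x (mv_plus M y z)"
    and "\<And>x y. \<lbrakk>x \<in> carrier M; y \<in> carrier M\<rbrakk> \<Longrightarrow> mv_plus M x y = mv_plus M y x"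
    and "\<And>x. x \<in> carrier M \<Longrightarrow> mv_plus M (mv_zero M) x = x"
    and "\<And>x. x \<in> carrier M \<Longrightarrow> mv_neg M x \<in> carrier M"
    and "\<And>x. x \<in> carrier M \<Longrightarrow> mv_neg M (mv_neg M x) = x"
    and "\<And>x. x \<in> carrier M \<Longrightarrow> mv_plus M x (mv_one M) = mv_one M"
    and "\<And>x y. \<lbrakk>x \<in> carrier M; y \<in> carrier M\<rbrakk> \<Longrightarrow>
      mv_plus M x (mv_neg M (mv_plus M x (mv_neg M y))) =
      mv_plus M y (mv_neg M (mv_plus M y (mv_neg M x)))"
  shows "mv_algebra M"
proof -
  have "comm_monoid (mv_monoid M)"
    by (rule comm_monoidI) (simp_all add: mv_monoid_def assms(1,2,3,5), rule assms(4))
  then show ?thesis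
    by (intro mv_algebra.intro assms)
qed

lemma mv_epi_wrt_any:
  fixes M :: "('a, 'm) mv_scheme" and N :: "('b, 'n) mv_scheme"
  assumes epi: "mv_epi M N f"
  shows "mv_epi_wrt TYPE('c) M N f"
  unfolding mv_epi_wrt_def
proof (intro conjI allI impI ballI)
  show "f \<in> mv_hom M N"
    using epi by (simp add: mv_epi_def mv_epi_wrt_def)
next
  fix K :: "'c mv" and \<alpha> \<beta> y
  assume K: "mv_algebra K" and a: "\<alpha> \<in> mv_hom N K" and b: "\<beta> \<in> mv_hom N K"
    and eq: "\<forall>x\<in>carrier M. \<alpha> (f x) = \<beta> (f x)" and y: "y \<in> carrier N"
  interpret K: mv_algebra K by (rule K)
  define ev where "ev = mv_eval K (case_sum \<alpha> \<beta>)"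
  define T where "T = {t :: ('b + 'b) mv_term. ev t \<in> carrier K}"
  define c where "c = inv_into T ev"
  define S where "S = ev ` T"
  have SK: "x \<in> carrier K" if "x \<in> S" for x
    using that by (auto simp: S_def T_def)
  have ec: "ev (c x) = x" if "x \<in> S" for x
    using that unfolding S_def c_def by (rule f_inv_into_f)
  have gens: "\<alpha> x \<in> S" "\<beta> x \<in> S" if "x \<in> carrier N" for x
  proof -
    have "\<alpha> x \<in> carrier K" "\<beta> x \<in> carrier K"
      using a b that by (auto simp: mv_hom_def)
    then have "Gen (Inl x) \<in> T" "Gen (Inr x) \<in> T"
      by (auto simp: T_def ev_def)
    moreover have "ev (Gen (Inl x)) = \<alpha> x" "ev (Gen (Inr x)) = \<beta> x"
      by (auto simp: ev_def)
    ultimately show "\<alpha> x \<in> S" "\<beta> x \<in> S"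
      unfolding S_def by (metis image_eqI)+
  qed
  have zero: "mv_zero K \<in> S"
    unfolding S_def T_def
    by (rule image_eqI[where x = TZero]) (auto simp: ev_def K.zero_closed)
  have neg: "mv_neg K x \<in> S" if x: "x \<in> S" for x
  proof -
    obtain t where t: "t \<in> T" "x = ev t" using x by (auto simp: S_def)
    show ?thesis unfolding S_def
      by (rule image_eqI[where x = "TNeg t"]) (use t in \<open>auto simp: ev_def T_def K.neg_closed\<close>)
  qed
  have plus: "mv_plus K x z \<in> S" if xz: "x \<in> S" "z \<in> S" for x z
  proof -
    obtain t s where t: "t \<in> T" "x = ev t" "s \<in> T" "z = ev s" using xz by (auto simp: S_def)
    show ?thesis unfolding S_def
      by (rule image_eqI[where x = "TPlus t s"])
        (use t in \<open>auto simp: ev_def T_def K.plus_closed\<close>)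
  qed
  define K' where "K' = \<lparr>carrier = c ` S,
     mv_plus = (\<lambda>s t. c (mv_plus K (ev s) (ev t))),
     mv_neg = (\<lambda>s. c (mv_neg K (ev s))), mv_zero = c (mv_zero K)\<rparr>"
  have one: "mv_one K' = c (mv_one K)"
    by (simp add: mv_one_def K'_def ec zero)
  have "mv_one K \<in> S" by (simp add: mv_one_def neg zero)
  have "mv_algebra K'"
  proof (rule mv_algebraI, unfold one)
    fix s t assume "s \<in> carrier K'" "t \<in> carrier K'"
    then obtain x y where *: "s = c x" "t = c y" "x \<in> S" "y \<in> S" by (auto simp: K'_def)
    show "mv_plus K' s t \<in> carrier K'" using * by (simp add: K'_def ec plus)
    show "mv_plus K' s t = mv_plus K' t s"
      using * K.plus_comm[of x y] by (simp add: K'_def ec SK)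
    show "mv_plus K' s (mv_neg K' (mv_plus K' s (mv_neg K' t))) =
        mv_plus K' t (mv_neg K' (mv_plus K' t (mv_neg K' s)))"
      using * K.lukasiewicz[of x y] by (simp add: K'_def ec SK plus neg)
  next
    fix s t r assume "s \<in> carrier K'" "t \<in> carrier K'" "r \<in> carrier K'"
    then obtain x y z where *: "s = c x" "t = c y" "r = c z" "x \<in> S" "y \<in> S" "z \<in> S"
      by (auto simp: K'_def)
    show "mv_plus K' (mv_plus K' s t) r = mv_plus K' s (mv_plus K' t r)"
      using * K.plus_assoc[of x y z] by (simp add: K'_def ec SK plus)
  next
    fix s assume "s \<in> carrier K'"
    then obtain x where *: "s = c x" "x \<in> S" by (auto simp: K'_def)
    show "mv_plus K' (mv_zero K') s = s" using * by (simp add: K'_def ec SK zero K.zero_plus)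
    show "mv_neg K' s \<in> carrier K'" using * by (simp add: K'_def ec neg)
    show "mv_neg K' (mv_neg K' s) = s" using * by (simp add: K'_def ec neg SK K.neg_neg)
    show "mv_plus K' s (c (mv_one K)) = c (mv_one K)"
      using * \<open>mv_one K \<in> S\<close> by (simp add: K'_def ec SK K.plus_one)
  qed (simp add: K'_def zero)
  moreover have "c \<circ> \<alpha> \<in> mv_hom N K'" "c \<circ> \<beta> \<in> mv_hom N K'"
    using a b gens by (auto simp: mv_hom_def K'_def ec)
  moreover have "\<forall>x\<in>carrier M. (c \<circ> \<alpha>) (f x) = (c \<circ> \<beta>) (f x)"
    using eq by simp
  ultimately have "(c \<circ> \<alpha>) y = (c \<circ> \<beta>) y"
    using epi y unfolding mv_epi_def mv_epi_wrt_def by blast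
  then show "\<alpha> y = \<beta> y"
    using gens[OF y] ec by (metis comp_apply)
qed

text \<open>
  Epicompleteness with respect to the codomains over one type; a theorem with a free type
  variable \<open>'c\<close> covers all codomains.
\<close>

definition mv_epicomplete :: "'c itself \<Rightarrow> ('a, 'm) mv_scheme \<Rightarrow> bool" where
  "mv_epicomplete TYPE('c) M \<longleftrightarrow>
     (\<forall>(A :: 'c mv) f. mv_algebra A \<longrightarrow> mv_epi M A f \<longrightarrow> f ` carrier M = carrier A)"


section \<open>Abelian lattice ordered groups\<close>

text \<open>Groups are written multiplicatively, as in the library: \<open>\<otimes>\<close> stands for \<open>+\<close>, \<open>\<one>\<close> for \<open>0\<close>,
  \<open>inv\<close> for \<open>-\<close>, and \<open>g [^] n\<close> for \<open>n g\<close>.\<close>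

record 'a lgroup = "'a monoid" +
  lg_le :: "'a \<Rightarrow> 'a \<Rightarrow> bool"

definition lg_order :: "('a, 'm) lgroup_scheme \<Rightarrow> 'a gorder" where
  "lg_order G = \<lparr>carrier = carrier G, eq = (=), le = lg_le G\<rparr>"

locale abelian_lgroup = comm_group G for G :: "('a, 'm) lgroup_scheme" (structure) +
  assumes lattice: "lattice (lg_order G)"
    and translation: "\<lbrakk>x \<in> carrier G; y \<in> carrier G; z \<in> carrier G; lg_le G x y\<rbrakk> \<Longrightarrow>
      lg_le G (x \<otimes> z) (y \<otimes> z)"

definition strong_unit :: "('a, 'm) lgroup_scheme \<Rightarrow> 'a \<Rightarrow> bool" where
  "strong_unit G u \<longleftrightarrow> u \<in> carrier G \<and> lg_le G \<one>\<^bsub>G\<^esub> u \<and>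
     (\<forall>g\<in>carrier G. \<exists>n::nat. lg_le G g (u [^]\<^bsub>G\<^esub> n))"

definition lsubgroup :: "'a set \<Rightarrow> ('a, 'm) lgroup_scheme \<Rightarrow> bool" where
  "lsubgroup K G \<longleftrightarrow> subgroup K G \<and>
     (\<forall>x\<in>K. \<forall>y\<in>K. x \<sqinter>\<^bsub>lg_order G\<^esub> y \<in> K \<and> x \<squnion>\<^bsub>lg_order G\<^esub> y \<in> K)"

definition Gamma :: "('a, 'm) lgroup_scheme \<Rightarrow> 'a \<Rightarrow> 'a mv" where
  "Gamma G u = \<lparr>carrier = {g \<in> carrier G. lg_le G \<one>\<^bsub>G\<^esub> g \<and> lg_le G g u},
     mv_plus = (\<lambda>x y. (x \<otimes>\<^bsub>G\<^esub> y) \<sqinter>\<^bsub>lg_order G\<^esub> u),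
     mv_neg = (\<lambda>x. u \<otimes>\<^bsub>G\<^esub> inv\<^bsub>G\<^esub> x),
     mv_zero = \<one>\<^bsub>G\<^esub>\<rparr>"


text \<open>
  By Mundici's theorem, a subalgebra \<open>S\<close> of \<open>\<Gamma>(H, v)\<close> is \<open>\<Gamma>(K, v)\<close> for exactly one
  \<open>\<ell>\<close>-subgroup \<open>K\<close> of \<open>H\<close> containing \<open>v\<close>; see \<open>unit_lsubgroup_unique\<close> below.
\<close>

definition unit_lsubgroup :: "('a, 'm) lgroup_scheme \<Rightarrow> 'a \<Rightarrow> 'a set \<Rightarrow> 'a set \<Rightarrow> bool" where
  "unit_lsubgroup H v S K \<longleftrightarrow>
     lsubgroup K H \<and> v \<in> K \<and> carrier (Gamma (H\<lparr>carrier := K\<rparr>) v) = S"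


section \<open>The divisible hull\<close>

text \<open>
  The divisible hull of \<open>G\<close> consists of the fractions \<open>g / n\<close> with \<open>n \<ge> 1\<close>;
  \<open>dfrac G g n\<close> is the class of all pairs \<open>(h, m)\<close> with \<open>m g = n h\<close>. The order is the one
  in which \<open>g / n \<le> h / m\<close> iff \<open>m g \<le> n h\<close>.
\<close>

definition dfrac :: "('a, 'm) lgroup_scheme \<Rightarrow> 'a \<Rightarrow> nat \<Rightarrow> ('a \<times> nat) set" where
  "dfrac G g n = {(h, m). h \<in> carrier G \<and> m \<ge> 1 \<and> g [^]\<^bsub>G\<^esub> m = h [^]\<^bsub>G\<^esub> n}"

definition dhull :: "('a, 'm) lgroup_scheme \<Rightarrow> ('a \<times> nat) set lgroup" where
  "dhull G = \<lparr>carrier = {dfrac G g n | g n. g \<in> carrier G \<and> n \<ge> 1},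
     mult = (\<lambda>X Y. \<Union>(g, n)\<in>X. \<Union>(h, m)\<in>Y.
       dfrac G (g [^]\<^bsub>G\<^esub> m \<otimes>\<^bsub>G\<^esub> h [^]\<^bsub>G\<^esub> n) (n * m)),
     one = dfrac G \<one>\<^bsub>G\<^esub> 1,
     lg_le = (\<lambda>X Y. \<forall>(g, n)\<in>X. \<forall>(h, m)\<in>Y. lg_le G (g [^]\<^bsub>G\<^esub> m) (h [^]\<^bsub>G\<^esub> n))\<rparr>"

definition dhull_emb :: "('a, 'm) lgroup_scheme \<Rightarrow> 'a \<Rightarrow> ('a \<times> nat) set" where
  "dhull_emb G g = dfrac G g 1"

text \<open>For an \<open>\<ell>\<close>-subgroup \<open>K\<close> of \<open>G\<close>, the hull of \<open>K\<close> as an \<open>\<ell>\<close>-subgroup of the hull of \<open>G\<close>: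
  the same fractions \<open>k / n\<close> with \<open>k \<in> K\<close>, formed as classes in \<open>G\<close>.\<close>

definition dhull_sub :: "('a, 'm) lgroup_scheme \<Rightarrow> 'a set \<Rightarrow> ('a \<times> nat) set lgroup" where
  "dhull_sub G K = (dhull G)\<lparr>carrier := {dfrac G g n | g n. g \<in> K \<and> n \<ge> 1}\<rparr>"

section \<open>Consistency of the definitions\<close>

text \<open>\<open>\<Gamma>(G, u)\<close> is an MV-algebra; the hull is again an Abelian \<open>\<ell>\<close>-group, it is divisible, and
  \<open>G\<close> embeds into it; the \<open>\<ell>\<close>-group of a subalgebra is unique.\<close>

lemma lg_order_simps:
  "carrier (lg_order G) = carrier G" "x \<sqsubseteq>\<^bsub>lg_order G\<^esub> y \<longleftrightarrow> lg_le G x y" "x .=\<^bsub>lg_order G\<^esub> y \<longleftrightarrow> x = y"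
  by (simp_all add: lg_order_def)

context abelian_lgroup
begin

abbreviation lle (infix \<open>\<preceq>\<close> 50) where "x \<preceq> y \<equiv> lg_le G x y"

lemma le_facts:
  shows le_refl: "x \<in> carrier G \<Longrightarrow> x \<preceq> x"
    and le_trans: "\<lbrakk>x \<preceq> y; y \<preceq> z; x \<in> carrier G; y \<in> carrier G; z \<in> carrier G\<rbrakk> \<Longrightarrow> x \<preceq> z"
    and le_antisym: "\<lbrakk>x \<preceq> y; y \<preceq> x; x \<in> carrier G; y \<in> carrier G\<rbrakk> \<Longrightarrow> x = y"
proof -
  interpret L: lattice "lg_order G" by (rule lattice)
  show "x \<in> carrier G \<Longrightarrow> x \<preceq> x"
    using L.le_refl[of x] by (simp add: lg_order_def)
  show "\<lbrakk>x \<preceq> y; y \<preceq> z; x \<in> carrier G; y \<in> carrier G; z \<in> carrier G\<rbrakk> \<Longrightarrow> x \<preceq> z"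
    using L.le_trans[of x y z] by (simp add: lg_order_def)
  show "\<lbrakk>x \<preceq> y; y \<preceq> x; x \<in> carrier G; y \<in> carrier G\<rbrakk> \<Longrightarrow> x = y"
    using L.le_antisym[of x y] by (simp add: lg_order_def)
qed

lemma join_facts:
  assumes "x \<in> carrier G" "y \<in> carrier G"
  shows join_closed: "x \<squnion>\<^bsub>lg_order G\<^esub> y \<in> carrier G"
    and join_left: "x \<preceq> x \<squnion>\<^bsub>lg_order G\<^esub> y"
    and join_right: "y \<preceq> x \<squnion>\<^bsub>lg_order G\<^esub> y"
    and join_le: "\<lbrakk>z \<in> carrier G; x \<preceq> z; y \<preceq> z\<rbrakk> \<Longrightarrow> x \<squnion>\<^bsub>lg_order G\<^esub> y \<preceq> z"
proof -
  interpret L: lattice "lg_order G" by (rule lattice)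
  have *: "x \<in> carrier (lg_order G)" "y \<in> carrier (lg_order G)"
    using assms by (auto simp: lg_order_def)
  show "x \<squnion>\<^bsub>lg_order G\<^esub> y \<in> carrier G"
    using L.join_closed[OF *] by (simp add: lg_order_def)
  show "x \<preceq> x \<squnion>\<^bsub>lg_order G\<^esub> y"
    using L.join_left[OF *] by (simp add: lg_order_def)
  show "y \<preceq> x \<squnion>\<^bsub>lg_order G\<^esub> y"
    using L.join_right[OF *] by (simp add: lg_order_def)
  show "\<lbrakk>z \<in> carrier G; x \<preceq> z; y \<preceq> z\<rbrakk> \<Longrightarrow> x \<squnion>\<^bsub>lg_order G\<^esub> y \<preceq> z"
    using L.join_le[OF _ _ *, of z] by (simp add: lg_order_def)
qed

lemma meet_facts:
  assumes "x \<in> carrier G" "y \<in> carrier G"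
  shows meet_closed: "x \<sqinter>\<^bsub>lg_order G\<^esub> y \<in> carrier G"
    and meet_left: "x \<sqinter>\<^bsub>lg_order G\<^esub> y \<preceq> x"
    and meet_right: "x \<sqinter>\<^bsub>lg_order G\<^esub> y \<preceq> y"
    and meet_le: "\<lbrakk>z \<in> carrier G; z \<preceq> x; z \<preceq> y\<rbrakk> \<Longrightarrow> z \<preceq> x \<sqinter>\<^bsub>lg_order G\<^esub> y"
proof -
  interpret L: lattice "lg_order G" by (rule lattice)
  have *: "x \<in> carrier (lg_order G)" "y \<in> carrier (lg_order G)"
    using assms by (auto simp: lg_order_def)
  show "x \<sqinter>\<^bsub>lg_order G\<^esub> y \<in> carrier G"
    using L.meet_closed[OF *] by (simp add: lg_order_def)
  show "x \<sqinter>\<^bsub>lg_order G\<^esub> y \<preceq> x"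
    using L.meet_left[OF *] by (simp add: lg_order_def)
  show "x \<sqinter>\<^bsub>lg_order G\<^esub> y \<preceq> y"
    using L.meet_right[OF *] by (simp add: lg_order_def)
  show "\<lbrakk>z \<in> carrier G; z \<preceq> x; z \<preceq> y\<rbrakk> \<Longrightarrow> z \<preceq> x \<sqinter>\<^bsub>lg_order G\<^esub> y"
    using L.meet_le[OF _ _ *, of z] by (simp add: lg_order_def)
qed

lemma mult_mono:
  assumes "a \<preceq> b" "c \<preceq> d" "a \<in> carrier G" "b \<in> carrier G" "c \<in> carrier G" "d \<in> carrier G"
  shows "a \<otimes> c \<preceq> b \<otimes> d"
proof -
  have "a \<otimes> c \<preceq> b \<otimes> c" using assms by (simp add: translation)
  moreover have "b \<otimes> c \<preceq> b \<otimes> d" using translation[of c d b] assms by (simp add: m_comm)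
  ultimately show ?thesis using assms by (meson le_trans m_closed)
qed

lemma le_cancel:
  assumes "a \<otimes> c \<preceq> b \<otimes> c" "a \<in> carrier G" "b \<in> carrier G" "c \<in> carrier G"
  shows "a \<preceq> b"
  using translation[of "a \<otimes> c" "b \<otimes> c" "inv c"] assms by (simp add: m_assoc)

lemma pow_mono:
  assumes "a \<preceq> b" "a \<in> carrier G" "b \<in> carrier G"
  shows "a [^] (n::nat) \<preceq> b [^] n"
  by (induction n) (use assms in \<open>auto intro: le_refl mult_mono\<close>)

lemma join_pow_le:
  assumes "a \<in> carrier G" "b \<in> carrier G" "d \<in> carrier G" "e \<in> carrier G"
    and "\<And>i j. i + j = (n::nat) \<Longrightarrow> a [^] i \<otimes> b [^] j \<otimes> e \<preceq> d"
  shows "(a \<squnion>\<^bsub>lg_order G\<^esub> b) [^] n \<otimes> e \<preceq> d"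
  using assms(4,5)
proof (induction n arbitrary: e)
  case 0
  then show ?case using "0.prems"(2)[of 0 0] by simp
next
  case (Suc n)
  let ?j = "a \<squnion>\<^bsub>lg_order G\<^esub> b"
  have j: "?j \<in> carrier G" using assms join_closed by blast
  define p where "p = ?j [^] n \<otimes> e"
  have p: "p \<in> carrier G" using j Suc.prems by (simp add: p_def)
  have 1: "?j [^] n \<otimes> (a \<otimes> e) \<preceq> d"
  proof (rule Suc.IH)
    fix i k :: nat assume "i + k = n"
    then show "a [^] i \<otimes> b [^] k \<otimes> (a \<otimes> e) \<preceq> d"
      using Suc.prems(2)[of "Suc i" k] assms Suc.prems(1) by (simp add: m_ac)
  qed (use assms Suc.prems in auto)
  have 2: "?j [^] n \<otimes> (b \<otimes> e) \<preceq> d"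
  proof (rule Suc.IH)
    fix i k :: nat assume "i + k = n"
    then show "a [^] i \<otimes> b [^] k \<otimes> (b \<otimes> e) \<preceq> d"
      using Suc.prems(2)[of i "Suc k"] assms Suc.prems(1) by (simp add: m_ac)
  qed (use assms Suc.prems in auto)
  have "a \<preceq> d \<otimes> inv p" if "x = a" for x
    using 1 assms j Suc.prems(1) p
    by (intro le_cancel[of a p "d \<otimes> inv p"]) (auto simp: m_assoc p_def m_ac)
  moreover have "b \<preceq> d \<otimes> inv p"
    using 2 assms j Suc.prems(1) p
    by (intro le_cancel[of b p "d \<otimes> inv p"]) (auto simp: m_assoc p_def m_ac)
  ultimately have "?j \<preceq> d \<otimes> inv p" using assms p by (simp add: join_le)
  then have "?j \<otimes> p \<preceq> (d \<otimes> inv p) \<otimes> p"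
    using j p assms by (simp add: translation)
  then show ?case using j p assms Suc.prems(1) by (simp add: m_assoc p_def m_ac)
qed

lemma pow_le_one:
  assumes z: "z \<in> carrier G" and n: "(n::nat) \<ge> 1" and le: "z [^] n \<preceq> \<one>"
  shows "z \<preceq> \<one>"
proof -
  obtain m where m: "n = Suc m" using n by (cases n) auto
  let ?j = "z \<squnion>\<^bsub>lg_order G\<^esub> \<one>"
  have j: "?j \<in> carrier G" "\<one> \<preceq> ?j" "z \<preceq> ?j" using z by (auto simp: join_closed join_left join_right)
  have one: "\<one> \<preceq> ?j [^] k" for k :: nat
    using pow_mono[OF j(2) one_closed j(1), of k] by simp
  have "?j [^] n \<otimes> \<one> \<preceq> ?j [^] m"
  proof (rule join_pow_le)
    fix i k :: nat assume ik: "i + k = n"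
    show "z [^] i \<otimes> \<one> [^] k \<otimes> \<one> \<preceq> ?j [^] m"
    proof (cases "i = n")
      case True
      then show ?thesis using le_trans[OF le one[of m]] z j ik by simp
    next
      case False
      then have "i + (m - i) = m" using ik m by auto
      then have "?j [^] m = ?j [^] i \<otimes> ?j [^] (m - i)"
        using nat_pow_mult[OF j(1), of i "m - i"] by simp
      moreover have "z [^] i \<otimes> \<one> \<preceq> ?j [^] i \<otimes> ?j [^] (m - i)"
        using pow_mono[OF j(3) z j(1), of i] one j z by (intro mult_mono) auto
      ultimately show ?thesis using z by simp
    qed
  qed (use z j in auto)
  then have "?j \<otimes> ?j [^] m \<preceq> \<one> \<otimes> ?j [^] m"
    using j m nat_pow_Suc2[OF j(1), of m] by simp
  from le_cancel[OF this] have "?j \<preceq> \<one>" using j by simp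
  then show ?thesis using le_trans[OF j(3)] j z by simp
qed

lemma pow_le_iff:
  assumes "a \<in> carrier G" "b \<in> carrier G" "(n::nat) \<ge> 1"
  shows "a [^] n \<preceq> b [^] n \<longleftrightarrow> a \<preceq> b"
proof
  assume *: "a [^] n \<preceq> b [^] n"
  have "(a \<otimes> inv b) [^] n = a [^] n \<otimes> inv (b [^] n)"
    using assms by (simp add: pow_mult_distrib m_comm nat_pow_inv)
  also have "\<dots> \<preceq> b [^] n \<otimes> inv (b [^] n)"
    using translation[OF _ _ _ *, of "inv (b [^] n)"] assms by simp
  also have "b [^] n \<otimes> inv (b [^] n) = \<one>" using assms by simp
  finally have "a \<otimes> inv b \<preceq> \<one>" using assms pow_le_one by simp
  from translation[OF _ _ _ this, of b] show "a \<preceq> b"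
    using assms by (simp add: m_assoc)
qed (use assms pow_mono in blast)

lemma pow_eq_iff:
  assumes "a \<in> carrier G" "b \<in> carrier G" "(n::nat) \<ge> 1"
  shows "a [^] n = b [^] n \<longleftrightarrow> a = b"
  using assms by (metis le_antisym le_refl pow_le_iff)

lemma join_pow_le_iff:
  assumes "a \<in> carrier G" "b \<in> carrier G" "c \<in> carrier G" "(p::nat) \<ge> 1"
    and "a [^] p \<preceq> c" "b [^] p \<preceq> c"
  shows "(a \<squnion>\<^bsub>lg_order G\<^esub> b) [^] p \<preceq> c"
proof -
  have "(a \<squnion>\<^bsub>lg_order G\<^esub> b) [^] p \<otimes> \<one> \<preceq> c"
  proof (rule join_pow_le)
    fix i j :: nat assume ij: "i + j = p"
    have "(a [^] i \<otimes> b [^] j) [^] p = (a [^] p) [^] i \<otimes> (b [^] p) [^] j"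
      using assms by (simp add: pow_mult_distrib m_comm nat_pow_pow mult.commute)
    also have "\<dots> \<preceq> c [^] i \<otimes> c [^] j"
      using assms by (intro mult_mono pow_mono) auto
    also have "\<dots> = c [^] p" using assms ij by (simp add: nat_pow_mult)
    finally show "a [^] i \<otimes> b [^] j \<otimes> \<one> \<preceq> c"
      using assms pow_le_iff[of "a [^] i \<otimes> b [^] j" c p] by simp
  qed (use assms in auto)
  then show ?thesis using assms by (simp add: join_closed)
qed

lemma inv_le_inv:
  assumes "a \<preceq> b" "a \<in> carrier G" "b \<in> carrier G"
  shows "inv b \<preceq> inv a"
proof -
  have "a \<otimes> (inv a \<otimes> inv b) = inv b" using assms by (simp add: m_assoc[symmetric])
  moreover have "b \<otimes> (inv a \<otimes> inv b) = inv a" using assms by (simp add: m_lcomm[of b])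
  ultimately show ?thesis
    using translation[OF _ _ _ assms(1), of "inv a \<otimes> inv b"] assms by simp
qed

lemma le_meet_pow:
  assumes "a \<in> carrier G" "b \<in> carrier G" "c \<in> carrier G" "(p::nat) \<ge> 1"
    and "c \<preceq> a [^] p" "c \<preceq> b [^] p"
  shows "c \<preceq> (a \<sqinter>\<^bsub>lg_order G\<^esub> b) [^] p"
proof -
  let ?j = "inv a \<squnion>\<^bsub>lg_order G\<^esub> inv b"
  have j: "?j \<in> carrier G" "inv a \<preceq> ?j" "inv b \<preceq> ?j"
    using assms by (auto simp: join_closed join_left join_right)
  have "?j [^] p \<preceq> inv c"
    using assms inv_le_inv[of c "a [^] p"] inv_le_inv[of c "b [^] p"]
    by (intro join_pow_le_iff) (auto simp: nat_pow_inv)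
  from inv_le_inv[OF this] have "c \<preceq> (inv ?j) [^] p"
    using j assms by (simp add: nat_pow_inv)
  moreover have "inv ?j \<preceq> a" "inv ?j \<preceq> b"
    using inv_le_inv[OF j(2)] inv_le_inv[OF j(3)] j assms by auto
  then have "inv ?j \<preceq> a \<sqinter>\<^bsub>lg_order G\<^esub> b"
    using j assms by (simp add: meet_le)
  then have "(inv ?j) [^] p \<preceq> (a \<sqinter>\<^bsub>lg_order G\<^esub> b) [^] p"
    using j assms by (intro pow_mono) (auto simp: meet_closed)
  ultimately show ?thesis
    using j assms by (meson le_trans inv_closed nat_pow_closed meet_closed)
qed

lemma dfrac_eq_iff:
  assumes "g \<in> carrier G" "h \<in> carrier G" "n \<ge> 1" "m \<ge> 1"
  shows "dfrac G g n = dfrac G h m \<longleftrightarrow> g [^] m = h [^] n"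
proof
  assume "dfrac G g n = dfrac G h m"
  moreover have "(h, m) \<in> dfrac G h m" using assms by (simp add: dfrac_def)
  ultimately have "(h, m) \<in> dfrac G g n" by simp
  then show "g [^] m = h [^] n" by (simp add: dfrac_def)
next
  assume e: "g [^] m = h [^] n"
  have "g [^] p = k [^] n \<longleftrightarrow> h [^] p = k [^] m" if "k \<in> carrier G" "p \<ge> 1" for k and p :: nat
  proof -
    have "g [^] p = k [^] n \<longleftrightarrow> (g [^] p) [^] m = (k [^] n) [^] m"
      using assms that by (simp add: pow_eq_iff)
    also have "(g [^] p) [^] m = (g [^] m) [^] p"
      using assms by (simp add: nat_pow_pow mult.commute)
    also have "\<dots> = (h [^] p) [^] n"
      using assms by (simp add: nat_pow_pow mult.commute e)
    also have "(k [^] n) [^] m = (k [^] m) [^] n"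
      using that by (simp add: nat_pow_pow mult.commute)
    also have "(h [^] p) [^] n = (k [^] m) [^] n \<longleftrightarrow> h [^] p = k [^] m"
      using assms that by (simp add: pow_eq_iff)
    finally show ?thesis .
  qed
  then show "dfrac G g n = dfrac G h m" by (auto simp: dfrac_def)
qed

lemma dfrac_memD:
  assumes "(h, m) \<in> dfrac G g n" "g \<in> carrier G" "n \<ge> 1"
  shows "h \<in> carrier G" "m \<ge> 1" "dfrac G h m = dfrac G g n"
  using assms dfrac_eq_iff[of h g m n] by (auto simp: dfrac_def)

lemma dfrac_self: "g \<in> carrier G \<Longrightarrow> n \<ge> 1 \<Longrightarrow> (g, n) \<in> dfrac G g n"
  by (simp add: dfrac_def)

lemma dfrac_expand:
  assumes "g \<in> carrier G" "n \<ge> 1" "k \<ge> 1"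
  shows "dfrac G (g [^] k) (n * k) = dfrac G g n"
  using assms by (subst dfrac_eq_iff) (auto simp: nat_pow_pow mult.commute)

lemma dhull_mult:
  assumes "g \<in> carrier G" "h \<in> carrier G" "n \<ge> 1" "m \<ge> 1"
  shows "dfrac G g n \<otimes>\<^bsub>dhull G\<^esub> dfrac G h m = dfrac G (g [^] m \<otimes> h [^] n) (n * m)"
proof -
  have *: "dfrac G (g' [^] m' \<otimes> h' [^] n') (n' * m') = dfrac G (g [^] m \<otimes> h [^] n) (n * m)"
    if "(g', n') \<in> dfrac G g n" "(h', m') \<in> dfrac G h m" for g' n' h' m'
  proof -
    note 1 = dfrac_memD[OF that(1) assms(1,3)] and 2 = dfrac_memD[OF that(2) assms(2,4)]
    have e: "g' [^] n = g [^] n'" "h' [^] m = h [^] m'"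
      using that by (auto simp: dfrac_def)
    have "(g' [^] m' \<otimes> h' [^] n') [^] (n * m)
        = (g' [^] n) [^] (m' * m) \<otimes> (h' [^] m) [^] (n' * n)"
      using 1 2 by (simp add: pow_mult_distrib m_comm nat_pow_pow mult_ac)
    also have "\<dots> = (g [^] m \<otimes> h [^] n) [^] (n' * m')"
      unfolding e using assms by (simp add: pow_mult_distrib m_comm nat_pow_pow mult_ac)
    finally show ?thesis
      using 1 2 assms by (subst dfrac_eq_iff) auto
  qed
  have "dfrac G g n \<otimes>\<^bsub>dhull G\<^esub> dfrac G h m = (\<Union>(g', n')\<in>dfrac G g n. \<Union>(h', m')\<in>dfrac G h m.
       dfrac G (g' [^] m' \<otimes> h' [^] n') (n' * m'))"
    by (simp add: dhull_def)
  also have "\<dots> = (\<Union>x\<in>dfrac G g n. \<Union>y\<in>dfrac G h m. dfrac G (g [^] m \<otimes> h [^] n) (n * m))"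
    by (intro SUP_cong refl) (auto simp: *)
  also have "\<dots> = dfrac G (g [^] m \<otimes> h [^] n) (n * m)"
    using dfrac_self[of g n] dfrac_self[of h m] assms by blast
  finally show ?thesis .
qed

lemma dhull_le:
  assumes "g \<in> carrier G" "h \<in> carrier G" "n \<ge> 1" "m \<ge> 1"
  shows "lg_le (dhull G) (dfrac G g n) (dfrac G h m) \<longleftrightarrow> g [^] m \<preceq> h [^] n"
proof
  show "lg_le (dhull G) (dfrac G g n) (dfrac G h m) \<Longrightarrow> g [^] m \<preceq> h [^] n"
    using dfrac_self[of g n] dfrac_self[of h m] assms by (auto simp: dhull_def)
next
  assume le: "g [^] m \<preceq> h [^] n"
  have "g' [^] m' \<preceq> h' [^] n'"
    if "(g', n') \<in> dfrac G g n" "(h', m') \<in> dfrac G h m" for g' n' h' m'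
  proof -
    note 1 = dfrac_memD[OF that(1) assms(1,3)] and 2 = dfrac_memD[OF that(2) assms(2,4)]
    have e: "g' [^] n = g [^] n'" "h' [^] m = h [^] m'"
      using that by (auto simp: dfrac_def)
    have "(g' [^] m') [^] (n * m) = (g' [^] n) [^] (m' * m)"
      using 1 by (simp add: nat_pow_pow mult_ac)
    also have "\<dots> = (g [^] m) [^] (n' * m')"
      unfolding e using assms by (simp add: nat_pow_pow mult_ac)
    also have "\<dots> \<preceq> (h [^] n) [^] (n' * m')"
      using le assms by (intro pow_mono) auto
    also have "(h [^] n) [^] (n' * m') = (h [^] m') [^] (n * n')"
      using assms by (simp add: nat_pow_pow mult_ac)
    also have "\<dots> = (h' [^] n') [^] (n * m)"
      unfolding e(2)[symmetric] using 2 by (simp add: nat_pow_pow mult_ac)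
    finally show ?thesis
      using 1 2 assms pow_le_iff[of "g' [^] m'" "h' [^] n'" "n * m"] by simp
  qed
  then show "lg_le (dhull G) (dfrac G g n) (dfrac G h m)"
    by (auto simp: dhull_def)
qed

lemma dhull_mult_same:
  assumes "g \<in> carrier G" "h \<in> carrier G" "n \<ge> 1"
  shows "dfrac G g n \<otimes>\<^bsub>dhull G\<^esub> dfrac G h n = dfrac G (g \<otimes> h) n"
  using assms dfrac_expand[of "g \<otimes> h" n n]
  by (simp add: dhull_mult pow_mult_distrib m_comm)

lemma dhull_le_same:
  assumes "g \<in> carrier G" "h \<in> carrier G" "n \<ge> 1"
  shows "lg_le (dhull G) (dfrac G g n) (dfrac G h n) \<longleftrightarrow> g \<preceq> h"
  using assms by (simp add: dhull_le pow_le_iff)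

lemma dhull_common:
  assumes "X \<in> carrier (dhull G)" "Y \<in> carrier (dhull G)" "Z \<in> carrier (dhull G)"
  obtains a b c n where "a \<in> carrier G" "b \<in> carrier G" "c \<in> carrier G" "n \<ge> 1"
    "X = dfrac G a n" "Y = dfrac G b n" "Z = dfrac G c n"
proof -
  from assms obtain g h k l m p where *: "X = dfrac G g l" "Y = dfrac G h m" "Z = dfrac G k p"
    "g \<in> carrier G" "h \<in> carrier G" "k \<in> carrier G" "l \<ge> 1" "m \<ge> 1" "p \<ge> 1"
    by (auto simp: dhull_def)
  show thesis
  proof (rule that)
    show "X = dfrac G (g [^] (m * p)) (l * m * p)"
      using dfrac_expand[of g l "m * p"] * by (simp add: mult_ac)
    show "Y = dfrac G (h [^] (l * p)) (l * m * p)"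
      using dfrac_expand[of h m "l * p"] * by (simp add: mult_ac)
    show "Z = dfrac G (k [^] (l * m)) (l * m * p)"
      using dfrac_expand[of k p "l * m"] * by (simp add: mult_ac)
  qed (use * in auto)
qed

lemma dhull_one: "n \<ge> 1 \<Longrightarrow> \<one>\<^bsub>dhull G\<^esub> = dfrac G \<one> n"
  using dfrac_eq_iff[of \<one> \<one> 1 n] by (simp add: dhull_def)

lemma dfrac_in_dhull: "g \<in> carrier G \<Longrightarrow> n \<ge> 1 \<Longrightarrow> dfrac G g n \<in> carrier (dhull G)"
  by (auto simp: dhull_def)

theorem dhull_abelian_lgroup: "abelian_lgroup (dhull G)"
proof -
  have grp: "comm_group (dhull G)"
  proof (rule comm_groupI)
    fix X Y Z assume "X \<in> carrier (dhull G)" "Y \<in> carrier (dhull G)" "Z \<in> carrier (dhull G)"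
    from dhull_common[OF this] obtain a b c n where *: "a \<in> carrier G" "b \<in> carrier G"
      "c \<in> carrier G" "n \<ge> 1" "X = dfrac G a n" "Y = dfrac G b n" "Z = dfrac G c n" .
    then show "X \<otimes>\<^bsub>dhull G\<^esub> Y \<otimes>\<^bsub>dhull G\<^esub> Z = X \<otimes>\<^bsub>dhull G\<^esub> (Y \<otimes>\<^bsub>dhull G\<^esub> Z)"
      by (simp add: dhull_mult_same m_assoc)
  next
    fix X Y assume "X \<in> carrier (dhull G)" "Y \<in> carrier (dhull G)"
    from dhull_common[OF this this(1)] obtain a b c n where *: "a \<in> carrier G" "b \<in> carrier G"
      "c \<in> carrier G" "n \<ge> 1" "X = dfrac G a n" "Y = dfrac G b n" .
    then show "X \<otimes>\<^bsub>dhull G\<^esub> Y = Y \<otimes>\<^bsub>dhull G\<^esub> X" "X \<otimes>\<^bsub>dhull G\<^esub> Y \<in> carrier (dhull G)"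
      by (simp_all add: dhull_mult_same m_comm dfrac_in_dhull)
  next
    fix X assume "X \<in> carrier (dhull G)"
    from dhull_common[OF this this this] obtain a n where *: "a \<in> carrier G" "n \<ge> 1"
      "X = dfrac G a n" by metis
    then show "\<one>\<^bsub>dhull G\<^esub> \<otimes>\<^bsub>dhull G\<^esub> X = X"
      by (simp add: dhull_one[of n] dhull_mult_same)
    show "\<exists>Y\<in>carrier (dhull G). Y \<otimes>\<^bsub>dhull G\<^esub> X = \<one>\<^bsub>dhull G\<^esub>"
      using * by (intro bexI[of _ "dfrac G (inv a) n"])
        (auto simp: dhull_one[of n] dhull_mult_same dfrac_in_dhull)
  qed (auto simp: dhull_one[of 1] dfrac_in_dhull)
  interpret D: comm_group "dhull G" by (rule grp)
  have po: "partial_order (lg_order (dhull G))"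
  proof
    fix X Y Z
    assume "X \<in> carrier (lg_order (dhull G))" "Y \<in> carrier (lg_order (dhull G))"
      "Z \<in> carrier (lg_order (dhull G))"
    then have "X \<in> carrier (dhull G)" "Y \<in> carrier (dhull G)" "Z \<in> carrier (dhull G)"
      by (auto simp: lg_order_def)
    from dhull_common[OF this] obtain a b c n where *: "a \<in> carrier G" "b \<in> carrier G"
      "c \<in> carrier G" "n \<ge> 1" "X = dfrac G a n" "Y = dfrac G b n" "Z = dfrac G c n" .
    assume "X \<sqsubseteq>\<^bsub>lg_order (dhull G)\<^esub> Y" "Y \<sqsubseteq>\<^bsub>lg_order (dhull G)\<^esub> Z"
    then show "X \<sqsubseteq>\<^bsub>lg_order (dhull G)\<^esub> Z"
      using * le_trans[of a b c] by (simp add: lg_order_def dhull_le_same)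
  next
    fix X Y
    assume XY: "X \<in> carrier (lg_order (dhull G))" "Y \<in> carrier (lg_order (dhull G))"
    then have "X \<in> carrier (dhull G)" "Y \<in> carrier (dhull G)"
      by (auto simp: lg_order_def)
    from dhull_common[OF this this(1)] obtain a b c n where *: "a \<in> carrier G" "b \<in> carrier G"
      "c \<in> carrier G" "n \<ge> 1" "X = dfrac G a n" "Y = dfrac G b n" .
    assume "X \<sqsubseteq>\<^bsub>lg_order (dhull G)\<^esub> Y" "Y \<sqsubseteq>\<^bsub>lg_order (dhull G)\<^esub> X"
    then show "X .=\<^bsub>lg_order (dhull G)\<^esub> Y"
      using * le_antisym[of a b] by (simp add: lg_order_def dhull_le_same)
  next
    fix X assume "X \<in> carrier (lg_order (dhull G))"
    then have "X \<in> carrier (dhull G)" by (auto simp: lg_order_def)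
    from dhull_common[OF this this this] obtain a n where *: "a \<in> carrier G" "n \<ge> 1"
      "X = dfrac G a n" by metis
    then show "X \<sqsubseteq>\<^bsub>lg_order (dhull G)\<^esub> X"
      by (simp add: lg_order_def dhull_le_same le_refl)
  qed (auto simp: lg_order_def)
  interpret P: partial_order "lg_order (dhull G)" by (rule po)
  have lat: "lattice (lg_order (dhull G))"
  proof
    fix X Y
    assume "X \<in> carrier (lg_order (dhull G))" "Y \<in> carrier (lg_order (dhull G))"
    then have XY: "X \<in> carrier (dhull G)" "Y \<in> carrier (dhull G)"
      by (auto simp: lg_order_def)
    from dhull_common[OF XY XY(1)] obtain a b c n where *: "a \<in> carrier G" "b \<in> carrier G"
      "c \<in> carrier G" "n \<ge> 1" "X = dfrac G a n" "Y = dfrac G b n" .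
    have "least (lg_order (dhull G)) (dfrac G (a \<squnion>\<^bsub>lg_order G\<^esub> b) n)
        (Upper (lg_order (dhull G)) {X, Y})"
    proof (rule least_UpperI)
      fix Z assume Z: "Z \<in> Upper (lg_order (dhull G)) {X, Y}"
      then have ZD: "Z \<in> carrier (dhull G)" by (auto simp: Upper_def lg_order_def)
      have le: "lg_le (dhull G) X Z" "lg_le (dhull G) Y Z"
        using Z XY by (auto simp: Upper_def lg_order_def)
      from ZD obtain k p where kp: "k \<in> carrier G" "p \<ge> 1" "Z = dfrac G k p"
        by (auto simp: dhull_def)
      have ap: "a [^] p \<preceq> k [^] n" and bp: "b [^] p \<preceq> k [^] n"
        using le kp * by (auto simp: dhull_le)
      have "(a \<squnion>\<^bsub>lg_order G\<^esub> b) [^] p \<preceq> k [^] n"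
        using ap bp * kp by (intro join_pow_le_iff) auto
      then show "dfrac G (a \<squnion>\<^bsub>lg_order G\<^esub> b) n \<sqsubseteq>\<^bsub>lg_order (dhull G)\<^esub> Z"
        using * kp join_closed by (simp add: lg_order_def dhull_le)
    qed (use * XY in \<open>auto simp: lg_order_simps dhull_le_same join_closed join_left join_right dfrac_in_dhull\<close>)
    then show "\<exists>s. least (lg_order (dhull G)) s (Upper (lg_order (dhull G)) {X, Y})" ..
    have "greatest (lg_order (dhull G)) (dfrac G (a \<sqinter>\<^bsub>lg_order G\<^esub> b) n)
        (Lower (lg_order (dhull G)) {X, Y})"
    proof (rule greatest_LowerI)
      fix Z assume Z: "Z \<in> Lower (lg_order (dhull G)) {X, Y}"
      then have ZD: "Z \<in> carrier (dhull G)" by (auto simp: Lower_def lg_order_def)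
      have le: "lg_le (dhull G) Z X" "lg_le (dhull G) Z Y"
        using Z XY by (auto simp: Lower_def lg_order_def)
      from ZD obtain k p where kp: "k \<in> carrier G" "p \<ge> 1" "Z = dfrac G k p"
        by (auto simp: dhull_def)
      have ap: "k [^] n \<preceq> a [^] p" and bp: "k [^] n \<preceq> b [^] p"
        using le kp * by (auto simp: dhull_le)
      have "k [^] n \<preceq> (a \<sqinter>\<^bsub>lg_order G\<^esub> b) [^] p"
        using ap bp * kp by (intro le_meet_pow) auto
      then show "Z \<sqsubseteq>\<^bsub>lg_order (dhull G)\<^esub> dfrac G (a \<sqinter>\<^bsub>lg_order G\<^esub> b) n"
        using * kp meet_closed by (simp add: lg_order_def dhull_le)
    qed (use * XY in \<open>auto simp: lg_order_simps dhull_le_same meet_closed meet_left meet_right dfrac_in_dhull\<close>)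
    then show "\<exists>s. greatest (lg_order (dhull G)) s (Lower (lg_order (dhull G)) {X, Y})" ..
  qed
  have tr: "lg_le (dhull G) (X \<otimes>\<^bsub>dhull G\<^esub> Z) (Y \<otimes>\<^bsub>dhull G\<^esub> Z)"
    if "X \<in> carrier (dhull G)" "Y \<in> carrier (dhull G)" "Z \<in> carrier (dhull G)"
      and le: "lg_le (dhull G) X Y" for X Y Z
  proof -
    from dhull_common[OF that(1-3)] obtain a b c n where *: "a \<in> carrier G" "b \<in> carrier G"
      "c \<in> carrier G" "n \<ge> 1" "X = dfrac G a n" "Y = dfrac G b n" "Z = dfrac G c n" .
    then show ?thesis
      using le by (simp add: dhull_mult_same dhull_le_same translation)
  qed
  show ?thesis
    by (intro abelian_lgroup.intro abelian_lgroup_axioms.intro grp lat tr)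
qed

theorem dhull_divisible:
  assumes "X \<in> carrier (dhull G)" "n \<ge> 1"
  shows "\<exists>Y\<in>carrier (dhull G). Y [^]\<^bsub>dhull G\<^esub> (n::nat) = X"
proof -
  interpret D: abelian_lgroup "dhull G" by (rule dhull_abelian_lgroup)
  from assms obtain g m where g: "g \<in> carrier G" "m \<ge> 1" "X = dfrac G g m"
    by (auto simp: dhull_def)
  have "dfrac G g k [^]\<^bsub>dhull G\<^esub> (i::nat) = dfrac G (g [^] i) k" if "k \<ge> 1" for i k
    using that g by (induction i) (auto simp: dhull_mult_same dhull_one[of k])
  then have "dfrac G g (m * n) [^]\<^bsub>dhull G\<^esub> n = X"
    using g assms(2) dfrac_expand[of g m n] by simp
  then show ?thesis using g assms(2) by (intro bexI[of _ "dfrac G g (m * n)"] dfrac_in_dhull) auto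
qed

theorem dhull_emb:
  shows "dhull_emb G \<in> hom G (dhull G)" "inj_on (dhull_emb G) (carrier G)"
    and "\<lbrakk>g \<in> carrier G; h \<in> carrier G\<rbrakk> \<Longrightarrow>
      lg_le (dhull G) (dhull_emb G g) (dhull_emb G h) \<longleftrightarrow> g \<preceq> h"
  by (auto simp: hom_def inj_on_def dhull_emb_def dhull_mult_same dhull_le_same dfrac_in_dhull
      dfrac_eq_iff)

lemma meet_le_iff:
  "\<lbrakk>a \<in> carrier G; b \<in> carrier G; z \<in> carrier G\<rbrakk> \<Longrightarrow> z \<preceq> a \<sqinter>\<^bsub>lg_order G\<^esub> b \<longleftrightarrow> z \<preceq> a \<and> z \<preceq> b"
  by (meson le_trans meet_closed meet_left meet_right meet_le)

lemma join_le_iff: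
  "\<lbrakk>a \<in> carrier G; b \<in> carrier G; z \<in> carrier G\<rbrakk> \<Longrightarrow> a \<squnion>\<^bsub>lg_order G\<^esub> b \<preceq> z \<longleftrightarrow> a \<preceq> z \<and> b \<preceq> z"
  by (meson le_trans join_closed join_left join_right join_le)

lemma le_mult_iff:
  "\<lbrakk>a \<in> carrier G; c \<in> carrier G; z \<in> carrier G\<rbrakk> \<Longrightarrow> z \<preceq> a \<otimes> c \<longleftrightarrow> z \<otimes> inv c \<preceq> a"
  using translation[of z "a \<otimes> c" "inv c"] translation[of "z \<otimes> inv c" a c]
  by (auto simp: m_assoc)

lemma eq_from_below:
  assumes "\<And>z. z \<in> carrier G \<Longrightarrow> z \<preceq> p \<longleftrightarrow> z \<preceq> q" "p \<in> carrier G" "q \<in> carrier G"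
  shows "p = q"
  using assms by (meson le_antisym le_refl)

lemma eq_from_above:
  assumes "\<And>z. z \<in> carrier G \<Longrightarrow> p \<preceq> z \<longleftrightarrow> q \<preceq> z" "p \<in> carrier G" "q \<in> carrier G"
  shows "p = q"
  using assms by (meson le_antisym le_refl)

theorem Gamma_mv_algebra:
  assumes u: "u \<in> carrier G" "\<one> \<preceq> u"
  shows "mv_algebra (Gamma G u)"
proof -
  have pos: "\<one> \<preceq> x \<otimes> y" if "\<one> \<preceq> x" "\<one> \<preceq> y" "x \<in> carrier G" "y \<in> carrier G" for x y
    using mult_mono[OF that(1,2)] that by simp
  have luk: "(x \<otimes> (u \<otimes> inv (x \<otimes> (u \<otimes> inv y) \<sqinter>\<^bsub>lg_order G\<^esub> u))) = x \<squnion>\<^bsub>lg_order G\<^esub> y"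
    if xy: "x \<in> carrier G" "y \<in> carrier G" for x y
  proof (rule eq_from_above)
    let ?m = "x \<otimes> (u \<otimes> inv y) \<sqinter>\<^bsub>lg_order G\<^esub> u"
    have m: "?m \<in> carrier G" using xy u by (simp add: meet_closed)
    fix z assume z: "z \<in> carrier G"
    have le: "a \<otimes> inv b \<preceq> c \<longleftrightarrow> a \<otimes> inv c \<preceq> b"
      if "a \<in> carrier G" "b \<in> carrier G" "c \<in> carrier G" for a b c
      using that le_mult_iff[of c b a] le_mult_iff[of b c a] by (simp add: m_comm)
    have "x \<otimes> (u \<otimes> inv ?m) \<preceq> z \<longleftrightarrow> (x \<otimes> u) \<otimes> inv z \<preceq> ?m"
      using le[of "x \<otimes> u" ?m z] xy u m z by (simp add: m_assoc)
    also have "\<dots> \<longleftrightarrow> (x \<otimes> u) \<otimes> inv z \<preceq> (x \<otimes> u) \<otimes> inv y \<and> (x \<otimes> u) \<otimes> inv z \<preceq> u"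
      using xy u z by (simp add: meet_le_iff m_assoc)
    also have "(x \<otimes> u) \<otimes> inv z \<preceq> u \<longleftrightarrow> x \<preceq> z"
      using le[of "x \<otimes> u" z u] xy u z by (simp add: m_assoc)
    also have "(x \<otimes> u) \<otimes> inv z \<preceq> (x \<otimes> u) \<otimes> inv y \<longleftrightarrow> y \<preceq> z"
    proof
      assume "(x \<otimes> u) \<otimes> inv z \<preceq> (x \<otimes> u) \<otimes> inv y"
      then have "inv z \<preceq> inv y"
        using le_cancel[of "inv z" "x \<otimes> u" "inv y"] xy u z by (simp add: m_comm)
      then show "y \<preceq> z" using inv_le_inv[of "inv z" "inv y"] xy z by simp
    next
      assume "y \<preceq> z"
      then show "(x \<otimes> u) \<otimes> inv z \<preceq> (x \<otimes> u) \<otimes> inv y"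
        using xy u z by (intro mult_mono le_refl inv_le_inv) auto
    qed
    finally show "x \<otimes> (u \<otimes> inv ?m) \<preceq> z \<longleftrightarrow> x \<squnion>\<^bsub>lg_order G\<^esub> y \<preceq> z"
      using xy z by (auto simp: join_le_iff)
  qed (use xy u in \<open>auto simp: join_closed meet_closed\<close>)
  have jc: "x \<squnion>\<^bsub>lg_order G\<^esub> y = y \<squnion>\<^bsub>lg_order G\<^esub> x" if "x \<in> carrier G" "y \<in> carrier G" for x y
    using that by (intro eq_from_above) (auto simp: join_le_iff join_closed)
  have assoc: "((x \<otimes> y) \<sqinter>\<^bsub>lg_order G\<^esub> u) \<otimes> z \<sqinter>\<^bsub>lg_order G\<^esub> u = x \<otimes> y \<otimes> z \<sqinter>\<^bsub>lg_order G\<^esub> u"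
    if xyz: "x \<in> carrier G" "y \<in> carrier G" "z \<in> carrier G" and z1: "\<one> \<preceq> z" for x y z
  proof (rule eq_from_below)
    fix w assume w: "w \<in> carrier G"
    have "w \<otimes> inv z \<preceq> u" if "w \<preceq> u"
      using mult_mono[OF that inv_le_inv[OF z1]] xyz w u by simp
    then show "w \<preceq> ((x \<otimes> y) \<sqinter>\<^bsub>lg_order G\<^esub> u) \<otimes> z \<sqinter>\<^bsub>lg_order G\<^esub> u \<longleftrightarrow>
        w \<preceq> x \<otimes> y \<otimes> z \<sqinter>\<^bsub>lg_order G\<^esub> u"
      using xyz w u by (auto simp: meet_le_iff meet_closed le_mult_iff[of _ z])
  qed (use xyz u in \<open>auto simp: meet_closed\<close>)
  have one: "mv_one (Gamma G u) = u" using u by (simp add: mv_one_def Gamma_def)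
  have absorb: "x \<sqinter>\<^bsub>lg_order G\<^esub> u = x" if "x \<in> carrier G" "x \<preceq> u" for x
    using that u by (meson le_antisym le_refl meet_closed meet_left meet_le)
  have absorb': "x \<otimes> u \<sqinter>\<^bsub>lg_order G\<^esub> u = u" if "x \<in> carrier G" "\<one> \<preceq> x" for x
  proof -
    have "u \<preceq> x \<otimes> u" using translation[OF _ _ _ that(2), of u] that u by simp
    then show ?thesis using that u by (meson le_antisym le_refl meet_closed meet_right meet_le m_closed)
  qed
  show ?thesis
  proof (rule mv_algebraI, unfold one)
    fix x y z assume "x \<in> carrier (Gamma G u)" "y \<in> carrier (Gamma G u)" "z \<in> carrier (Gamma G u)"
    then have *: "x \<in> carrier G" "y \<in> carrier G" "z \<in> carrier G"
      "\<one> \<preceq> x" "\<one> \<preceq> y" "\<one> \<preceq> z" by (auto simp: Gamma_def)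
    have "((x \<otimes> y) \<sqinter>\<^bsub>lg_order G\<^esub> u) \<otimes> z \<sqinter>\<^bsub>lg_order G\<^esub> u = x \<otimes> y \<otimes> z \<sqinter>\<^bsub>lg_order G\<^esub> u"
      using assoc * by blast
    also have "x \<otimes> y \<otimes> z = y \<otimes> z \<otimes> x" using * by (simp add: m_ac)
    also have "y \<otimes> z \<otimes> x \<sqinter>\<^bsub>lg_order G\<^esub> u = ((y \<otimes> z) \<sqinter>\<^bsub>lg_order G\<^esub> u) \<otimes> x \<sqinter>\<^bsub>lg_order G\<^esub> u"
      using assoc[of y z x] * by simp
    also have "((y \<otimes> z) \<sqinter>\<^bsub>lg_order G\<^esub> u) \<otimes> x = x \<otimes> ((y \<otimes> z) \<sqinter>\<^bsub>lg_order G\<^esub> u)"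
      using * u by (simp add: m_comm meet_closed)
    finally show "mv_plus (Gamma G u) (mv_plus (Gamma G u) x y) z =
        mv_plus (Gamma G u) x (mv_plus (Gamma G u) y z)"
      by (simp add: Gamma_def)
  next
    fix x y assume "x \<in> carrier (Gamma G u)" "y \<in> carrier (Gamma G u)"
    then have *: "x \<in> carrier G" "y \<in> carrier G" by (auto simp: Gamma_def)
    then show "mv_plus (Gamma G u) x (mv_neg (Gamma G u) (mv_plus (Gamma G u) x (mv_neg (Gamma G u) y))) =
      mv_plus (Gamma G u) y (mv_neg (Gamma G u) (mv_plus (Gamma G u) y (mv_neg (Gamma G u) x)))"
      using luk[of x y] luk[of y x] jc[of x y] by (simp add: Gamma_def)
  next
    fix x y assume xy: "x \<in> carrier (Gamma G u)" "y \<in> carrier (Gamma G u)"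
    show "mv_plus (Gamma G u) x y \<in> carrier (Gamma G u)"
      using xy u by (auto simp: Gamma_def meet_closed meet_right meet_le_iff pos)
    show "mv_plus (Gamma G u) x y = mv_plus (Gamma G u) y x"
      using xy by (simp add: Gamma_def m_comm)
  next
    fix x assume x: "x \<in> carrier (Gamma G u)"
    then have *: "x \<in> carrier G" "\<one> \<preceq> x" "x \<preceq> u" by (auto simp: Gamma_def)
    show "mv_plus (Gamma G u) (mv_zero (Gamma G u)) x = x" "mv_plus (Gamma G u) x u = u"
      using * absorb absorb' by (auto simp: Gamma_def)
    show "mv_neg (Gamma G u) (mv_neg (Gamma G u) x) = x"
      using * u by (simp add: Gamma_def inv_mult m_assoc[symmetric])
    have "u \<otimes> inv x \<preceq> u \<otimes> \<one>"
      using inv_le_inv[OF *(2)] * u by (intro mult_mono le_refl) auto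
    moreover have "\<one> \<preceq> u \<otimes> inv x" using translation[OF _ _ _ *(3), of "inv x"] * u by simp
    ultimately show "mv_neg (Gamma G u) x \<in> carrier (Gamma G u)"
      using * u by (simp add: Gamma_def)
  qed (use u in \<open>auto simp: Gamma_def le_refl\<close>)
qed

lemma unit_lsubgroup_le:
  assumes v: "strong_unit G v" and K: "unit_lsubgroup G v S K" and K': "unit_lsubgroup G v S K'"
  shows "K \<subseteq> K'"
proof -
  have sub: "subgroup K G" "subgroup K' G" using K K' by (auto simp: unit_lsubgroup_def lsubgroup_def)
  have vK: "v \<in> K" "v \<in> K'" "v \<in> carrier G" "\<one> \<preceq> v"
    using K K' v by (auto simp: unit_lsubgroup_def strong_unit_def)
  have KG: "x \<in> carrier G" if "x \<in> K \<or> x \<in> K'" for x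
    using that subgroup.mem_carrier[OF sub(1)] subgroup.mem_carrier[OF sub(2)] by blast
  have S: "x \<in> K'" if "x \<in> K" "\<one> \<preceq> x" "x \<preceq> v" for x
  proof -
    have "x \<in> carrier (Gamma (G\<lparr>carrier := K\<rparr>) v)" using that by (simp add: Gamma_def)
    also have "\<dots> = carrier (Gamma (G\<lparr>carrier := K'\<rparr>) v)"
      using K K' by (simp add: unit_lsubgroup_def)
    finally show ?thesis by (simp add: Gamma_def)
  qed
  have pos: "g \<in> K'" if "g \<in> K" "\<one> \<preceq> g" "g \<preceq> v [^] (n::nat)" for g n
    using that
  proof (induction n arbitrary: g)
    case 0
    then have "g = \<one>" using KG[of g] le_antisym[of g \<one>] by simp
    then show ?case using subgroup.one_closed[OF sub(2)] by simp
  next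
    case (Suc n)
    let ?m = "g \<sqinter>\<^bsub>lg_order G\<^esub> v"
    have g: "g \<in> carrier G" using Suc.prems KG by blast
    have m: "?m \<in> K" using K Suc.prems vK by (auto simp: unit_lsubgroup_def lsubgroup_def)
    have mG: "?m \<in> carrier G" using m KG by blast
    have m1: "\<one> \<preceq> ?m" "?m \<preceq> v" "?m \<preceq> g"
      using Suc.prems g vK meet_le[of g v \<one>] meet_left[of g v] meet_right[of g v] by simp_all
    have mK': "?m \<in> K'" using S m m1 by blast
    let ?d = "g \<otimes> inv ?m"
    have dK: "?d \<in> K" using subgroup.m_closed[OF sub(1) Suc.prems(1) subgroup.m_inv_closed[OF sub(1) m]] .
    have "g \<otimes> inv (v [^] n) \<preceq> g"
      using mult_mono[OF le_refl inv_le_inv[OF pow_mono[OF vK(4) one_closed vK(3), of n]], of g] g vK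
      by simp
    moreover have "g \<otimes> inv (v [^] n) \<preceq> v"
      using translation[OF _ _ _ Suc.prems(3)[unfolded nat_pow_Suc2[OF vK(3)]], of "inv (v [^] n)"] g vK
      by (simp add: m_assoc)
    ultimately have "g \<otimes> inv (v [^] n) \<preceq> ?m" using g vK meet_le[of g v "g \<otimes> inv (v [^] n)"] by simp
    from translation[OF _ _ _ this, of "v [^] n"] have "g \<preceq> v [^] n \<otimes> ?m"
      using g vK mG m_comm[of "v [^] n" ?m] by (simp add: m_assoc)
    then have "?d \<preceq> v [^] n" using le_mult_iff[of "v [^] n" ?m g] g vK mG by simp
    moreover have "\<one> \<preceq> ?d"
      using translation[OF _ _ _ m1(3), of "inv ?m"] g mG by simp
    ultimately have "?d \<in> K'" using Suc.IH[OF dK] by simp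
    then have "?d \<otimes> ?m \<in> K'" using subgroup.m_closed[OF sub(2) _ mK'] by simp
    then show ?case using g mG by (simp add: m_assoc)
  qed
  show ?thesis
  proof
    fix g assume gK: "g \<in> K"
    have g: "g \<in> carrier G" using gK KG by blast
    obtain n :: nat where n: "inv g \<preceq> v [^] n"
      using v inv_closed[OF g] by (auto simp: strong_unit_def)
    obtain m :: nat where m: "g \<preceq> v [^] m"
      using v g by (auto simp: strong_unit_def)
    have pw: "v [^] k \<in> K" "v [^] k \<in> K'" for k :: nat
      by (induction k) (use vK sub in \<open>simp_all add: subgroup.one_closed subgroup.m_closed\<close>)
    have "g \<otimes> v [^] n \<in> K'"
    proof (rule pos)
      show "g \<otimes> v [^] n \<in> K" by (rule subgroup.m_closed[OF sub(1) gK pw(1)])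
      show "\<one> \<preceq> g \<otimes> v [^] n" using translation[OF _ _ _ n, of g] g vK by (simp add: m_comm)
      show "g \<otimes> v [^] n \<preceq> v [^] (m + n)"
        using translation[OF _ _ _ m, of "v [^] n"] g vK by (simp add: nat_pow_mult)
    qed
    then have "g \<otimes> v [^] n \<otimes> inv (v [^] n) \<in> K'"
      by (rule subgroup.m_closed[OF sub(2) _ subgroup.m_inv_closed[OF sub(2) pw(2)]])
    then show "g \<in> K'" using g vK by (simp add: m_assoc)
  qed
qed

theorem unit_lsubgroup_unique:
  assumes "strong_unit G v" "unit_lsubgroup G v S K" "unit_lsubgroup G v S K'"
  shows "K = K'"
  using unit_lsubgroup_le[OF assms] unit_lsubgroup_le[OF assms(1,3,2)] by blast

end

end

theory Submission
  imports Defs "HOL-Algebra.Generated_Groups"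
begin

text \<open>
  (i) A linearly ordered \<open>\<Gamma>(H, v)\<close> forces \<open>H\<close> to be totally ordered. If no positive multiple of \<open>g\<close> lies in
  the subgroup \<open>K\<close> of the image, two copies of \<open>H\<close> can be amalgamated over \<open>K\<close> into a totally
  ordered group in which the two copies of \<open>g\<close> differ; this contradicts the epimorphism property.

  (ii) Let \<open>S\<close> be the image of a divisible \<open>M\<close> under an epimorphism \<open>M \<rightarrow> A\<close>. By (i), applied to
  the chains \<open>A/P\<close> with \<open>P\<close> prime, \<open>S\<close> maps onto every \<open>A/P\<close>. For two primes \<open>P\<close>, \<open>Q\<close> the
  two maps \<open>A \<rightarrow> S/r\<close> through \<open>A/P\<close> and \<open>A/Q\<close>, where \<open>r\<close> is generated by \<open>P \<inter> S\<close> and \<open>Q \<inter> S\<close>, agree on \<open>S\<close>,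
  hence coincide, so every \<open>a \<in> A\<close> can be interpolated at \<open>P\<close> and \<open>Q\<close> by an element of \<open>S\<close>. As in
  the lattice form of the Stone-Weierstrass theorem, with the prime ideal theorem in the role of
  compactness, this gives \<open>a \<in> S\<close>.
\<close>

section \<open>Arithmetic in MV-algebras\<close>

text \<open>Groups are written additively in these comments. Membership of g in the divisible hull
  of K means n g in K for some n >= 1. If it fails, all positive multiples of g avoid K, a condition
  that a Zorn extension of cones can preserve. Divisibility of M later removes the factor n, because
  division by n in an l-group is unique. In (i) the group is given; the chains A/P of (ii) come
  without one, and it is built from the chain as Chang's group of pairs (integer part, remainder).
  The obstacle in (ii) is that the chain case is local: modulo each prime P, a agrees with some
  element of S, but this element depends on P. Surjectivity onto A/P identifies A/P with S/(P
  \<inter> S), hence the maps to S/r; a difference in r is then bounded by a part in P plus a part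
  in Q. It suffices to agree with a at P and to stay below it at Q: letting Q vary and taking meets
  gives an element of S below a that still agrees with a at P; letting P vary and taking joins
  reaches a.\<close>

context mv_algebra
begin

abbreviation oplus (infixl \<open>\<oplus>\<close> 65) where "x \<oplus> y \<equiv> mv_plus M x y"
abbreviation neg where "neg x \<equiv> mv_neg M x"
abbreviation mle (infix \<open>\<lesssim>\<close> 50) where "x \<lesssim> y \<equiv> mv_le M x y"
abbreviation zero (\<open>\<zero>\<close>) where "\<zero> \<equiv> mv_zero M"
abbreviation unit (\<open>\<I>\<close>) where "\<I> \<equiv> mv_one M"

text \<open>In \<Gamma>(G, u), \<open>x \<ominus> y\<close> is x - y truncated at 0, and
  \<open>x \<odot> y\<close> is x + y - u truncated at 0, the excess of the sum over the
  unit.\<close>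

definition ominus (infixl \<open>\<ominus>\<close> 65) where "x \<ominus> y = neg (neg x \<oplus> y)"
definition odot (infixl \<open>\<odot>\<close> 70) where "x \<odot> y = neg (neg x \<oplus> neg y)"
definition mjoin where "mjoin x y = x \<oplus> (y \<ominus> x)"
definition mmeet where "mmeet x y = neg (mjoin (neg x) (neg y))"

lemmas mv_closed [simp, intro] = plus_closed neg_closed zero_closed one_closed
lemmas [simp] = neg_neg zero_plus plus_one

lemma ops_closed [simp, intro]:
  assumes "x \<in> carrier M" "y \<in> carrier M"
  shows "x \<ominus> y \<in> carrier M" "x \<odot> y \<in> carrier M" "mjoin x y \<in> carrier M" "mmeet x y \<in> carrier M"
  using assms by (auto simp: ominus_def odot_def mjoin_def mmeet_def)

lemma plus_lcomm:
  "\<lbrakk>x \<in> carrier M; y \<in> carrier M; z \<in> carrier M\<rbrakk> \<Longrightarrow> x \<oplus> (y \<oplus> z) = y \<oplus> (x \<oplus> z)"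
  by (metis plus_assoc plus_comm)

lemmas plus_ac = plus_assoc plus_comm plus_lcomm

lemma plus_zero [simp]: "x \<in> carrier M \<Longrightarrow> x \<oplus> \<zero> = x"
  using plus_comm[of x \<zero>] by simp

lemma one_plus [simp]: "x \<in> carrier M \<Longrightarrow> \<I> \<oplus> x = \<I>"
  using plus_comm[of \<I> x] by simp

lemma neg_zero [simp]: "neg \<zero> = \<I>" and neg_one [simp]: "neg \<I> = \<zero>"
  by (simp_all add: mv_one_def)

lemma neg_inj: "\<lbrakk>x \<in> carrier M; y \<in> carrier M\<rbrakk> \<Longrightarrow> neg x = neg y \<longleftrightarrow> x = y"
  by (metis neg_neg)

lemma plus_neg [simp]: assumes "x \<in> carrier M" shows "x \<oplus> neg x = \<I>" "neg x \<oplus> x = \<I>"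
proof -
  show "x \<oplus> neg x = \<I>" using lukasiewicz[of x \<I>] assms by simp
  then show "neg x \<oplus> x = \<I>" using plus_comm[of x "neg x"] assms by simp
qed

lemma mle_refl [simp]: "x \<in> carrier M \<Longrightarrow> x \<lesssim> x"
  by (simp add: mv_le_def)

text \<open>Up to commutativity of \<open>\<oplus>\<close> this is the Lukasiewicz axiom. Through
  \<open>mjoin_absorb\<close> it yields antisymmetry and the description of the order by
  summands.\<close>

lemma mjoin_comm: "\<lbrakk>x \<in> carrier M; y \<in> carrier M\<rbrakk> \<Longrightarrow> mjoin x y = mjoin y x"
  unfolding mjoin_def ominus_def using lukasiewicz[of x y]
  by (simp add: plus_comm[of _ x] plus_comm[of _ y])

lemma ominus_eq_zero_iff: "\<lbrakk>x \<in> carrier M; y \<in> carrier M\<rbrakk> \<Longrightarrow> x \<ominus> y = \<zero> \<longleftrightarrow> x \<lesssim> y"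
  unfolding ominus_def mv_le_def using neg_inj[of "neg x \<oplus> y" \<I>] by simp

lemma mjoin_absorb: "\<lbrakk>x \<in> carrier M; y \<in> carrier M; x \<lesssim> y\<rbrakk> \<Longrightarrow> mjoin x y = y"
  using mjoin_comm[of x y] ominus_eq_zero_iff[of x y] by (simp add: mjoin_def)

lemma mle_plus: "\<lbrakk>x \<in> carrier M; y \<in> carrier M\<rbrakk> \<Longrightarrow> x \<lesssim> x \<oplus> y"
  using plus_assoc[of "neg x" x y] by (simp add: mv_le_def)

lemma mle_plus': "\<lbrakk>x \<in> carrier M; y \<in> carrier M\<rbrakk> \<Longrightarrow> y \<lesssim> x \<oplus> y"
  using mle_plus[of y x] by (simp add: plus_comm)

lemma mle_antisym: "\<lbrakk>x \<in> carrier M; y \<in> carrier M; x \<lesssim> y; y \<lesssim> x\<rbrakk> \<Longrightarrow> x = y"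
  using mjoin_comm[of x y] mjoin_absorb[of x y] mjoin_absorb[of y x] by simp

lemma mle_iff_plus:
  "\<lbrakk>x \<in> carrier M; y \<in> carrier M\<rbrakk> \<Longrightarrow> x \<lesssim> y \<longleftrightarrow> (\<exists>w\<in>carrier M. y = x \<oplus> w)"
  using mjoin_absorb[of x y] mle_plus[of x] by (metis mjoin_def ops_closed(1))

lemma mle_trans:
  assumes "x \<lesssim> y" "y \<lesssim> z" "x \<in> carrier M" "y \<in> carrier M" "z \<in> carrier M"
  shows "x \<lesssim> z"
  using assms by (auto simp: mle_iff_plus plus_assoc)

lemma plus_mono:
  assumes "x \<lesssim> y" "z \<lesssim> w" "x \<in> carrier M" "y \<in> carrier M" "z \<in> carrier M" "w \<in> carrier M"
  shows "x \<oplus> z \<lesssim> y \<oplus> w"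
proof -
  obtain a b where "a \<in> carrier M" "b \<in> carrier M" "y = x \<oplus> a" "w = z \<oplus> b"
    using assms by (auto simp: mle_iff_plus)
  then have "y \<oplus> w = x \<oplus> z \<oplus> (a \<oplus> b)" using assms by (simp add: plus_ac)
  then show ?thesis using mle_plus[of "x \<oplus> z" "a \<oplus> b"] \<open>a \<in> _\<close> \<open>b \<in> _\<close> assms by simp
qed

lemma neg_mle_neg_iff:
  "\<lbrakk>x \<in> carrier M; y \<in> carrier M\<rbrakk> \<Longrightarrow> neg x \<lesssim> neg y \<longleftrightarrow> y \<lesssim> x"
  by (simp add: mv_le_def plus_comm)

text \<open>Both sides unfold to \<open>neg x \<oplus> y \<oplus> z = \<I>\<close>. This adjunction
  is the substitute for moving terms across an inequality.\<close>

lemma ominus_mle_iff: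
  "\<lbrakk>x \<in> carrier M; y \<in> carrier M; z \<in> carrier M\<rbrakk> \<Longrightarrow> x \<ominus> y \<lesssim> z \<longleftrightarrow> x \<lesssim> y \<oplus> z"
  by (simp add: mv_le_def ominus_def plus_assoc)

lemma zero_mle [simp]: "x \<in> carrier M \<Longrightarrow> \<zero> \<lesssim> x"
  by (simp add: mv_le_def)

lemma mle_zero_iff: "x \<in> carrier M \<Longrightarrow> x \<lesssim> \<zero> \<longleftrightarrow> x = \<zero>"
  using mle_antisym[of x \<zero>] by auto

lemma mle_one [simp]: "x \<in> carrier M \<Longrightarrow> x \<lesssim> \<I>"
  by (simp add: mv_le_def)

lemma mle_ominus_plus: "\<lbrakk>x \<in> carrier M; y \<in> carrier M\<rbrakk> \<Longrightarrow> x \<lesssim> y \<oplus> (x \<ominus> y)"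
  using ominus_mle_iff[of x y "x \<ominus> y"] by simp

lemma ominus_mle: "\<lbrakk>x \<in> carrier M; y \<in> carrier M\<rbrakk> \<Longrightarrow> x \<ominus> y \<lesssim> x"
  by (simp add: ominus_mle_iff mle_plus')

lemma ominus_mono:
  assumes "x \<lesssim> y" "w \<lesssim> z" "x \<in> carrier M" "y \<in> carrier M" "z \<in> carrier M" "w \<in> carrier M"
  shows "x \<ominus> z \<lesssim> y \<ominus> w"
proof -
  have "y \<lesssim> w \<oplus> (y \<ominus> w)" "w \<oplus> (y \<ominus> w) \<lesssim> z \<oplus> (y \<ominus> w)"
    using assms by (auto intro: mle_ominus_plus plus_mono)
  then have "x \<lesssim> z \<oplus> (y \<ominus> w)" using assms by (meson mle_trans mv_closed(1) ops_closed(1))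
  then show ?thesis using assms by (simp add: ominus_mle_iff)
qed

lemma mjoin_upper:
  assumes "x \<in> carrier M" "y \<in> carrier M"
  shows "x \<lesssim> mjoin x y" "y \<lesssim> mjoin x y"
  using assms mle_plus[of x "y \<ominus> x"] mle_plus[of y "x \<ominus> y"] mjoin_comm[of x y]
  by (simp_all add: mjoin_def)

lemma mmeet_lower:
  assumes "x \<in> carrier M" "y \<in> carrier M"
  shows "mmeet x y \<lesssim> x" "mmeet x y \<lesssim> y"
  using assms mjoin_upper[of "neg x" "neg y"] neg_mle_neg_iff[of "mmeet x y" x]
    neg_mle_neg_iff[of "mmeet x y" y] neg_mle_neg_iff[of x "mmeet x y"] neg_mle_neg_iff[of y "mmeet x y"]
  by (simp_all add: mmeet_def)

lemma mjoin_least: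
  assumes "x \<lesssim> z" "y \<lesssim> z" "x \<in> carrier M" "y \<in> carrier M" "z \<in> carrier M"
  shows "mjoin x y \<lesssim> z"
proof -
  have "x \<oplus> (y \<ominus> x) \<lesssim> x \<oplus> (z \<ominus> x)" using assms by (intro plus_mono ominus_mono) auto
  then show ?thesis using mjoin_absorb[of x z] assms by (simp add: mjoin_def)
qed

lemma mmeet_greatest:
  assumes "z \<lesssim> x" "z \<lesssim> y" "x \<in> carrier M" "y \<in> carrier M" "z \<in> carrier M"
  shows "z \<lesssim> mmeet x y"
proof -
  have "mjoin (neg x) (neg y) \<lesssim> neg z"
    using assms by (intro mjoin_least) (auto simp: neg_mle_neg_iff)
  then show ?thesis using assms neg_mle_neg_iff[of "mmeet x y" z] by (simp add: mmeet_def)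
qed

text \<open>The bound on \<open>y\<close> says that x + y stays within the unit, so nothing is
  truncated. By absorption \<open>x \<oplus> (neg y \<ominus> x) = neg y\<close>, and the complement
  of this equation is the claim.\<close>

lemma plus_ominus_cancel:
  "\<lbrakk>x \<in> carrier M; y \<in> carrier M; y \<lesssim> neg x\<rbrakk> \<Longrightarrow> (x \<oplus> y) \<ominus> x = y"
  using mjoin_absorb[of x "neg y"] neg_mle_neg_iff[of "neg y" x]
  by (simp add: mjoin_def ominus_def plus_comm)

text \<open>Let m be the meet of \<open>x\<close> and \<open>y\<close>. Then m \<oplus> z stays
  below both, hence below m; since \<open>z\<close> is below \<open>neg m\<close>, the sum is not
  truncated and \<open>z\<close> cancels. This disjointness is what makes maximal avoiding ideals
  prime.\<close>

lemma ominus_disjoint: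
  assumes "x \<in> carrier M" "y \<in> carrier M" "z \<in> carrier M" "z \<lesssim> x \<ominus> y" "z \<lesssim> y \<ominus> x"
  shows "z = \<zero>"
proof -
  let ?m = "mmeet x y"
  have le: "?m \<oplus> z \<lesssim> w" if w: "w \<in> carrier M" "?m \<lesssim> w" and z: "z \<lesssim> w \<ominus> ?m" for w
    using plus_mono[OF mle_refl z, of ?m] mjoin_absorb[OF _ _ w(2)] w assms by (simp add: mjoin_def)
  have 1: "x \<ominus> y \<lesssim> x \<ominus> ?m" "y \<ominus> x \<lesssim> y \<ominus> ?m"
    using assms by (auto intro!: ominus_mono mmeet_lower)
  then have 2: "z \<lesssim> x \<ominus> ?m" "z \<lesssim> y \<ominus> ?m"
    using assms by (meson mle_trans ops_closed)+
  have "?m \<oplus> z \<lesssim> ?m"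
    using le[OF _ _ 2(1)] le[OF _ _ 2(2)] assms by (intro mmeet_greatest) (auto intro: mmeet_lower)
  moreover have "x \<ominus> ?m \<lesssim> neg ?m"
    using assms mle_plus'[of "neg x" "?m"] by (simp add: ominus_def neg_mle_neg_iff)
  then have "z \<lesssim> neg ?m" using 2 assms by (meson mle_trans ops_closed mv_closed)
  then have "(?m \<oplus> z) \<ominus> ?m = z" using assms by (intro plus_ominus_cancel) auto
  moreover have "?m \<oplus> z \<lesssim> ?m \<Longrightarrow> (?m \<oplus> z) \<ominus> ?m = \<zero>" using assms by (simp add: ominus_eq_zero_iff)
  ultimately show ?thesis by simp
qed

text \<open>Riesz-type splitting: \<open>z \<ominus> b\<close> lies below both \<open>a\<close> and
  \<open>c\<close>, hence is zero, and so \<open>z\<close> falls below \<open>b\<close>.\<close>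

lemma disjoint_plus:
  assumes "\<And>z. \<lbrakk>z \<in> carrier M; z \<lesssim> a; z \<lesssim> b\<rbrakk> \<Longrightarrow> z = \<zero>"
    and "\<And>z. \<lbrakk>z \<in> carrier M; z \<lesssim> a; z \<lesssim> c\<rbrakk> \<Longrightarrow> z = \<zero>"
    and "a \<in> carrier M" "b \<in> carrier M" "c \<in> carrier M" "z \<in> carrier M" "z \<lesssim> a" "z \<lesssim> b \<oplus> c"
  shows "z = \<zero>"
proof -
  have 1: "z \<ominus> b \<lesssim> c" "z \<ominus> b \<lesssim> a"
    using mle_trans[OF ominus_mle[of z b] assms(7)] assms(3-6,8) by (auto simp: ominus_mle_iff)
  have "z \<ominus> b = \<zero>" by (rule assms(2)[OF _ 1(2,1)]) (use assms(4,6) in auto)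
  then have "z \<lesssim> b" using assms(4,6) by (simp add: ominus_eq_zero_iff)
  then show ?thesis using assms(1)[of z] assms(6,7) by blast
qed

lemma nmult_closed [simp, intro]: "a \<in> carrier M \<Longrightarrow> mv_nmult M n a \<in> carrier M"
  by (induction n) auto

text \<open>Adjoining an element to an ideal brings in its multiples, so disjointness has to survive
  them: induction on \<open>n\<close> with \<open>a\<close> fixed, then on \<open>m\<close>.\<close>

lemma disjoint_nmult:
  assumes d: "\<And>z. \<lbrakk>z \<in> carrier M; z \<lesssim> a; z \<lesssim> b\<rbrakk> \<Longrightarrow> z = \<zero>" and ab: "a \<in> carrier M" "b \<in> carrier M"
    and z: "z \<in> carrier M" "z \<lesssim> mv_nmult M m a" "z \<lesssim> mv_nmult M n b"
  shows "z = \<zero>"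
proof -
  have 1: "z = \<zero>" if "z \<in> carrier M" "z \<lesssim> a" "z \<lesssim> mv_nmult M n b" for z
    using that
  proof (induction n arbitrary: z)
    case (Suc n)
    show ?case
      by (rule disjoint_plus[OF Suc.IH d]) (use Suc.prems ab in simp_all)
  qed (simp add: mle_zero_iff)
  have "z = \<zero>" if "z \<in> carrier M" "z \<lesssim> mv_nmult M n b" "z \<lesssim> mv_nmult M m a" for z
    using that
  proof (induction m arbitrary: z)
    case (Suc m)
    show ?case
      by (rule disjoint_plus[OF Suc.IH 1]) (use Suc.prems ab in simp_all)
  qed (simp add: mle_zero_iff)
  then show ?thesis using z by blast
qed

section \<open>Ideals and quotients\<close>

definition mv_ideal where
  "mv_ideal I \<longleftrightarrow> I \<subseteq> carrier M \<and> \<zero> \<in> I \<and> (\<forall>x\<in>I. \<forall>y\<in>I. x \<oplus> y \<in> I) \<and>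
     (\<forall>x\<in>carrier M. \<forall>y\<in>I. x \<lesssim> y \<longrightarrow> x \<in> I)"

text \<open>Stated through differences so that the quotient is visibly a chain. The improper ideal
  \<open>carrier M\<close> qualifies; its quotient is the one-element chain.\<close>

definition mv_prime where
  "mv_prime I \<longleftrightarrow> mv_ideal I \<and> (\<forall>x\<in>carrier M. \<forall>y\<in>carrier M. x \<ominus> y \<in> I \<or> y \<ominus> x \<in> I)"

definition mcong where
  "mcong I x y \<longleftrightarrow> x \<in> carrier M \<and> y \<in> carrier M \<and> x \<ominus> y \<in> I \<and> y \<ominus> x \<in> I"

lemma ideal_carrier: "mv_ideal I \<Longrightarrow> x \<in> I \<Longrightarrow> x \<in> carrier M"
  by (auto simp: mv_ideal_def)

lemma ideal_zero: "mv_ideal I \<Longrightarrow> \<zero> \<in> I"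
  by (auto simp: mv_ideal_def)

lemma ideal_plus: "\<lbrakk>mv_ideal I; x \<in> I; y \<in> I\<rbrakk> \<Longrightarrow> x \<oplus> y \<in> I"
  by (auto simp: mv_ideal_def)

lemma ideal_down: "\<lbrakk>mv_ideal I; y \<in> I; x \<lesssim> y; x \<in> carrier M\<rbrakk> \<Longrightarrow> x \<in> I"
  by (auto simp: mv_ideal_def)

lemma ideal_ominusI:
  "\<lbrakk>mv_ideal I; x \<lesssim> y \<oplus> z; z \<in> I; x \<in> carrier M; y \<in> carrier M\<rbrakk> \<Longrightarrow> x \<ominus> y \<in> I"
  by (rule ideal_down[of I z]) (auto simp: ominus_mle_iff ideal_carrier)

lemma ideal_ominus_trans:
  assumes I: "mv_ideal I" and c: "x \<in> carrier M" "y \<in> carrier M" "z \<in> carrier M"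
    and d: "x \<ominus> y \<in> I" "y \<ominus> z \<in> I"
  shows "x \<ominus> z \<in> I"
proof (rule ideal_ominusI[OF I _ ideal_plus[OF I d(2,1)]])
  have "x \<lesssim> y \<oplus> (x \<ominus> y)" "y \<oplus> (x \<ominus> y) \<lesssim> z \<oplus> (y \<ominus> z) \<oplus> (x \<ominus> y)"
    using c by (auto intro!: plus_mono mle_ominus_plus)
  then have "x \<lesssim> z \<oplus> (y \<ominus> z) \<oplus> (x \<ominus> y)" using c by (meson mle_trans mv_closed(1) ops_closed(1))
  then show "x \<lesssim> z \<oplus> (y \<ominus> z \<oplus> (x \<ominus> y))" using c by (simp add: plus_assoc)
qed (use c in auto)

lemma ideal_ominus_plus:
  assumes I: "mv_ideal I" and c: "x \<in> carrier M" "y \<in> carrier M" "z \<in> carrier M" "w \<in> carrier M"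
    and d: "x \<ominus> y \<in> I" "z \<ominus> w \<in> I"
  shows "(x \<oplus> z) \<ominus> (y \<oplus> w) \<in> I"
proof (rule ideal_ominusI[OF I _ ideal_plus[OF I d]])
  have "x \<oplus> z \<lesssim> (y \<oplus> (x \<ominus> y)) \<oplus> (w \<oplus> (z \<ominus> w))"
    using c by (auto intro!: plus_mono mle_ominus_plus)
  then show "x \<oplus> z \<lesssim> y \<oplus> w \<oplus> (x \<ominus> y \<oplus> (z \<ominus> w))"
    using c by (simp add: plus_ac)
qed (use c in auto)

lemma neg_ominus_neg: "\<lbrakk>x \<in> carrier M; y \<in> carrier M\<rbrakk> \<Longrightarrow> neg x \<ominus> neg y = y \<ominus> x"
  by (simp add: ominus_def plus_comm)

lemma mcong_refl: "mv_ideal I \<Longrightarrow> x \<in> carrier M \<Longrightarrow> mcong I x x"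
  using ominus_eq_zero_iff[of x x] by (auto simp: mcong_def ideal_zero)

lemma mcong_sym: "mcong I x y \<Longrightarrow> mcong I y x"
  by (auto simp: mcong_def)

lemma mcong_trans: "mv_ideal I \<Longrightarrow> mcong I x y \<Longrightarrow> mcong I y z \<Longrightarrow> mcong I x z"
  unfolding mcong_def by (meson ideal_ominus_trans)

lemma mcong_plus: "mv_ideal I \<Longrightarrow> mcong I x y \<Longrightarrow> mcong I z w \<Longrightarrow> mcong I (x \<oplus> z) (y \<oplus> w)"
  unfolding mcong_def by (auto intro: ideal_ominus_plus)

lemma mcong_neg: "mcong I x y \<Longrightarrow> mcong I (neg x) (neg y)"
  unfolding mcong_def by (auto simp: neg_ominus_neg)

definition mclass where "mclass I x = {y. mcong I x y}"

definition mv_quot where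
  "mv_quot I = \<lparr>carrier = mclass I ` carrier M,
     mv_plus = (\<lambda>X Y. mclass I ((SOME x. x \<in> X) \<oplus> (SOME y. y \<in> Y))),
     mv_neg = (\<lambda>X. mclass I (neg (SOME x. x \<in> X))),
     mv_zero = mclass I \<zero>\<rparr>"

lemma mclass_eq_iff:
  "mv_ideal I \<Longrightarrow> x \<in> carrier M \<Longrightarrow> mclass I x = mclass I y \<longleftrightarrow> mcong I x y"
  unfolding mclass_def by (auto intro: mcong_sym mcong_trans mcong_refl)

lemma mclass_some: "mv_ideal I \<Longrightarrow> x \<in> carrier M \<Longrightarrow> mcong I x (SOME y. y \<in> mclass I x)"
  using someI[of "\<lambda>y. y \<in> mclass I x" x] mcong_refl[of I x] by (simp add: mclass_def)

text \<open>The representative picked by \<open>SOME\<close> is congruent to the given one by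
  \<open>mclass_some\<close>, so compatibility of the congruence with the operations makes the
  choice immaterial.\<close>

lemma quot_simps:
  assumes I: "mv_ideal I"
  shows "carrier (mv_quot I) = mclass I ` carrier M"
    and "mv_zero (mv_quot I) = mclass I \<zero>"
    and "x \<in> carrier M \<Longrightarrow> mv_neg (mv_quot I) (mclass I x) = mclass I (neg x)"
    and "\<lbrakk>x \<in> carrier M; y \<in> carrier M\<rbrakk> \<Longrightarrow>
      mv_plus (mv_quot I) (mclass I x) (mclass I y) = mclass I (x \<oplus> y)"
    and "mv_one (mv_quot I) = mclass I \<I>"
proof -
  show neg: "x \<in> carrier M \<Longrightarrow> mv_neg (mv_quot I) (mclass I x) = mclass I (neg x)" for x
    using iffD2[OF mclass_eq_iff[OF I, of "neg x"] mcong_neg[OF mclass_some[OF I, of x]]]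
    by (simp add: mv_quot_def)
  show "\<lbrakk>x \<in> carrier M; y \<in> carrier M\<rbrakk> \<Longrightarrow>
      mv_plus (mv_quot I) (mclass I x) (mclass I y) = mclass I (x \<oplus> y)"
    for x y
    using iffD2[OF mclass_eq_iff[OF I, of "x \<oplus> y"]
        mcong_plus[OF I mclass_some[OF I, of x] mclass_some[OF I, of y]]]
    by (simp add: mv_quot_def)
  show "mv_one (mv_quot I) = mclass I \<I>"
    using neg[of \<zero>] by (simp add: mv_one_def[of "mv_quot I"]) (simp add: mv_quot_def)
qed (simp_all add: mv_quot_def)

theorem quot_mv_algebra:
  assumes I: "mv_ideal I"
  shows "mv_algebra (mv_quot I)"
proof -
  note simps = quot_simps[OF I]
  show ?thesis
  proof (rule mv_algebraI)
    fix X Y assume "X \<in> carrier (mv_quot I)" "Y \<in> carrier (mv_quot I)"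
    then obtain x y where "x \<in> carrier M" "y \<in> carrier M" "X = mclass I x" "Y = mclass I y"
      by (auto simp: simps)
    then show "mv_plus (mv_quot I) X Y = mv_plus (mv_quot I) Y X"
      and "mv_plus (mv_quot I) X (mv_neg (mv_quot I) (mv_plus (mv_quot I) X (mv_neg (mv_quot I) Y))) =
        mv_plus (mv_quot I) Y (mv_neg (mv_quot I) (mv_plus (mv_quot I) Y (mv_neg (mv_quot I) X)))"
      using lukasiewicz[of x y] plus_comm[of x y] by (simp_all add: simps)
  qed (auto simp: simps plus_assoc)
qed

lemma mclass_hom: "mv_ideal I \<Longrightarrow> mclass I \<in> mv_hom M (mv_quot I)"
  by (auto simp: mv_hom_def quot_simps)

lemma quot_linear:
  assumes P: "mv_prime P"
  shows "mv_linear (mv_quot P)"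
proof -
  have I: "mv_ideal P" using P by (simp add: mv_prime_def)
  have "mv_le (mv_quot P) (mclass P x) (mclass P y)"
    if "x \<in> carrier M" "y \<in> carrier M" "x \<ominus> y \<in> P" for x y
  proof -
    have "mcong P (neg x \<oplus> y) \<I>"
      using that ominus_eq_zero_iff[of "neg x \<oplus> y" \<I>] I
      by (auto simp: mcong_def ideal_zero ominus_def)
    then show ?thesis
      using that by (simp add: mv_le_def quot_simps[OF I] mclass_eq_iff[OF I])
  qed
  moreover have "x \<ominus> y \<in> P \<or> y \<ominus> x \<in> P" if "x \<in> carrier M" "y \<in> carrier M" for x y
    using P that by (simp add: mv_prime_def)
  ultimately show ?thesis unfolding mv_linear_def quot_simps[OF I] by blast
qed

section \<open>Prime ideals\<close>

definition ideal_adjoin where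
  "ideal_adjoin I a = {z \<in> carrier M. \<exists>p\<in>I. \<exists>n. z \<lesssim> p \<oplus> mv_nmult M n a}"

lemma nmult_add:
  "a \<in> carrier M \<Longrightarrow> mv_nmult M (m + n) a = mv_nmult M m a \<oplus> mv_nmult M n a"
  by (induction n) (auto simp: plus_assoc)

lemma ideal_adjoin_ideal:
  assumes I: "mv_ideal I" and a: "a \<in> carrier M"
  shows "mv_ideal (ideal_adjoin I a)" "I \<subseteq> ideal_adjoin I a" "a \<in> ideal_adjoin I a"
proof -
  have "x \<oplus> y \<in> ideal_adjoin I a" if xy: "x \<in> ideal_adjoin I a" "y \<in> ideal_adjoin I a" for x y
  proof -
    obtain p q m n where *: "x \<in> carrier M" "y \<in> carrier M" "p \<in> I" "q \<in> I"
      "x \<lesssim> p \<oplus> mv_nmult M m a" "y \<lesssim> q \<oplus> mv_nmult M n a"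
      using xy by (auto simp: ideal_adjoin_def)
    have "p \<in> carrier M" "q \<in> carrier M" using * ideal_carrier[OF I] by auto
    then have "x \<oplus> y \<lesssim> (p \<oplus> q) \<oplus> mv_nmult M (m + n) a"
      using plus_mono[OF *(5,6)] * a by (simp add: nmult_add plus_ac)
    then show ?thesis using * ideal_plus[OF I] by (auto simp: ideal_adjoin_def)
  qed
  moreover have "x \<in> ideal_adjoin I a"
    if xy: "x \<in> carrier M" "y \<in> ideal_adjoin I a" "x \<lesssim> y" for x y
  proof -
    obtain p n where *: "y \<in> carrier M" "p \<in> I" "y \<lesssim> p \<oplus> mv_nmult M n a"
      using xy by (auto simp: ideal_adjoin_def)
    then have "x \<lesssim> p \<oplus> mv_nmult M n a"
      using mle_trans[OF xy(3) *(3)] xy a ideal_carrier[OF I *(2)] by simp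
    then show ?thesis using * xy by (auto simp: ideal_adjoin_def)
  qed
  moreover have "\<zero> \<in> ideal_adjoin I a"
    using ideal_zero[OF I] a by (auto simp: ideal_adjoin_def intro!: bexI[of _ \<zero>] exI[of _ 0])
  ultimately show "mv_ideal (ideal_adjoin I a)"
    by (auto simp: mv_ideal_def ideal_adjoin_def)
  show "I \<subseteq> ideal_adjoin I a"
  proof
    fix x assume x: "x \<in> I"
    then have "x \<lesssim> x \<oplus> mv_nmult M 0 a" using ideal_carrier[OF I] by simp
    then show "x \<in> ideal_adjoin I a"
      using x ideal_carrier[OF I] unfolding ideal_adjoin_def by blast
  qed
  show "a \<in> ideal_adjoin I a"
    using a ideal_zero[OF I] by (auto simp: ideal_adjoin_def intro!: bexI[of _ \<zero>] exI[of _ 1])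
qed

text \<open>An ideal P maximal among those disjoint from \<open>X\<close> is prime. If neither
  difference of x and y were in P, adjoining either one would hit \<open>X\<close>, and by
  directedness some h in \<open>X\<close> lies below both hits. Modulo P this h is below multiples
  of two disjoint elements, so h is in P. In the applications \<open>X\<close> collects the errors
  to be excluded.\<close>

theorem prime_ideal_avoiding:
  assumes X: "X \<subseteq> carrier M" "X \<noteq> {}" "\<zero> \<notin> X"
    and dir: "\<And>x y. \<lbrakk>x \<in> X; y \<in> X\<rbrakk> \<Longrightarrow> \<exists>z\<in>X. z \<lesssim> x \<and> z \<lesssim> y"
  obtains P where "mv_prime P" "P \<inter> X = {}"
proof -
  define \<A> where "\<A> = {I. mv_ideal I \<and> I \<inter> X = {}}"
  have "{\<zero>} \<in> \<A>" using X by (auto simp: \<A>_def mv_ideal_def mle_zero_iff)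
  moreover have "\<Union>C \<in> \<A>" if C: "C \<noteq> {}" "subset.chain \<A> C" for C
  proof -
    have CA: "C \<subseteq> \<A>" and tot: "\<And>I J. I \<in> C \<Longrightarrow> J \<in> C \<Longrightarrow> I \<subseteq> J \<or> J \<subseteq> I"
      using C by (auto simp: subset.chain_def)
    have "x \<oplus> y \<in> \<Union>C" if "x \<in> \<Union>C" "y \<in> \<Union>C" for x y
    proof -
      obtain I J where *: "x \<in> I" "y \<in> J" "I \<in> C" "J \<in> C" using \<open>x \<in> \<Union>C\<close> \<open>y \<in> \<Union>C\<close> by auto
      then obtain N where "N \<in> C" "x \<in> N" "y \<in> N" using tot[of I J] by auto
      then show ?thesis using CA ideal_plus[of N x y] by (auto simp: \<A>_def)
    qed
    moreover have "x \<in> \<Union>C" if "x \<in> carrier M" "y \<in> \<Union>C" "x \<lesssim> y" for x y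
      using that CA ideal_down[of _ y x] by (auto simp: \<A>_def)
    moreover have "\<Union>C \<subseteq> carrier M" using CA by (auto simp: \<A>_def mv_ideal_def)
    moreover have "\<zero> \<in> \<Union>C" using C CA by (auto simp: \<A>_def mv_ideal_def)
    ultimately have "mv_ideal (\<Union>C)" unfolding mv_ideal_def by blast
    then show ?thesis using CA by (auto simp: \<A>_def)
  qed
  ultimately obtain P where P: "P \<in> \<A>" and max: "\<And>I. I \<in> \<A> \<Longrightarrow> P \<subseteq> I \<Longrightarrow> I = P"
    using subset_Zorn_nonempty[of \<A>] by (metis empty_iff)
  have I: "mv_ideal P" using P by (simp add: \<A>_def)
  have hit: "\<exists>f\<in>X. \<exists>p\<in>P. \<exists>n. f \<lesssim> p \<oplus> mv_nmult M n a" if "a \<in> carrier M" "a \<notin> P" for a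
  proof -
    have "ideal_adjoin P a \<notin> \<A>"
      using max[of "ideal_adjoin P a"] ideal_adjoin_ideal[OF I that(1)] that by auto
    then show ?thesis using ideal_adjoin_ideal(1)[OF I that(1)] by (auto simp: \<A>_def ideal_adjoin_def)
  qed
  have "x \<ominus> y \<in> P \<or> y \<ominus> x \<in> P" if xy: "x \<in> carrier M" "y \<in> carrier M" for x y
  proof (rule ccontr)
    assume "\<not> ?thesis"
    then obtain f g p q m n where *: "f \<in> X" "g \<in> X" "p \<in> P" "q \<in> P"
      "f \<lesssim> p \<oplus> mv_nmult M m (x \<ominus> y)" "g \<lesssim> q \<oplus> mv_nmult M n (y \<ominus> x)"
      using hit[of "x \<ominus> y"] hit[of "y \<ominus> x"] xy by auto
    obtain h where h: "h \<in> X" "h \<lesssim> f" "h \<lesssim> g" using dir * by blast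
    have c: "f \<in> carrier M" "g \<in> carrier M" "h \<in> carrier M" "p \<in> carrier M" "q \<in> carrier M"
      using X * h ideal_carrier[OF I] by auto
    \<comment> \<open>Subtracting p + q removes the P-part of both hits at once, so that one element
      lies below both multiples.\<close>
    have "h \<ominus> (p \<oplus> q) \<lesssim> mv_nmult M m (x \<ominus> y)"
    proof -
      have "h \<ominus> (p \<oplus> q) \<lesssim> f \<ominus> p" using h c by (intro ominus_mono mle_plus) auto
      moreover have "f \<ominus> p \<lesssim> mv_nmult M m (x \<ominus> y)" using * c xy by (simp add: ominus_mle_iff)
      ultimately show ?thesis using c xy by (meson mle_trans ops_closed(1) nmult_closed mv_closed(1))
    qed
    moreover have "h \<ominus> (p \<oplus> q) \<lesssim> mv_nmult M n (y \<ominus> x)"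
    proof -
      have "h \<ominus> (p \<oplus> q) \<lesssim> g \<ominus> q" using h c by (intro ominus_mono mle_plus') auto
      moreover have "g \<ominus> q \<lesssim> mv_nmult M n (y \<ominus> x)" using * c xy by (simp add: ominus_mle_iff)
      ultimately show ?thesis using c xy by (meson mle_trans ops_closed(1) nmult_closed mv_closed(1))
    qed
    ultimately have "h \<ominus> (p \<oplus> q) = \<zero>"
      using disjoint_nmult[of "x \<ominus> y" "y \<ominus> x" "h \<ominus> (p \<oplus> q)" m n] ominus_disjoint[of x y] xy c by auto
    then have "h \<in> P"
      using ideal_down[OF I ideal_plus[OF I *(3,4)], of h] c by (simp add: ominus_eq_zero_iff)
    then show False using h P by (auto simp: \<A>_def)
  qed
  then have "mv_prime P" using I by (simp add: mv_prime_def)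
  then show ?thesis using that P by (auto simp: \<A>_def)
qed

end

section \<open>Linearly ordered Abelian groups\<close>

lemma (in comm_monoid) m_interchange:
  "\<lbrakk>a \<in> carrier G; b \<in> carrier G; c \<in> carrier G; d \<in> carrier G\<rbrakk> \<Longrightarrow>
    a \<otimes> b \<otimes> (c \<otimes> d) = (a \<otimes> c) \<otimes> (b \<otimes> d)"
  by (simp add: m_ac)

locale linear_lgroup = abelian_lgroup +
  assumes total: "\<lbrakk>x \<in> carrier G; y \<in> carrier G\<rbrakk> \<Longrightarrow> lg_le G x y \<or> lg_le G y x"

text \<open>Differences do not change under translation, which gives invariance of the order. The
  lattice structure comes from totality alone, without constructing meets and joins.\<close>

lemma linear_lgroup_of_cone:
  fixes G (structure)
  assumes G: "comm_group G"
    and le: "\<And>x y. \<lbrakk>x \<in> carrier G; y \<in> carrier G\<rbrakk> \<Longrightarrow> lg_le G x y \<longleftrightarrow> y \<otimes> inv x \<in> Q"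
    and mult: "\<And>x y. \<lbrakk>x \<in> Q; y \<in> Q\<rbrakk> \<Longrightarrow> x \<otimes> y \<in> Q"
    and total: "\<And>x. x \<in> carrier G \<Longrightarrow> x \<in> Q \<or> inv x \<in> Q"
    and antisym: "\<And>x. \<lbrakk>x \<in> carrier G; x \<in> Q; inv x \<in> Q\<rbrakk> \<Longrightarrow> x = \<one>"
  shows "linear_lgroup G"
proof -
  interpret comm_group G by (rule G)
  have one: "\<one> \<in> Q" using total[of \<one>] by simp
  have tot: "lg_le G x y \<or> lg_le G y x" if "x \<in> carrier G" "y \<in> carrier G" for x y
    using that total[of "y \<otimes> inv x"] by (simp add: le inv_mult m_comm)
  have trans: "lg_le G x z"
    if xyz: "x \<in> carrier G" "y \<in> carrier G" "z \<in> carrier G" and d: "lg_le G x y" "lg_le G y z" for x y z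
  proof -
    have "inv y \<otimes> (y \<otimes> inv x) = inv x"
      using xyz by (simp add: m_assoc[symmetric])
    then have "z \<otimes> inv y \<otimes> (y \<otimes> inv x) = z \<otimes> inv x"
      using xyz by (simp add: m_assoc)
    then show ?thesis using mult[of "z \<otimes> inv y" "y \<otimes> inv x"] that by (simp add: le)
  qed
  have anti: "x = y" if xy: "x \<in> carrier G" "y \<in> carrier G" "lg_le G x y" "lg_le G y x" for x y
  proof -
    have "y \<otimes> inv x = \<one>"
      using antisym[of "y \<otimes> inv x"] xy by (simp add: le inv_mult m_comm)
    then show ?thesis using xy inv_equality[of y "inv x"] by simp
  qed
  have "partial_order (lg_order G)"
    by (unfold_locales; unfold lg_order_simps) (use one le in \<open>simp; fail | blast intro: trans anti\<close>)+
  then interpret T: total_order "lg_order G"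
    by (rule partial_order.total_orderI) (use tot in \<open>auto simp: lg_order_def\<close>)
  have "lattice (lg_order G)" by unfold_locales
  then have "abelian_lgroup_axioms G"
  proof (rule abelian_lgroup_axioms.intro)
    fix x y z assume xyz: "x \<in> carrier G" "y \<in> carrier G" "z \<in> carrier G" "lg_le G x y"
    have "y \<otimes> z \<otimes> inv (x \<otimes> z) = (y \<otimes> inv x) \<otimes> (z \<otimes> inv z)"
      using xyz by (simp add: inv_mult m_ac del: r_inv)
    then have "y \<otimes> z \<otimes> inv (x \<otimes> z) = y \<otimes> inv x" using xyz by simp
    then show "lg_le G (x \<otimes> z) (y \<otimes> z)" using xyz by (simp add: le)
  qed
  then show ?thesis
    by (intro linear_lgroup.intro abelian_lgroup.intro linear_lgroup_axioms.intro G tot)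
qed

text \<open>Zorn on the submonoids that contain \<open>C\<close> and avoid all positive multiples of
  \<open>e\<close>. If a maximal Q contained neither x nor -x, adjoining either would produce
  multiples N e = p + n x and M e = q - m x with p, q in Q; then (N m + M n) e = m p + n q lies in
  Q. This argument yields only some multiple of \<open>e\<close>, so all of them must be excluded
  from the start.\<close>

theorem (in comm_group) total_cone_avoiding:
  assumes C: "C \<subseteq> carrier G" "\<one> \<in> C" "\<And>x y. \<lbrakk>x \<in> C; y \<in> C\<rbrakk> \<Longrightarrow> x \<otimes> y \<in> C"
    and e: "e \<in> carrier G" "\<And>n::nat. n \<ge> 1 \<Longrightarrow> e [^] n \<notin> C"
  obtains Q where "C \<subseteq> Q" "Q \<subseteq> carrier G" "\<And>x y. \<lbrakk>x \<in> Q; y \<in> Q\<rbrakk> \<Longrightarrow> x \<otimes> y \<in> Q"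
    "\<And>x. x \<in> carrier G \<Longrightarrow> x \<in> Q \<or> inv x \<in> Q" "e \<notin> Q"
proof -
  define \<A> where "\<A> = {Q. C \<subseteq> Q \<and> Q \<subseteq> carrier G \<and> (\<forall>x\<in>Q. \<forall>y\<in>Q. x \<otimes> y \<in> Q) \<and>
    (\<forall>n::nat. n \<ge> 1 \<longrightarrow> e [^] n \<notin> Q)}"
  have "C \<in> \<A>" using assms by (auto simp: \<A>_def)
  moreover have "\<Union>\<C> \<in> \<A>" if \<C>: "\<C> \<noteq> {}" "subset.chain \<A> \<C>" for \<C>
  proof -
    have CA: "\<C> \<subseteq> \<A>" and tot: "\<And>I J. I \<in> \<C> \<Longrightarrow> J \<in> \<C> \<Longrightarrow> I \<subseteq> J \<or> J \<subseteq> I"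
      using \<C> by (auto simp: subset.chain_def)
    have "x \<otimes> y \<in> \<Union>\<C>" if xy: "x \<in> \<Union>\<C>" "y \<in> \<Union>\<C>" for x y
    proof -
      obtain I J where *: "x \<in> I" "y \<in> J" "I \<in> \<C>" "J \<in> \<C>" using xy by auto
      then obtain N where N: "N \<in> \<C>" "x \<in> N" "y \<in> N" using tot[of I J] by auto
      then have "x \<otimes> y \<in> N" using CA by (auto simp: \<A>_def)
      then show ?thesis using N by auto
    qed
    moreover have "C \<subseteq> \<Union>\<C>"
    proof -
      obtain I where "I \<in> \<C>" using \<C>(1) by blast
      moreover from this have "C \<subseteq> I" using CA by (auto simp: \<A>_def)
      ultimately show ?thesis by blast
    qed
    moreover have "\<Union>\<C> \<subseteq> carrier G" "\<forall>n::nat. n \<ge> 1 \<longrightarrow> e [^] n \<notin> \<Union>\<C>"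
      using CA by (auto simp: \<A>_def)
    ultimately show ?thesis unfolding \<A>_def by blast
  qed
  ultimately obtain Q where Q: "Q \<in> \<A>" and max: "\<And>I. I \<in> \<A> \<Longrightarrow> Q \<subseteq> I \<Longrightarrow> I = Q"
    using subset_Zorn_nonempty[of \<A>] by (metis empty_iff)
  have QG: "x \<in> carrier G" if "x \<in> Q" for x using that Q by (auto simp: \<A>_def)
  have Qm: "x \<otimes> y \<in> Q" if "x \<in> Q" "y \<in> Q" for x y using that Q by (auto simp: \<A>_def)
  have Qe: "e [^] n \<notin> Q" if "n \<ge> 1" for n :: nat using that Q by (auto simp: \<A>_def)
  have Q1: "\<one> \<in> Q" using Q C by (auto simp: \<A>_def)
  have Qp: "x [^] n \<in> Q" if "x \<in> Q" for x and n :: nat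
    by (induction n) (use that Q1 Qm in auto)
  have hit: "\<exists>(N::nat) (n::nat) q. N \<ge> 1 \<and> n \<ge> 1 \<and> q \<in> Q \<and> e [^] N = q \<otimes> x [^] n"
    if x: "x \<in> carrier G" "x \<notin> Q" for x
  proof -
    define R where "R = {q \<otimes> x [^] n | q (n::nat). q \<in> Q}"
    have QR: "Q \<subseteq> R"
    proof
      fix q assume "q \<in> Q"
      then have "q = q \<otimes> x [^] (0::nat)" using QG by simp
      then show "q \<in> R" using \<open>q \<in> Q\<close> unfolding R_def by blast
    qed
    have "x = \<one> \<otimes> x [^] (1::nat)" using x by simp
    then have "x \<in> R" using Q1 unfolding R_def by blast
    have "y \<otimes> z \<in> R" if yz: "y \<in> R" "z \<in> R" for y z
    proof -
      obtain p q m n where *: "p \<in> Q" "q \<in> Q" "y = p \<otimes> x [^] (m::nat)" "z = q \<otimes> x [^] (n::nat)"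
        using yz by (auto simp: R_def)
      have "y \<otimes> z = (p \<otimes> q) \<otimes> (x [^] m \<otimes> x [^] n)" using * x QG by (simp add: m_ac)
      also have "x [^] m \<otimes> x [^] n = x [^] (m + n)" using x by (simp add: nat_pow_mult)
      finally show ?thesis using Qm[OF *(1,2)] unfolding R_def by blast
    qed
    moreover have "R \<subseteq> carrier G" using x QG by (auto simp: R_def)
    moreover have "C \<subseteq> R" using QR Q by (auto simp: \<A>_def)
    moreover have "R \<notin> \<A>" using max[OF _ QR] \<open>x \<in> R\<close> x by auto
    ultimately obtain N :: nat where N: "N \<ge> 1" "e [^] N \<in> R" unfolding \<A>_def by blast
    then obtain q n where q: "q \<in> Q" "e [^] N = q \<otimes> x [^] (n::nat)" by (auto simp: R_def)
    then have "n \<noteq> 0" using Qe[OF N(1)] QG by (cases n) auto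
    then show ?thesis using N q by (metis One_nat_def Suc_leI neq0_conv)
  qed
  have "x \<in> Q \<or> inv x \<in> Q" if x: "x \<in> carrier G" for x
  proof (rule ccontr)
    assume "\<not> ?thesis"
    then obtain N n p M m q where *: "N \<ge> (1::nat)" "n \<ge> (1::nat)" "p \<in> Q" "e [^] N = p \<otimes> x [^] n"
      "M \<ge> (1::nat)" "m \<ge> (1::nat)" "q \<in> Q" "e [^] M = q \<otimes> inv x [^] m"
      using hit[of x] hit[of "inv x"] x by auto
    have "e [^] (N * m + M * n) = (e [^] N) [^] m \<otimes> (e [^] M) [^] n"
      using e by (simp add: nat_pow_mult nat_pow_pow)
    also have "\<dots> = p [^] m \<otimes> (x [^] n) [^] m \<otimes> (q [^] n \<otimes> (inv x [^] m) [^] n)"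
      unfolding * using x QG[OF *(3)] QG[OF *(7)] by (simp add: pow_mult_distrib m_comm)
    also have "(x [^] n) [^] m = x [^] (n * m)" using x by (simp add: nat_pow_pow)
    also have "(inv x [^] m) [^] n = inv (x [^] (n * m))"
      using x by (simp add: nat_pow_pow nat_pow_inv mult.commute)
    also have "p [^] m \<otimes> x [^] (n * m) \<otimes> (q [^] n \<otimes> inv (x [^] (n * m))) =
        (p [^] m \<otimes> q [^] n) \<otimes> (x [^] (n * m) \<otimes> inv (x [^] (n * m)))"
      using x QG[OF *(3)] QG[OF *(7)] by (simp add: m_ac del: r_inv)
    also have "\<dots> = p [^] m \<otimes> q [^] n" using x QG[OF *(3)] QG[OF *(7)] by simp
    also have "\<dots> \<in> Q" using Qm Qp * by blast
    finally have "e [^] (N * m + M * n) \<in> Q" .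
    moreover have "1 \<le> N * m + M * n" using mult_le_mono[OF *(1,6)] by linarith
    ultimately show False using Qe by blast
  qed
  moreover have "C \<subseteq> Q" "Q \<subseteq> carrier G" using Q by (auto simp: \<A>_def)
  moreover have "e \<notin> Q" using Qe[of 1] e(1) by simp
  ultimately show ?thesis using that Qm by blast
qed

text \<open>A total cone gives only a preorder. These are the elements equivalent to the neutral
  element, and dividing by them restores antisymmetry.\<close>

definition cone_units :: "('a, 'm) monoid_scheme \<Rightarrow> 'a set \<Rightarrow> 'a set" where
  "cone_units G Q = {x \<in> Q. inv\<^bsub>G\<^esub> x \<in> Q}"

definition cone_quot :: "('a, 'm) monoid_scheme \<Rightarrow> 'a set \<Rightarrow> 'a set lgroup" where
  "cone_quot G Q = (let F = G Mod cone_units G Q in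
     \<lparr>carrier = carrier F, mult = mult F, one = one F,
      lg_le = (\<lambda>X Y. Y \<otimes>\<^bsub>F\<^esub> inv\<^bsub>F\<^esub> X \<in> (\<lambda>x. cone_units G Q #>\<^bsub>G\<^esub> x) ` Q)\<rparr>)"

theorem (in comm_group) cone_quot:
  assumes Q: "Q \<subseteq> carrier G" "\<And>x y. \<lbrakk>x \<in> Q; y \<in> Q\<rbrakk> \<Longrightarrow> x \<otimes> y \<in> Q"
    "\<And>x. x \<in> carrier G \<Longrightarrow> x \<in> Q \<or> inv x \<in> Q"
  defines "\<pi> \<equiv> \<lambda>x. cone_units G Q #> x"
  shows "linear_lgroup (cone_quot G Q)" "\<pi> \<in> hom G (cone_quot G Q)"
    "\<lbrakk>x \<in> carrier G; y \<in> carrier G\<rbrakk> \<Longrightarrow> lg_le (cone_quot G Q) (\<pi> x) (\<pi> y) \<longleftrightarrow> y \<otimes> inv x \<in> Q"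
    "\<lbrakk>x \<in> carrier G; y \<in> carrier G\<rbrakk> \<Longrightarrow> \<pi> x = \<pi> y \<longleftrightarrow> y \<otimes> inv x \<in> Q \<and> x \<otimes> inv y \<in> Q"
proof -
  let ?N = "cone_units G Q" and ?F = "G Mod cone_units G Q" and ?D = "cone_quot G Q"
  have QG: "x \<in> carrier G" if "x \<in> Q" for x using that Q(1) by auto
  have one: "\<one> \<in> Q" using Q(3)[of \<one>] by simp
  have N: "subgroup ?N G"
    by unfold_locales (use Q(2) one QG in \<open>auto simp: cone_units_def inv_mult\<close>)
  then interpret N: normal ?N G by (rule subgroup_imp_normal)
  have FG: "comm_group ?F" by (rule abelian_FactGroup[OF N])
  then interpret F: comm_group ?F .
  have D: "carrier ?D = carrier ?F" "mult ?D = mult ?F" "\<one>\<^bsub>?D\<^esub> = \<one>\<^bsub>?F\<^esub>"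
    by (simp_all add: cone_quot_def Let_def)
  have inv: "inv\<^bsub>?D\<^esub> X = inv\<^bsub>?F\<^esub> X" for X by (simp add: m_inv_def D)
  have CD: "comm_group ?D"
    by (rule comm_groupI, unfold D)
      (rule F.m_closed F.one_closed F.m_assoc F.m_comm F.l_one F.l_inv_ex; assumption)+
  have homF: "\<pi> \<in> hom G ?F" unfolding \<pi>_def by (rule N.r_coset_hom_Mod)
  then show hom: "\<pi> \<in> hom G ?D" by (simp add: hom_def D)
  interpret h: group_hom G ?F \<pi>
    by (intro group_hom.intro group_hom_axioms.intro homF) unfold_locales
  have le: "lg_le ?D X Y \<longleftrightarrow> Y \<otimes>\<^bsub>?F\<^esub> inv\<^bsub>?F\<^esub> X \<in> \<pi> ` Q" for X Y
    by (simp add: cone_quot_def Let_def \<pi>_def)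
  have eq: "\<pi> x = \<pi> y \<longleftrightarrow> x \<otimes> inv y \<in> ?N" if "x \<in> carrier G" "y \<in> carrier G" for x y
  proof -
    have "\<pi> x = \<pi> y \<longleftrightarrow> x \<in> ?N #> y"
      unfolding \<pi>_def using repr_independence[OF _ _ N, of x y] rcos_self[OF _ N, of x] that by metis
    also have "\<dots> \<longleftrightarrow> x \<otimes> inv y \<in> ?N"
      by (meson that N subgroup.rcos_module group_axioms is_group)
    finally show ?thesis .
  qed
  then show "\<pi> x = \<pi> y \<longleftrightarrow> y \<otimes> inv x \<in> Q \<and> x \<otimes> inv y \<in> Q"
    if "x \<in> carrier G" "y \<in> carrier G" for x y
    using that by (auto simp: cone_units_def inv_mult m_comm)
  \<comment> \<open>\<open>Q\<close> is a union of cosets of the units, so positivity of a coset can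
    be tested on any representative.\<close>
  have img: "\<pi> x \<in> \<pi> ` Q \<longleftrightarrow> x \<in> Q" if x: "x \<in> carrier G" for x
  proof
    assume "\<pi> x \<in> \<pi> ` Q"
    then obtain q where q: "q \<in> Q" "x \<otimes> inv q \<in> ?N" using eq x QG by auto
    then have "x \<otimes> inv q \<otimes> q \<in> Q" using Q(2) by (auto simp: cone_units_def)
    then show "x \<in> Q" using x q QG by (simp add: m_assoc)
  qed auto
  then show "lg_le ?D (\<pi> x) (\<pi> y) \<longleftrightarrow> y \<otimes> inv x \<in> Q"
    if "x \<in> carrier G" "y \<in> carrier G" for x y
    using img[of "y \<otimes> inv x"] that by (simp add: le)
  have surj: "carrier ?F = \<pi> ` carrier G"
    by (auto simp: FactGroup_def RCOSETS_def \<pi>_def)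
  show "linear_lgroup ?D"
  proof (rule linear_lgroup_of_cone[OF CD, where Q = "\<pi> ` Q"])
    fix X Y assume "X \<in> \<pi> ` Q" "Y \<in> \<pi> ` Q"
    then obtain x y where xy: "x \<in> Q" "y \<in> Q" "X = \<pi> x" "Y = \<pi> y" by auto
    then have "X \<otimes>\<^bsub>?D\<^esub> Y = \<pi> (x \<otimes> y)" using hom_mult[OF hom, of x y] QG by simp
    then show "X \<otimes>\<^bsub>?D\<^esub> Y \<in> \<pi> ` Q" using Q(2)[of x y] xy by simp
  next
    fix X assume "X \<in> carrier ?D"
    then obtain x where x: "x \<in> carrier G" "X = \<pi> x" by (auto simp: D surj)
    then have ix: "inv\<^bsub>?D\<^esub> X = \<pi> (inv x)" using h.hom_inv[of x] by (simp only: inv)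
    show "X \<in> \<pi> ` Q \<or> inv\<^bsub>?D\<^esub> X \<in> \<pi> ` Q"
      using Q(3)[of x] x unfolding ix by blast
    assume "X \<in> \<pi> ` Q" "inv\<^bsub>?D\<^esub> X \<in> \<pi> ` Q"
    then have "x \<in> Q" "inv x \<in> Q" using x img[of x] img[of "inv x"] unfolding ix by auto
    then have "\<pi> x = \<pi> \<one>" using x by (subst eq) (auto simp: cone_units_def)
    then show "X = \<one>\<^bsub>?D\<^esub>" using x h.hom_one by (simp only: D)
  qed (auto simp: le D inv)
qed

section \<open>Separating an element from a subgroup by two homomorphisms\<close>

context linear_lgroup
begin

text \<open>
  The two homomorphisms are the coordinate embeddings into the quotient of \<open>G \<times> G\<close> by a total
  cone that contains the positive pairs and the pairs \<open>(k, k\<^sup>-\<^sup>1)\<close> with \<open>k \<in> K\<close>, but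
  not \<open>(g\<^sup>-\<^sup>1, g)\<close>.
\<close>

theorem separating_homs:
  assumes K: "subgroup K G" and g: "g \<in> carrier G" "\<And>n::nat. n \<ge> 1 \<Longrightarrow> g [^] n \<notin> K"
  obtains B :: "('a \<times> 'a) set lgroup" and \<alpha> \<beta> where "linear_lgroup B"
    "\<alpha> \<in> hom G B" "\<And>x y. \<lbrakk>x \<in> carrier G; y \<in> carrier G; x \<preceq> y\<rbrakk> \<Longrightarrow> lg_le B (\<alpha> x) (\<alpha> y)"
    "\<beta> \<in> hom G B" "\<And>x y. \<lbrakk>x \<in> carrier G; y \<in> carrier G; x \<preceq> y\<rbrakk> \<Longrightarrow> lg_le B (\<beta> x) (\<beta> y)"
    "\<And>k. k \<in> K \<Longrightarrow> \<alpha> k = \<beta> k" "\<alpha> g \<noteq> \<beta> g"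
proof -
  let ?P = "G \<times>\<times> G"
  interpret P: group ?P by (intro DirProd_group is_group)
  interpret P: comm_group ?P by unfold_locales (auto simp: m_comm)
  have KG: "k \<in> carrier G" if "k \<in> K" for k using that K by (rule subgroup.mem_carrier[rotated])
  \<comment> \<open>Making both (k, -k) and (-k, k) positive forces (k, 0) and (0, k) to coincide in
    the quotient; the positive pairs (p, q) make both coordinate maps monotone.\<close>
  define C where "C = {(p \<otimes> k, q \<otimes> inv k) | p q k.
    p \<in> carrier G \<and> q \<in> carrier G \<and> \<one> \<preceq> p \<and> \<one> \<preceq> q \<and> k \<in> K}"
  have pos: "\<one> \<preceq> x \<otimes> y" if "\<one> \<preceq> x" "\<one> \<preceq> y" "x \<in> carrier G" "y \<in> carrier G" for x y
    using mult_mono[OF that(1,2)] that by simp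
  have CI: "(p \<otimes> k, q \<otimes> inv k) \<in> C"
    if "p \<in> carrier G" "q \<in> carrier G" "\<one> \<preceq> p" "\<one> \<preceq> q" "k \<in> K" for p q k
    using that unfolding C_def by blast
  have K1: "\<one> \<in> K" using K by (rule subgroup.one_closed)
  have pow: "(x, y) [^]\<^bsub>?P\<^esub> n = (x [^] n, y [^] n)" for x y and n :: nat
    by (induction n) auto
  have "C \<subseteq> carrier ?P" using KG by (auto simp: C_def)
  moreover have "\<one>\<^bsub>?P\<^esub> \<in> C" using CI[of \<one> \<one> \<one>] K1 le_refl by simp
  moreover have "x \<otimes>\<^bsub>?P\<^esub> y \<in> C" if xy: "x \<in> C" "y \<in> C" for x y
  proof -
    obtain p q k p' q' k' where *: "x = (p \<otimes> k, q \<otimes> inv k)" "y = (p' \<otimes> k', q' \<otimes> inv k')"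
      "p \<in> carrier G" "q \<in> carrier G" "\<one> \<preceq> p" "\<one> \<preceq> q" "k \<in> K"
      "p' \<in> carrier G" "q' \<in> carrier G" "\<one> \<preceq> p'" "\<one> \<preceq> q'" "k' \<in> K"
      using xy unfolding C_def by blast
    then have "x \<otimes>\<^bsub>?P\<^esub> y = ((p \<otimes> p') \<otimes> (k \<otimes> k'), (q \<otimes> q') \<otimes> inv (k \<otimes> k'))"
      using KG by (simp add: m_ac inv_mult)
    then show ?thesis using CI[of "p \<otimes> p'" "q \<otimes> q'" "k \<otimes> k'"] * pos subgroup.m_closed[OF K] by simp
  qed
  moreover have "(inv g, g) \<in> carrier ?P" using g by simp
  \<comment> \<open>If (-n g, n g) = (p + k, q - k), adding the coordinates gives p + q = 0 with p,
    q >= 0. Hence q = 0 and n g = -k lies in K, contrary to the choice of g.\<close>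
  moreover have "(inv g, g) [^]\<^bsub>?P\<^esub> n \<notin> C" if n: "n \<ge> 1" for n :: nat
  proof
    assume "(inv g, g) [^]\<^bsub>?P\<^esub> n \<in> C"
    then obtain p q k where *: "inv (g [^] n) = p \<otimes> k" "g [^] n = q \<otimes> inv k"
      "p \<in> carrier G" "q \<in> carrier G" "\<one> \<preceq> p" "\<one> \<preceq> q" "k \<in> K"
      using g by (auto simp: pow C_def nat_pow_inv)
    have "p \<otimes> k \<otimes> (q \<otimes> inv k) = p \<otimes> q \<otimes> (k \<otimes> inv k)"
      using *(3,4,7) KG by (intro m_interchange) auto
    also have "\<dots> = p \<otimes> q" using *(3,4,7) KG by simp
    finally have "p \<otimes> q = p \<otimes> k \<otimes> (q \<otimes> inv k)" ..
    also have "\<dots> = inv (g [^] n) \<otimes> g [^] n" by (simp only: *(1)[symmetric] *(2)[symmetric])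
    also have "\<dots> = \<one>" using g by simp
    finally have pq: "p \<otimes> q = \<one>" .
    then have "q \<preceq> \<one>" using translation[OF _ _ _ \<open>\<one> \<preceq> p\<close>, of q] * by simp
    then have "q = \<one>" using * le_antisym[of q \<one>] by simp
    then have "g [^] n = inv k" using * KG by simp
    then show False using g(2)[OF n] subgroup.m_inv_closed[OF K] * by simp
  qed
  ultimately obtain Q where Q: "C \<subseteq> Q" "Q \<subseteq> carrier ?P"
    "\<And>x y. \<lbrakk>x \<in> Q; y \<in> Q\<rbrakk> \<Longrightarrow> x \<otimes>\<^bsub>?P\<^esub> y \<in> Q"
    "\<And>x. x \<in> carrier ?P \<Longrightarrow> x \<in> Q \<or> inv\<^bsub>?P\<^esub> x \<in> Q" "(inv g, g) \<notin> Q"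
    using P.total_cone_avoiding[of C "(inv g, g)"] by metis
  define \<pi> where "\<pi> = (\<lambda>x. cone_units ?P Q #>\<^bsub>?P\<^esub> x)"
  define B where "B = cone_quot ?P Q"
  note B = P.cone_quot[OF Q(2-4), folded \<pi>_def B_def]
  have inv: "inv\<^bsub>?P\<^esub> (x, y) = (inv x, inv y)" if "x \<in> carrier G" "y \<in> carrier G" for x y
    using that by (simp add: inv_DirProd is_group)
  have diff: "\<one> \<preceq> y \<otimes> inv x" if "x \<in> carrier G" "y \<in> carrier G" "x \<preceq> y" for x y
    using translation[OF _ _ _ that(3), of "inv x"] that by simp
  show ?thesis
  proof (rule that[of B "\<lambda>x. \<pi> (x, \<one>)" "\<lambda>x. \<pi> (\<one>, x)"])
    show "linear_lgroup B" by (rule B)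
    show "(\<lambda>x. \<pi> (x, \<one>)) \<in> hom G B"
    proof (rule homI)
      fix x y assume "x \<in> carrier G" "y \<in> carrier G"
      then show "\<pi> (x \<otimes> y, \<one>) = \<pi> (x, \<one>) \<otimes>\<^bsub>B\<^esub> \<pi> (y, \<one>)"
        using hom_mult[OF B(2), of "(x, \<one>)" "(y, \<one>)"] by simp
    qed (use hom_carrier[OF B(2)] in auto)
    show "(\<lambda>x. \<pi> (\<one>, x)) \<in> hom G B"
    proof (rule homI)
      fix x y assume "x \<in> carrier G" "y \<in> carrier G"
      then show "\<pi> (\<one>, x \<otimes> y) = \<pi> (\<one>, x) \<otimes>\<^bsub>B\<^esub> \<pi> (\<one>, y)"
        using hom_mult[OF B(2), of "(\<one>, x)" "(\<one>, y)"] by simp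
    qed (use hom_carrier[OF B(2)] in auto)
    fix x y assume xy: "x \<in> carrier G" "y \<in> carrier G" "x \<preceq> y"
    show "lg_le B (\<pi> (x, \<one>)) (\<pi> (y, \<one>))"
      using B(3)[of "(x, \<one>)" "(y, \<one>)"] CI[of "y \<otimes> inv x" \<one> \<one>] diff[OF xy] xy K1 Q(1) le_refl[of \<one>]
      by (auto simp: inv)
    show "lg_le B (\<pi> (\<one>, x)) (\<pi> (\<one>, y))"
      using B(3)[of "(\<one>, x)" "(\<one>, y)"] CI[of \<one> "y \<otimes> inv x" \<one>] diff[OF xy] xy K1 Q(1) le_refl[of \<one>]
      by (auto simp: inv)
  next
    fix k assume k: "k \<in> K"
    have "(inv k, k) \<in> C" "(k, inv k) \<in> C"
      using CI[of \<one> \<one> "inv k"] CI[of \<one> \<one> k] k KG subgroup.m_inv_closed[OF K] le_refl[of \<one>] by auto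
    then show "\<pi> (k, \<one>) = \<pi> (\<one>, k)"
      using B(4)[of "(k, \<one>)" "(\<one>, k)"] KG[OF k] Q(1) by (auto simp: inv)
  next
    show "\<pi> (g, \<one>) \<noteq> \<pi> (\<one>, g)"
      using B(4)[of "(g, \<one>)" "(\<one>, g)"] g Q(5) by (auto simp: inv)
  qed
qed

end

section \<open>Linearly ordered unital groups and their unit intervals\<close>

lemma Gamma_simps:
  "x \<in> carrier (Gamma G u) \<longleftrightarrow> x \<in> carrier G \<and> lg_le G \<one>\<^bsub>G\<^esub> x \<and> lg_le G x u"
  "mv_plus (Gamma G u) x y = (x \<otimes>\<^bsub>G\<^esub> y) \<sqinter>\<^bsub>lg_order G\<^esub> u"
  "mv_neg (Gamma G u) x = u \<otimes>\<^bsub>G\<^esub> inv\<^bsub>G\<^esub> x"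
  "mv_zero (Gamma G u) = \<one>\<^bsub>G\<^esub>"
  by (simp_all add: Gamma_def)

lemma mv_hom_simps:
  assumes "h \<in> mv_hom M N"
  shows "x \<in> carrier M \<Longrightarrow> h x \<in> carrier N"
    "\<lbrakk>x \<in> carrier M; y \<in> carrier M\<rbrakk> \<Longrightarrow> h (mv_plus M x y) = mv_plus N (h x) (h y)"
    "x \<in> carrier M \<Longrightarrow> h (mv_neg M x) = mv_neg N (h x)"
    "h (mv_zero M) = mv_zero N"
  using assms by (auto simp: mv_hom_def)

lemma mv_hom_one:
  "\<lbrakk>h \<in> mv_hom M N; mv_algebra M\<rbrakk> \<Longrightarrow> h (mv_one M) = mv_one N"
  by (simp add: mv_one_def mv_hom_simps mv_algebra.zero_closed)

lemma mv_hom_comp: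
  "\<lbrakk>f \<in> mv_hom M N; g \<in> mv_hom N K\<rbrakk> \<Longrightarrow> (\<lambda>x. g (f x)) \<in> mv_hom M K"
  by (auto simp: mv_hom_def Pi_iff)

lemma (in abelian_lgroup) Gamma_le_iff:
  assumes u: "u \<in> carrier G" and xy: "x \<in> carrier G" "y \<in> carrier G"
  shows "mv_le (Gamma G u) x y \<longleftrightarrow> x \<preceq> y"
proof -
  have "x \<otimes> (u \<otimes> inv x) = u" using m_lcomm[of x u "inv x"] u xy by simp
  moreover have "y \<otimes> (u \<otimes> inv x) = u \<otimes> inv x \<otimes> y" using u xy by (simp add: m_comm)
  ultimately have "u \<preceq> u \<otimes> inv x \<otimes> y \<longleftrightarrow> x \<preceq> y"
    using translation[of x y "u \<otimes> inv x"] le_cancel[of x "u \<otimes> inv x" y] u xy by auto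
  moreover have "w \<sqinter>\<^bsub>lg_order G\<^esub> u = u \<longleftrightarrow> u \<preceq> w" if "w \<in> carrier G" for w
    using that u by (metis le_antisym le_refl meet_closed meet_left meet_right meet_le)
  ultimately show ?thesis
    using u xy by (simp add: mv_le_def mv_one_def Gamma_simps)
qed

text \<open>Subtracting the meet from two elements leaves disjoint positive p and q. Their
  truncations at v lie in the unit interval, so they are comparable, and the smaller one, being
  below both p and q, is 0. A positive element disjoint from a strong unit is 0, so p or q
  vanishes.\<close>

lemma (in abelian_lgroup) linear_lgroup_of_Gamma:
  assumes v: "strong_unit G v" and lin: "mv_linear (Gamma G v)"
  shows "linear_lgroup G"
proof
  have vG: "v \<in> carrier G" "\<one> \<preceq> v" using v by (auto simp: strong_unit_def)
  \<comment> \<open>Disjointness from v extends to all multiples of v: if z is below h and (n + 1)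
    v, then z - v is below h and n v, so z - v <= 0 by induction, and z is below h and v. Some
    multiple of v dominates h.\<close>
  have disj: "h = \<one>" if h: "h \<in> carrier G" "\<one> \<preceq> h" and d: "h \<sqinter>\<^bsub>lg_order G\<^esub> v = \<one>" for h
  proof -
    have "z \<preceq> \<one>" if "z \<in> carrier G" "z \<preceq> h" "z \<preceq> v [^] n" for z and n :: nat
      using that
    proof (induction n arbitrary: z)
      case (Suc n)
      have "z \<otimes> inv v \<preceq> v [^] n" using le_mult_iff[of "v [^] n" v z] Suc.prems vG by simp
      moreover have "z \<otimes> inv v \<preceq> h"
        using mult_mono[OF Suc.prems(2) inv_le_inv[OF vG(2)]] Suc.prems vG h by simp
      ultimately have "z \<otimes> inv v \<preceq> \<one>" using Suc vG by simp
      then have "z \<preceq> v" using le_mult_iff[of \<one> v z] Suc.prems vG by simp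
      then show ?case using meet_le[of h v z] Suc.prems h vG d by simp
    qed simp
    moreover obtain n :: nat where "h \<preceq> v [^] n" using v h by (auto simp: strong_unit_def)
    ultimately have "h \<preceq> \<one>" using h le_refl by blast
    then show ?thesis using h le_antisym by blast
  qed
  fix x y assume xy: "x \<in> carrier G" "y \<in> carrier G"
  define m where "m = x \<sqinter>\<^bsub>lg_order G\<^esub> y"
  have m: "m \<in> carrier G" "m \<preceq> x" "m \<preceq> y"
    using xy by (auto simp: m_def meet_closed meet_left meet_right)
  define p q where "p = x \<otimes> inv m" and "q = y \<otimes> inv m"
  have pq: "p \<in> carrier G" "q \<in> carrier G" "\<one> \<preceq> p" "\<one> \<preceq> q"
    using translation[OF _ _ _ m(2), of "inv m"] translation[OF _ _ _ m(3), of "inv m"] m xy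
    by (simp_all add: p_def q_def)
  have le_one: "z \<preceq> \<one>" if "z \<in> carrier G" "z \<preceq> p" "z \<preceq> q" for z
  proof -
    have "z \<otimes> m \<preceq> m"
      using that le_mult_iff[of x "inv m" z] le_mult_iff[of y "inv m" z] m xy meet_le[of x y "z \<otimes> m"]
      by (simp add: p_def q_def flip: m_def)
    then show ?thesis using le_mult_iff[of m "inv m" z] that m by simp
  qed
  define a b where "a = p \<sqinter>\<^bsub>lg_order G\<^esub> v" and "b = q \<sqinter>\<^bsub>lg_order G\<^esub> v"
  have ab: "a \<in> carrier G" "a \<preceq> p" "a \<preceq> v" "\<one> \<preceq> a" "b \<in> carrier G" "b \<preceq> q" "b \<preceq> v" "\<one> \<preceq> b"
    using pq vG by (auto simp: a_def b_def meet_closed meet_left meet_right intro!: meet_le)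
  have "a \<preceq> b \<or> b \<preceq> a"
    using lin ab vG Gamma_le_iff unfolding mv_linear_def by (simp add: Gamma_simps)
  then have "a = \<one> \<or> b = \<one>"
    using le_one[of a] le_one[of b] ab pq le_trans[of a b q] le_trans[of b a p] le_antisym by blast
  then have "p = \<one> \<or> q = \<one>" using disj pq by (auto simp: a_def b_def)
  then have "x = m \<or> y = m"
    using inv_equality[of x "inv m"] inv_equality[of y "inv m"] xy m by (auto simp: p_def q_def)
  then show "x \<preceq> y \<or> y \<preceq> x" using m by auto
qed

section \<open>Subalgebras of a totally ordered unit interval and the groups they generate\<close>

context linear_lgroup
begin

lemma meet_eq:
  assumes "x \<in> carrier G" "y \<in> carrier G" "x \<preceq> y"
  shows "x \<sqinter>\<^bsub>lg_order G\<^esub> y = x" "y \<sqinter>\<^bsub>lg_order G\<^esub> x = x"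
  using assms by (metis le_antisym le_refl meet_closed meet_left meet_right meet_le)+

lemma join_eq:
  assumes "x \<in> carrier G" "y \<in> carrier G" "x \<preceq> y"
  shows "x \<squnion>\<^bsub>lg_order G\<^esub> y = y" "y \<squnion>\<^bsub>lg_order G\<^esub> x = y"
  using assms by (metis le_antisym le_refl join_closed join_left join_right join_le)+

text \<open>In a totally ordered group a meet is one of its arguments, so a monotone homomorphism
  preserves meets and with them truncated sums.\<close>

lemma Gamma_hom:
  assumes B: "abelian_lgroup B" and h: "h \<in> hom G B"
    and mono: "\<And>x y. \<lbrakk>x \<in> carrier G; y \<in> carrier G; x \<preceq> y\<rbrakk> \<Longrightarrow> lg_le B (h x) (h y)"
    and u: "u \<in> carrier G"
  shows "h \<in> mv_hom (Gamma G u) (Gamma B (h u))"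
proof -
  interpret B: abelian_lgroup B by (rule B)
  interpret h: group_hom G B h
    by (intro group_hom.intro group_hom_axioms.intro h is_group B.is_group)
  have meet: "h (x \<sqinter>\<^bsub>lg_order G\<^esub> y) = h x \<sqinter>\<^bsub>lg_order B\<^esub> h y"
    if xy: "x \<in> carrier G" "y \<in> carrier G" for x y
  proof -
    have B': "a \<sqinter>\<^bsub>lg_order B\<^esub> b = a" "b \<sqinter>\<^bsub>lg_order B\<^esub> a = a"
      if "a \<in> carrier B" "b \<in> carrier B" "lg_le B a b" for a b
      using that by (metis B.le_antisym B.le_refl B.meet_closed B.meet_left B.meet_right B.meet_le)+
    show ?thesis using total[OF xy] xy mono by (auto simp: meet_eq B')
  qed
  have "lg_le B \<one>\<^bsub>B\<^esub> (h x)" if "x \<in> carrier G" "\<one> \<preceq> x" for x using mono[of \<one> x] that by simp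
  then show ?thesis using u mono by (auto simp: mv_hom_def Gamma_simps meet)
qed

text \<open>Division by v with remainder: for a subalgebra S of the unit interval of a totally
  ordered group, these integer multiples of v plus remainders in S form the group of S.\<close>

definition unit_hull where
  "unit_hull v S = {s \<otimes> v [^] (m::int) | s m. s \<in> S}"

lemma unit_hullI: "s \<in> S \<Longrightarrow> s \<otimes> v [^] (m::int) \<in> unit_hull v S"
  by (auto simp: unit_hull_def)

theorem unit_lsubgroup_unit_hull:
  assumes v: "v \<in> carrier G" "\<one> \<preceq> v"
    and S: "S \<subseteq> carrier (Gamma G v)" "\<one> \<in> S"
      "\<And>x. x \<in> S \<Longrightarrow> mv_neg (Gamma G v) x \<in> S"
      "\<And>x y. \<lbrakk>x \<in> S; y \<in> S\<rbrakk> \<Longrightarrow> mv_plus (Gamma G v) x y \<in> S"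
  shows "unit_lsubgroup G v S (unit_hull v S)"
proof -
  let ?K = "unit_hull v S"
  have SG: "s \<in> carrier G" "\<one> \<preceq> s" "s \<preceq> v" if "s \<in> S" for s
    using S(1) that by (auto simp: Gamma_simps)
  have neg: "v \<otimes> inv s \<in> S" if "s \<in> S" for s using S(3)[OF that] by (simp add: Gamma_simps)
  have plus: "(s \<otimes> t) \<sqinter>\<^bsub>lg_order G\<^esub> v \<in> S" if "s \<in> S" "t \<in> S" for s t
    using S(4)[OF that] by (simp add: Gamma_simps)
  have KG: "x \<in> carrier G" if "x \<in> ?K" for x using that SG v by (auto simp: unit_hull_def)
  have vS: "v \<in> S" using neg[OF S(2)] v by simp
  have SK: "s \<in> ?K" if "s \<in> S" for s using unit_hullI[OF that, of v 0] SG that by simp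
  have m: "x \<otimes> y \<in> ?K" if xy: "x \<in> ?K" "y \<in> ?K" for x y
  proof -
    obtain s t m n where *: "s \<in> S" "t \<in> S" "x = s \<otimes> v [^] (m::int)" "y = t \<otimes> v [^] (n::int)"
      using xy by (auto simp: unit_hull_def)
    note ** = SG[OF *(1)] SG[OF *(2)]
    have e: "x \<otimes> y = (s \<otimes> t) \<otimes> v [^] (m + n)"
      using * ** v by (simp add: int_pow_mult m_ac)
    show ?thesis
    proof (cases "s \<otimes> t \<preceq> v")
      case True
      then have "s \<otimes> t \<in> S" using plus[OF *(1,2)] ** v by (simp add: meet_eq)
      then show ?thesis unfolding e by (rule unit_hullI)
    next
      case False
      then have le: "v \<preceq> s \<otimes> t" using total ** v by blast
      \<comment> \<open>The sum s + t reaches v, so there is a carry. The complements add up without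
        truncation to r = (v - s) + (v - t), and v - r = s + t - v is the new remainder; the carry
        is the extra 1 in m + n + 1.\<close>
      let ?r = "v \<otimes> inv s \<otimes> (v \<otimes> inv t)"
      have "v \<otimes> inv (s \<otimes> t) \<preceq> \<one>"
        using translation[OF _ _ _ le, of "inv (s \<otimes> t)"] ** v by simp
      from translation[OF _ _ _ this, of v] have "?r \<preceq> v"
        using ** v by (simp add: inv_mult m_ac)
      then have "?r \<in> S" using plus[OF neg neg, OF *(1,2)] ** v by (simp add: meet_eq)
      then have "v \<otimes> inv ?r \<in> S" by (rule neg)
      then have "v \<otimes> inv ?r \<otimes> v [^] (m + n + 1) \<in> ?K" by (rule unit_hullI)
      moreover have "v \<otimes> inv ?r \<otimes> v [^] (m + n + 1) = x \<otimes> y"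
      proof -
        have rG: "?r \<in> carrier G" using ** v by simp
        have "?r \<otimes> (s \<otimes> t) = (v \<otimes> inv s \<otimes> s) \<otimes> (v \<otimes> inv t \<otimes> t)"
          using ** v by (intro m_interchange) auto
        also have "\<dots> = v \<otimes> v" using ** v by (simp add: m_assoc)
        finally have c: "s \<otimes> t = inv ?r \<otimes> (v \<otimes> v)"
          using inv_solve_left[of "s \<otimes> t" ?r "v \<otimes> v"] ** v rG by simp
        have "v [^] (m + n + 1) = v \<otimes> v [^] (m + n)"
          using v by (simp add: int_pow_mult m_comm)
        then show ?thesis using rG v unfolding e c by (simp add: m_ac del: inv_mult_group)
      qed
      ultimately show ?thesis by simp
    qed
  qed
  have i: "inv x \<in> ?K" if x: "x \<in> ?K" for x
  proof -
    obtain s m where *: "s \<in> S" "x = s \<otimes> v [^] (m::int)" using x by (auto simp: unit_hull_def)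
    \<comment> \<open>-(s + m v) = (v - s) + (-m - 1) v, so the complement of s serves as the
      remainder of the inverse.\<close>
    have "v \<otimes> inv s \<otimes> v [^] (- m - 1) \<in> ?K" using neg[OF *(1)] by (rule unit_hullI)
    moreover have "v \<otimes> v [^] (- m - 1) = inv (v [^] m)"
      using v int_pow_mult[of v 1 "- m - 1"] by (simp add: int_pow_neg)
    moreover have "v \<otimes> inv s \<otimes> v [^] (- m - 1) = inv s \<otimes> (v \<otimes> v [^] (- m - 1))"
      using SG[OF *(1)] v by (simp add: m_ac)
    ultimately show ?thesis using * SG v by (simp add: inv_mult)
  qed
  have sub: "subgroup ?K G"
    by unfold_locales (use KG m i SK[OF S(2)] in auto)
  have "lsubgroup ?K G"
    unfolding lsubgroup_def
  proof (intro conjI ballI sub)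
    fix x y assume "x \<in> ?K" "y \<in> ?K"
    then show "x \<sqinter>\<^bsub>lg_order G\<^esub> y \<in> ?K" "x \<squnion>\<^bsub>lg_order G\<^esub> y \<in> ?K"
      using total[of x y] KG by (auto simp: meet_eq join_eq)
  qed
  moreover have "carrier (Gamma (G\<lparr>carrier := ?K\<rparr>) v) = S"
  proof (intro equalityI subsetI)
    fix x assume "x \<in> carrier (Gamma (G\<lparr>carrier := ?K\<rparr>) v)"
    then have x: "x \<in> ?K" "\<one> \<preceq> x" "x \<preceq> v" by (auto simp: Gamma_def)
    then obtain s m where *: "s \<in> S" "x = s \<otimes> v [^] (m::int)" by (auto simp: unit_hull_def)
    have one: "\<one> \<preceq> v [^] n" for n :: nat using pow_mono[OF v(2) _ v(1), of n] by simp
    \<comment> \<open>For an element of the interval, m >= 1 gives s + m v >= v and hence the value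
      v, while m <= -1 gives s + m v <= 0 and hence the value 0; both values lie in S.\<close>
    consider "m = 0" | n where "m = 1 + int n" | n where "m = - 1 - int n"
    proof -
      have "m = 0 \<or> m = 1 + int (nat (m - 1)) \<or> m = - 1 - int (nat (- m - 1))" by linarith
      then show thesis using that by blast
    qed
    then show "x \<in> S"
    proof cases
      case 1
      then show ?thesis using * SG by simp
    next
      case 2
      have "v [^] m = v \<otimes> v [^] n" using v 2 by (simp add: int_pow_mult int_pow_int)
      then have "x = v \<otimes> (s \<otimes> v [^] n)" using * SG v by (simp add: m_ac)
      moreover have "v \<otimes> \<one> \<preceq> v \<otimes> (s \<otimes> v [^] n)"
        using mult_mono[OF SG(2)[OF *(1)] one[of n]] SG[OF *(1)] v le_refl by (intro mult_mono) auto
      ultimately have "x = v" using x KG v le_antisym[of x v] by simp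
      then show ?thesis using vS by simp
    next
      case 3
      have "v [^] m = inv v \<otimes> inv (v [^] n)"
        using v 3 int_pow_mult[of v "- 1" "- int n"] by (simp add: int_pow_neg int_pow_int)
      then have "x = s \<otimes> inv v \<otimes> inv (v [^] n)" using * SG v by (simp add: m_ac)
      moreover have "s \<otimes> inv v \<otimes> inv (v [^] n) \<preceq> v \<otimes> inv v \<otimes> inv \<one>"
        using SG[OF *(1)] v one le_refl by (intro mult_mono inv_le_inv) auto
      ultimately have "x = \<one>" using x KG v le_antisym[of x \<one>] by simp
      then show ?thesis using S(2) by simp
    qed
  qed (use SK SG in \<open>auto simp: Gamma_def\<close>)
  ultimately show ?thesis using SK[OF vS] by (simp add: unit_lsubgroup_def)
qed

text \<open>Otherwise \<open>separating_homs\<close> gives two maps into an ordered group B that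
  agree on K. As v is in K, it has the same image under both, so both land in the one algebra
  \<open>Gamma B (\<alpha> v)\<close>; composed with \<phi> they agree after f but differ at y. The
  map \<phi> is a parameter: it is the given isomorphism in (i) and the embedding into Chang's group
  in (ii).\<close>

theorem epi_power_in_subgroup:
  assumes epi: "mv_epi M L f" and L: "mv_algebra L" and \<phi>: "\<phi> \<in> mv_hom L (Gamma G v)"
    and K: "subgroup K G" "v \<in> K" "\<And>x. x \<in> carrier M \<Longrightarrow> \<phi> (f x) \<in> K"
    and v: "\<one> \<preceq> v" and y: "y \<in> carrier L"
  shows "\<exists>n\<ge>1. \<phi> y [^] (n::nat) \<in> K"
proof (rule ccontr)
  assume "\<not> ?thesis"
  then have n: "\<phi> y [^] n \<notin> K" if "n \<ge> 1" for n :: nat using that by blast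
  have vG: "v \<in> carrier G" using K by (meson subgroup.mem_carrier)
  have g: "\<phi> y \<in> carrier G" using mv_hom_simps(1)[OF \<phi> y] by (simp add: Gamma_simps)
  obtain B :: "('a \<times> 'a) set lgroup" and \<alpha> \<beta> where B: "linear_lgroup B"
    "\<alpha> \<in> hom G B" "\<And>x y. \<lbrakk>x \<in> carrier G; y \<in> carrier G; x \<preceq> y\<rbrakk> \<Longrightarrow> lg_le B (\<alpha> x) (\<alpha> y)"
    "\<beta> \<in> hom G B" "\<And>x y. \<lbrakk>x \<in> carrier G; y \<in> carrier G; x \<preceq> y\<rbrakk> \<Longrightarrow> lg_le B (\<beta> x) (\<beta> y)"
    "\<And>k. k \<in> K \<Longrightarrow> \<alpha> k = \<beta> k" "\<alpha> (\<phi> y) \<noteq> \<beta> (\<phi> y)"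
    using separating_homs[OF K(1) g n] by metis
  interpret B: linear_lgroup B by (rule B)
  have u: "\<alpha> v \<in> carrier B" "\<beta> v = \<alpha> v" using hom_in_carrier[OF B(2) vG] B(6)[OF K(2)] by auto
  have "lg_le B \<one>\<^bsub>B\<^esub> (\<alpha> v)"
    using B(3)[OF one_closed vG v] hom_one[OF B(2) is_group B.is_group] by simp
  then have "mv_algebra (Gamma B (\<alpha> v))" using u B.Gamma_mv_algebra by blast
  moreover have "(\<lambda>x. \<alpha> (\<phi> x)) \<in> mv_hom L (Gamma B (\<alpha> v))"
    using Gamma_hom[OF B.abelian_lgroup_axioms B(2,3) vG] by (intro mv_hom_comp[OF \<phi>]) auto
  moreover have "(\<lambda>x. \<beta> (\<phi> x)) \<in> mv_hom L (Gamma B (\<alpha> v))"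
    using Gamma_hom[OF B.abelian_lgroup_axioms B(4,5) vG] u by (intro mv_hom_comp[OF \<phi>]) auto
  ultimately show False
    using mv_epi_wrt_any[OF epi, where 'c = "('a \<times> 'a) set"] y K(3) B(6,7)
    unfolding mv_epi_wrt_def by blast
qed

text \<open>In \<open>\<Gamma>(G, v)\<close> the second equation of divisibility excludes truncation: \<open>n.x = s\<close> holds in
  the group.\<close>

lemma Gamma_nmult_exact:
  assumes v: "v \<in> carrier G" "\<one> \<preceq> v" and x: "x \<in> carrier (Gamma G v)" and s: "s \<in> carrier (Gamma G v)"
    and n: "n \<ge> 1" and 1: "mv_nmult (Gamma G v) n x = s"
    and 2: "mv_plus (Gamma G v) (mv_neg (Gamma G v) s) (mv_nmult (Gamma G v) (n - 1) x) =
      mv_neg (Gamma G v) x"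
  shows "x [^] n = s"
proof -
  have xG: "x \<in> carrier G" "\<one> \<preceq> x" "x \<preceq> v" and sG: "s \<in> carrier G" "\<one> \<preceq> s" "s \<preceq> v"
    using x s by (auto simp: Gamma_simps)
  obtain k where k: "n = Suc k" using n by (cases n) auto
  define y where "y = mv_nmult (Gamma G v) k x"
  have A: "mv_algebra (Gamma G v)" using Gamma_mv_algebra v by blast
  interpret A: mv_algebra "Gamma G v" by (rule A)
  have y: "y \<in> carrier G" "\<one> \<preceq> y" "y \<preceq> v"
    using A.nmult_closed[OF x, of k] by (auto simp: y_def Gamma_simps)
  \<comment> \<open>Truncating at every step amounts to truncating the group multiple once.\<close>
  have yn: "mv_nmult (Gamma G v) i x = (x [^] i) \<sqinter>\<^bsub>lg_order G\<^esub> v" for i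
  proof (induction i)
    case 0
    then show ?case using v by (simp add: meet_eq Gamma_simps)
  next
    case (Suc i)
    show ?case
    proof (cases "x [^] i \<preceq> v")
      case True
      then show ?thesis using Suc xG v by (simp add: meet_eq Gamma_simps)
    next
      case False
      then have *: "v \<preceq> x [^] i" using total[of v "x [^] i"] xG v by auto
      then have "v \<otimes> \<one> \<preceq> x [^] i \<otimes> x" using xG v by (intro mult_mono) auto
      moreover have "v \<otimes> \<one> \<preceq> v \<otimes> x" using xG v by (intro mult_mono le_refl) auto
      ultimately show ?thesis using * Suc xG v by (simp add: meet_eq Gamma_simps)
    qed
  qed
  have s1: "(y \<otimes> x) \<sqinter>\<^bsub>lg_order G\<^esub> v = s" using 1 k by (simp add: y_def Gamma_simps)
  have s2: "(v \<otimes> inv s \<otimes> y) \<sqinter>\<^bsub>lg_order G\<^esub> v = v \<otimes> inv x"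
    using 2 k by (simp add: y_def Gamma_simps)
  show ?thesis
  proof (cases "x = \<one>")
    case True
    have "mv_nmult (Gamma G v) n x = \<one>" using yn[of n] v True by (simp add: meet_eq)
    then have "s = \<one>" using 1 by simp
    then show ?thesis using True by simp
  next
    case False
    \<comment> \<open>As x > 0, the value v - x is strictly below v, so the left side of the second
      equation is not truncated; the equation reads v - s + y = v - x, that is s = y + x.\<close>
    have lt: "\<not> v \<preceq> v \<otimes> inv x"
    proof
      assume "v \<preceq> v \<otimes> inv x"
      then have "x \<otimes> v \<preceq> \<one> \<otimes> v" using le_mult_iff[of v "inv x" v] xG v by (simp add: m_comm)
      then have "x \<preceq> \<one>" using le_cancel[of x v \<one>] xG v by simp
      then show False using xG False le_antisym by blast
    qed
    let ?w = "v \<otimes> inv s \<otimes> y"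
    have "?w \<preceq> v"
    proof (rule ccontr)
      assume "\<not> ?w \<preceq> v"
      then have "v \<preceq> ?w" using total[of ?w v] sG y v by auto
      then show False using s2 lt sG y v le_refl[of v] by (simp add: meet_eq)
    qed
    then have "?w = v \<otimes> inv x" using s2 sG y v by (simp add: meet_eq)
    then have "inv s \<otimes> y = inv x" using v sG y xG by (simp add: m_assoc)
    then have "y = s \<otimes> inv x" using inv_solve_left'[of "inv x" s y] sG y xG by simp
    then have "s = y \<otimes> x" using sG xG by (simp add: m_assoc)
    \<comment> \<open>Had y been truncated, it would be v, and s = v + x would exceed v.\<close>
    moreover have "x [^] k \<preceq> v"
    proof (rule ccontr)
      assume "\<not> x [^] k \<preceq> v"
      then have "y = v" using yn[of k] total[of v "x [^] k"] xG v by (auto simp: y_def meet_eq)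
      then have "v \<otimes> x \<preceq> v" using \<open>s = y \<otimes> x\<close> sG by simp
      from translation[OF _ _ _ this, of "inv x"] show False using lt xG v by (simp add: m_assoc)
    qed
    then have "y = x [^] k" using yn[of k] xG v by (simp add: y_def meet_eq)
    ultimately show ?thesis using k by simp
  qed
qed

end

section \<open>The ordered group of an MV-chain\<close>

context mv_algebra
begin

text \<open>This law, \<open>odot_plus_swap\<close> and \<open>odot_plus_mixed\<close> are the cases
  of associativity for addition with carry. Here neither a + b nor a + c is truncated; writing c as
  \<open>(a \<oplus> c) \<ominus> a\<close>, and b likewise, turns both sides into one expression
  symmetric in b and c.\<close>

lemma odot_odot_swap:
  assumes "a \<in> carrier M" "b \<in> carrier M" "c \<in> carrier M" "b \<lesssim> neg a" "c \<lesssim> neg a"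
  shows "(a \<oplus> b) \<odot> c = (a \<oplus> c) \<odot> b"
proof -
  have "(a \<oplus> b) \<odot> ((a \<oplus> c) \<ominus> a) = (a \<oplus> c) \<odot> ((a \<oplus> b) \<ominus> a)"
    using assms by (simp add: odot_def ominus_def plus_ac)
  then show ?thesis using assms by (simp add: plus_ominus_cancel)
qed

lemma odot_plus_neg:
  assumes "a \<in> carrier M" "b \<in> carrier M" "a \<oplus> b = \<I>"
  shows "(a \<odot> b) \<oplus> neg a = b"
  using mjoin_absorb[of "neg a" b] assms
  by (simp add: mjoin_def odot_def ominus_def mv_le_def plus_comm)

text \<open>Both b and c lie above \<open>neg a\<close>, so c =
  \<open>(a \<odot> c) \<oplus> neg a\<close>, and likewise for b; substituting for the right
  summand on each side gives the same sum.\<close>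

lemma odot_plus_swap:
  assumes "a \<in> carrier M" "b \<in> carrier M" "c \<in> carrier M" "a \<oplus> b = \<I>" "a \<oplus> c = \<I>"
  shows "(a \<odot> b) \<oplus> c = (a \<odot> c) \<oplus> b"
proof -
  have "(a \<odot> b) \<oplus> ((a \<odot> c) \<oplus> neg a) = (a \<odot> c) \<oplus> ((a \<odot> b) \<oplus> neg a)"
    using assms by (simp add: plus_ac)
  then show ?thesis using assms by (simp add: odot_plus_neg)
qed

text \<open>With e = \<open>a \<odot> c\<close> one has a = \<open>e \<oplus> neg c\<close>. The
  bound on b puts \<open>e \<oplus> b\<close> below c, so adding \<open>neg c\<close> to it is not
  truncated and can be cancelled.\<close>

lemma odot_plus_mixed:
  assumes "a \<in> carrier M" "b \<in> carrier M" "c \<in> carrier M" "b \<lesssim> neg a" "a \<oplus> c = \<I>"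
  shows "(a \<oplus> b) \<odot> c = (a \<odot> c) \<oplus> b"
proof -
  let ?e = "a \<odot> c"
  have odot_comm: "?e = c \<odot> a" using assms by (simp add: odot_def plus_comm)
  have c: "?e \<oplus> neg a = c" using odot_plus_neg[of a c] assms by simp
  have a: "?e \<oplus> neg c = a"
    using odot_plus_neg[of c a] assms plus_comm[of a c] by (simp add: odot_comm)
  have "?e \<oplus> b \<lesssim> ?e \<oplus> neg a" using assms by (intro plus_mono) auto
  then have "(neg c \<oplus> (?e \<oplus> b)) \<ominus> neg c = ?e \<oplus> b"
    using assms by (intro plus_ominus_cancel) (auto simp: c)
  moreover have "neg c \<oplus> (?e \<oplus> b) = (?e \<oplus> neg c) \<oplus> b" using assms by (simp add: plus_ac)
  ultimately have "(a \<oplus> b) \<ominus> neg c = ?e \<oplus> b" by (simp only: a)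
  then show ?thesis by (simp only: odot_def ominus_def)
qed

text \<open>Addition with carry: when the remainders together reach the unit, their excess over it
  remains and 1 moves to the integer part.\<close>

definition cadd :: "int \<times> 'a \<Rightarrow> int \<times> 'a \<Rightarrow> int \<times> 'a" where
  "cadd x y = (if snd x \<oplus> snd y = \<I> then (fst x + fst y + 1, snd x \<odot> snd y)
     else (fst x + fst y, snd x \<oplus> snd y))"

text \<open>For a nonzero remainder, -(n v + a) = (-n - 1) v + (v - a). For a = 0 this formula would
  leave the forbidden remainder \<open>\<I>\<close>, hence the separate case.\<close>

definition cneg :: "int \<times> 'a \<Rightarrow> int \<times> 'a" where
  "cneg x = (if snd x = \<zero> then (- fst x, \<zero>) else (- fst x - 1, neg (snd x)))"

text \<open>The pair \<open>(n, a)\<close> stands for \<open>n v + a\<close>; the value \<open>a = \<I>\<close> is excluded because it would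
  represent \<open>(n + 1, \<zero>)\<close> a second time.\<close>

definition chang :: "(int \<times> 'a) lgroup" where
  "chang = \<lparr>carrier = {x. snd x \<in> carrier M \<and> snd x \<noteq> \<I>}, mult = cadd, one = (0, \<zero>),
     lg_le = (\<lambda>x y. 0 \<le> fst (cadd y (cneg x)))\<rparr>"

definition chang_emb :: "'a \<Rightarrow> int \<times> 'a" where
  "chang_emb a = (if a = \<I> then (1, \<zero>) else (0, a))"

lemma chang_simps:
  "carrier chang = {x. snd x \<in> carrier M \<and> snd x \<noteq> \<I>}" "x \<otimes>\<^bsub>chang\<^esub> y = cadd x y"
  "\<one>\<^bsub>chang\<^esub> = (0, \<zero>)" "lg_le chang x y \<longleftrightarrow> 0 \<le> fst (cadd y (cneg x))"
  by (simp_all add: chang_def)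

section \<open>Chang's group as a totally ordered group containing the chain\<close>

context
  assumes linear: "mv_linear M" and nontrivial: "\<zero> \<noteq> \<I>"
begin

lemma mle_neg_of_plus_neq:
  "\<lbrakk>a \<in> carrier M; b \<in> carrier M; a \<oplus> b \<noteq> \<I>\<rbrakk> \<Longrightarrow> b \<lesssim> neg a"
  using linear[unfolded mv_linear_def, rule_format, of b "neg a"] by (auto simp: mv_le_def)

lemma odot_neq_one:
  assumes "a \<in> carrier M" "b \<in> carrier M" "a \<noteq> \<I>" shows "a \<odot> b \<noteq> \<I>"
proof
  assume "a \<odot> b = \<I>"
  moreover have "a \<odot> b \<lesssim> a" using ominus_mle[of a "neg b"] assms by (simp add: odot_def ominus_def)
  ultimately show False using assms mle_antisym[of a \<I>] by simp
qed

lemma cadd_comm: "\<lbrakk>x \<in> carrier chang; y \<in> carrier chang\<rbrakk> \<Longrightarrow> cadd x y = cadd y x"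
  by (simp add: cadd_def chang_simps odot_def plus_comm)

text \<open>Together with commutativity this exchange law gives associativity. Being symmetric in y
  and z, it splits only by whether a + b and a + c carry; in the mixed cases exactly one carry
  occurs on each side, in the first addition on one and in the second on the other.\<close>

lemma cadd_swap:
  assumes "x \<in> carrier chang" "y \<in> carrier chang" "z \<in> carrier chang"
  shows "cadd (cadd x y) z = cadd (cadd x z) y"
proof -
  obtain n a m b k c where xyz: "x = (n, a)" "y = (m, b)" "z = (k, c)" by (metis surj_pair)
  then have *: "a \<in> carrier M" "b \<in> carrier M" "c \<in> carrier M" "a \<noteq> \<I>" "b \<noteq> \<I>" "c \<noteq> \<I>"
    using assms by (auto simp: chang_simps)
  have comm: "a \<oplus> b \<oplus> c = a \<oplus> c \<oplus> b" using * by (simp add: plus_ac)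
  consider "a \<oplus> b = \<I>" "a \<oplus> c = \<I>" | "a \<oplus> b = \<I>" "a \<oplus> c \<noteq> \<I>" | "a \<oplus> b \<noteq> \<I>" "a \<oplus> c = \<I>"
    | "a \<oplus> b \<noteq> \<I>" "a \<oplus> c \<noteq> \<I>" by blast
  then show ?thesis
  proof cases
    case 1
    have "a \<odot> b \<odot> c = a \<odot> c \<odot> b" using * by (simp add: odot_def plus_ac)
    then show ?thesis using 1 odot_plus_swap[of a b c] * by (simp add: xyz cadd_def)
  next
    case 2
    have "(a \<oplus> c) \<odot> b = (a \<odot> b) \<oplus> c"
      using odot_plus_mixed[of a c b] mle_neg_of_plus_neq[of a c] 2 * by simp
    moreover have "a \<oplus> c \<oplus> b = \<I>" using 2 * comm by simp
    moreover have "(a \<oplus> c) \<odot> b \<noteq> \<I>" using odot_neq_one[of "a \<oplus> c" b] 2 * by simp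
    ultimately show ?thesis using 2 by (simp add: xyz cadd_def)
  next
    case 3
    have "(a \<oplus> b) \<odot> c = (a \<odot> c) \<oplus> b"
      using odot_plus_mixed[of a b c] mle_neg_of_plus_neq[of a b] 3 * by simp
    moreover have "a \<oplus> b \<oplus> c = \<I>" using 3 * comm by simp
    moreover have "(a \<oplus> b) \<odot> c \<noteq> \<I>" using odot_neq_one[of "a \<oplus> b" c] 3 * by simp
    ultimately show ?thesis using 3 by (simp add: xyz cadd_def)
  next
    case 4
    have "(a \<oplus> b) \<odot> c = (a \<oplus> c) \<odot> b"
      using odot_odot_swap[of a b c] mle_neg_of_plus_neq[of a] 4 * by simp
    then show ?thesis using 4 comm by (simp add: xyz cadd_def)
  qed
qed

lemma cadd_closed: "\<lbrakk>x \<in> carrier chang; y \<in> carrier chang\<rbrakk> \<Longrightarrow> cadd x y \<in> carrier chang"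
  by (simp add: cadd_def chang_simps odot_neq_one)

lemma cneg_closed: "x \<in> carrier chang \<Longrightarrow> cneg x \<in> carrier chang"
  using nontrivial neg_inj[of "snd x" \<zero>] by (auto simp: cneg_def chang_simps)

lemma cadd_cneg: "x \<in> carrier chang \<Longrightarrow> cadd (cneg x) x = (0, \<zero>)"
  using nontrivial by (auto simp: cadd_def cneg_def chang_simps odot_def)

lemma chang_comm_group: "comm_group chang"
proof (rule comm_groupI)
  fix x y z assume *: "x \<in> carrier chang" "y \<in> carrier chang" "z \<in> carrier chang"
  have "cadd (cadd x y) z = cadd (cadd y x) z" using * cadd_comm by simp
  also have "\<dots> = cadd (cadd y z) x" using * cadd_swap by simp
  also have "\<dots> = cadd x (cadd y z)" using * cadd_comm cadd_closed by simp
  finally show "x \<otimes>\<^bsub>chang\<^esub> y \<otimes>\<^bsub>chang\<^esub> z = x \<otimes>\<^bsub>chang\<^esub> (y \<otimes>\<^bsub>chang\<^esub> z)"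
    by (simp add: chang_simps)
next
  fix x assume x: "x \<in> carrier chang"
  show "\<exists>y\<in>carrier chang. y \<otimes>\<^bsub>chang\<^esub> x = \<one>\<^bsub>chang\<^esub>"
    using cneg_closed[OF x] cadd_cneg[OF x] by (auto simp: chang_simps(2,3))
  show "\<one>\<^bsub>chang\<^esub> \<otimes>\<^bsub>chang\<^esub> x = x"
    using x by (simp add: chang_simps cadd_def prod_eq_iff)
next
  show "\<one>\<^bsub>chang\<^esub> \<in> carrier chang" using nontrivial by (simp add: chang_simps)
next
  fix x y assume "x \<in> carrier chang" "y \<in> carrier chang"
  then show "x \<otimes>\<^bsub>chang\<^esub> y \<in> carrier chang" "x \<otimes>\<^bsub>chang\<^esub> y = y \<otimes>\<^bsub>chang\<^esub> x"
    using cadd_closed cadd_comm by (simp_all add: chang_simps(2))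
qed

lemma inv_chang: "x \<in> carrier chang \<Longrightarrow> inv\<^bsub>chang\<^esub> x = cneg x"
  using comm_group.axioms(2)[OF chang_comm_group] cadd_cneg cneg_closed
  by (metis group.inv_equality chang_simps(2,3))

text \<open>Remainders are never negative, so the integer part decides positivity. If x and -x both
  have integer part >= 0, the remainder is 0, since otherwise the two integer parts would add up to
  -1.\<close>

theorem chang_linear_lgroup: "linear_lgroup chang"
proof (rule linear_lgroup_of_cone[OF chang_comm_group, where Q = "{x \<in> carrier chang. 0 \<le> fst x}"])
  fix x y assume "x \<in> carrier chang" "y \<in> carrier chang"
  then show "lg_le chang x y \<longleftrightarrow> y \<otimes>\<^bsub>chang\<^esub> inv\<^bsub>chang\<^esub> x \<in> {x \<in> carrier chang. 0 \<le> fst x}"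
    using cadd_closed cneg_closed by (simp add: chang_simps(2,4) inv_chang)
next
  fix x y assume *: "x \<in> {x \<in> carrier chang. 0 \<le> fst x}" "y \<in> {x \<in> carrier chang. 0 \<le> fst x}"
  then have "cadd x y \<in> carrier chang" using cadd_closed by simp
  then show "x \<otimes>\<^bsub>chang\<^esub> y \<in> {x \<in> carrier chang. 0 \<le> fst x}"
    using * by (simp add: chang_simps(2)) (simp add: cadd_def)
next
  fix x assume x: "x \<in> carrier chang"
  show "x \<in> {x \<in> carrier chang. 0 \<le> fst x} \<or> inv\<^bsub>chang\<^esub> x \<in> {x \<in> carrier chang. 0 \<le> fst x}"
    using x cneg_closed[OF x] by (auto simp: inv_chang cneg_def)
  assume "x \<in> {x \<in> carrier chang. 0 \<le> fst x}" "inv\<^bsub>chang\<^esub> x \<in> {x \<in> carrier chang. 0 \<le> fst x}"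
  then show "x = \<one>\<^bsub>chang\<^esub>"
    using x by (auto simp: inv_chang cneg_def chang_simps(3) prod_eq_iff split: if_splits)
qed

lemma chang_unit: "(1, \<zero>) \<in> carrier chang" "lg_le chang \<one>\<^bsub>chang\<^esub> (1, \<zero>)"
  using nontrivial by (auto simp: chang_simps cadd_def cneg_def)

theorem chang_emb_hom: "chang_emb \<in> mv_hom M (Gamma chang (1, \<zero>))"
proof -
  interpret C: linear_lgroup chang by (rule chang_linear_lgroup)
  have cl: "chang_emb a \<in> carrier chang" if "a \<in> carrier M" for a
    using that nontrivial by (simp add: chang_emb_def chang_simps)
  have pos: "lg_le chang \<one>\<^bsub>chang\<^esub> (chang_emb a)" if "a \<in> carrier M" for a
    using that nontrivial by (auto simp: chang_emb_def chang_simps cadd_def cneg_def)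
  have le: "lg_le chang (chang_emb a) (1, \<zero>)" if a: "a \<in> carrier M" for a
    using a nontrivial neg_inj[of a \<zero>] by (auto simp: chang_emb_def chang_simps cadd_def cneg_def)
  have neg: "chang_emb (neg a) = cadd (1, \<zero>) (cneg (chang_emb a))" if a: "a \<in> carrier M" for a
    using a nontrivial neg_inj[of a \<zero>] by (auto simp: chang_emb_def cadd_def cneg_def)
  have plus: "chang_emb (a \<oplus> b) = cadd (chang_emb a) (chang_emb b) \<sqinter>\<^bsub>lg_order chang\<^esub> (1, \<zero>)"
    if ab: "a \<in> carrier M" "b \<in> carrier M" for a b
  proof -
    let ?s = "cadd (chang_emb a) (chang_emb b)"
    have s: "?s \<in> carrier chang" using cl ab cadd_closed by simp
    show ?thesis
    proof (cases "a \<oplus> b = \<I>")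
      case True
      have "lg_le chang (1, \<zero>) ?s"
      \<comment> \<open>The unit is sent to (1, 0), so a sum involving it is not given by the carry
        formula applied to a and b; it is a positive element translated by v.\<close>
      proof (cases "a = \<I> \<or> b = \<I>")
        case True
        then have "?s = chang_emb (if a = \<I> then b else a) \<otimes>\<^bsub>chang\<^esub> (1, \<zero>)"
          using cadd_comm[OF cl cl, OF ab] by (auto simp: chang_simps(2) chang_emb_def[of \<I>])
        then show ?thesis
          using C.translation[OF _ _ _ pos, of "if a = \<I> then b else a" "(1, \<zero>)"] cl ab chang_unit
          by simp
      next
        case False
        then have "?s = (1, a \<odot> b)" "a \<odot> b \<noteq> \<I>" using True ab odot_neq_one by (simp_all add: cadd_def chang_emb_def)
        then show ?thesis using ab by (simp add: chang_simps(4) cadd_def cneg_def)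
      qed
      then show ?thesis using C.meet_eq(2)[OF chang_unit(1) s] True by (simp add: chang_emb_def)
    next
      case False
      then have "a \<noteq> \<I>" "b \<noteq> \<I>" using ab by auto
      then have "?s = chang_emb (a \<oplus> b)" using False by (simp add: chang_emb_def cadd_def)
      then show ?thesis using C.meet_eq(1)[OF s chang_unit(1)] le[of "a \<oplus> b"] ab by simp
    qed
  qed
  show ?thesis
    using cl pos le neg plus nontrivial
    by (simp add: mv_hom_def Gamma_simps chang_simps(2) inv_chang Pi_iff)
      (simp add: chang_simps(3) chang_emb_def)
qed

lemma inj_chang_emb: "inj_on chang_emb (carrier M)"
  by (auto simp: inj_on_def chang_emb_def split: if_splits)

end

end

section \<open>Epimorphisms from divisible algebras onto chains\<close>

lemma mv_hom_nmult:
  assumes "h \<in> mv_hom M N" "mv_algebra M" "x \<in> carrier M"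
  shows "h (mv_nmult M n x) = mv_nmult N n (h x)"
proof -
  interpret mv_algebra M by (rule assms)
  show ?thesis using assms(3) by (induction n) (auto simp: mv_hom_simps[OF assms(1)])
qed

lemma mv_hom_image_closed:
  assumes M: "mv_algebra M" and h: "h \<in> mv_hom M N"
  shows "h ` carrier M \<subseteq> carrier N" "mv_zero N \<in> h ` carrier M"
    "x \<in> h ` carrier M \<Longrightarrow> mv_neg N x \<in> h ` carrier M"
    "\<lbrakk>x \<in> h ` carrier M; y \<in> h ` carrier M\<rbrakk> \<Longrightarrow> mv_plus N x y \<in> h ` carrier M"
proof -
  interpret mv_algebra M by (rule M)
  note [simp] = mv_hom_simps(2-4)[OF h, symmetric]
  show "h ` carrier M \<subseteq> carrier N" using mv_hom_simps(1)[OF h] by auto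
  show "mv_zero N \<in> h ` carrier M" by simp
  show "x \<in> h ` carrier M \<Longrightarrow> mv_neg N x \<in> h ` carrier M" by auto
  show "\<lbrakk>x \<in> h ` carrier M; y \<in> h ` carrier M\<rbrakk> \<Longrightarrow> mv_plus N x y \<in> h ` carrier M" by auto
qed

text \<open>Some n \<phi>(y) lies in K, hence equals s + m v with s in S. Dividing s and v by n
  inside S gives t and w, and n (t + m w) = n \<phi>(y); by torsion-freeness \<phi>(y) = t + m w.
  This lies in K and in the unit interval, hence in S.\<close>

theorem divisible_epi_chain_surj:
  assumes M: "mv_algebra M" "mv_divisible M" and L: "mv_algebra L" "mv_linear L"
    and epi: "mv_epi M L f"
  shows "f ` carrier M = carrier L"
proof -
  interpret M: mv_algebra M by (rule M)
  interpret L: mv_algebra L by (rule L)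
  have f: "f \<in> mv_hom M L" using epi by (simp add: mv_epi_def mv_epi_wrt_def)
  have "y \<in> f ` carrier M" if y: "y \<in> carrier L" for y
  proof (cases "mv_zero L = mv_one L")
    \<comment> \<open>Chang's group presupposes that zero and unit differ. The one-element chain
      does occur, as the quotient by the improper prime.\<close>
    case True
    then have "y = mv_zero L" using L.plus_one[OF y] L.plus_zero[OF y] by simp
    then show ?thesis using mv_hom_image_closed(2)[OF M(1) f] by simp
  next
    case False
    define G where "G = L.chang"
    define v where "v = (1 :: int, mv_zero L)"
    define \<phi> where "\<phi> = L.chang_emb"
    interpret G: linear_lgroup G unfolding G_def by (rule L.chang_linear_lgroup[OF L(2) False])
    have v: "v \<in> carrier G" "lg_le G \<one>\<^bsub>G\<^esub> v"
      using L.chang_unit[OF L(2) False] by (simp_all add: v_def G_def)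
    have \<phi>: "\<phi> \<in> mv_hom L (Gamma G v)"
      using L.chang_emb_hom[OF L(2) False] by (simp add: v_def G_def \<phi>_def)
    have inj: "inj_on \<phi> (carrier L)" unfolding \<phi>_def by (rule L.inj_chang_emb[OF L(2) False])
    define h where "h = (\<lambda>x. \<phi> (f x))"
    have h: "h \<in> mv_hom M (Gamma G v)" unfolding h_def by (rule mv_hom_comp[OF f \<phi>])
    define S where "S = h ` carrier M"
    note SI = mv_hom_image_closed[OF M(1) h, folded S_def]
    define K where "K = G.unit_hull v S"
    have "unit_lsubgroup G v S K"
      unfolding K_def using v SI by (intro G.unit_lsubgroup_unit_hull) (auto simp: Gamma_simps(4))
    then have K: "subgroup K G" "v \<in> K" and KS: "carrier (Gamma (G\<lparr>carrier := K\<rparr>) v) = S"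
      by (auto simp: unit_lsubgroup_def lsubgroup_def)
    have SK: "s \<in> K" "s \<in> carrier G" if "s \<in> S" for s
    proof -
      show "s \<in> K" using that KS by (auto simp: Gamma_def)
      then show "s \<in> carrier G" using subgroup.mem_carrier[OF K(1)] by blast
    qed
    have root: "\<exists>t\<in>S. t [^]\<^bsub>G\<^esub> n = s" if n: "n \<ge> 1" and s: "s \<in> S" for n :: nat and s
    proof -
      obtain a where a: "a \<in> carrier M" "s = h a" using s by (auto simp: S_def)
      obtain x where x: "x \<in> carrier M" "mv_nmult M n x = a"
        "mv_plus M (mv_neg M a) (mv_nmult M (n - 1) x) = mv_neg M x"
        using M(2) n a unfolding mv_divisible_def by blast
      have "h x [^]\<^bsub>G\<^esub> n = s"
      proof (rule G.Gamma_nmult_exact[OF v _ _ n])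
        show "h x \<in> carrier (Gamma G v)" "s \<in> carrier (Gamma G v)"
          using x a mv_hom_simps(1)[OF h] by auto
        show "mv_nmult (Gamma G v) n (h x) = s" using mv_hom_nmult[OF h M(1) x(1), of n] x(2) a(2) by (simp only:)
        show "mv_plus (Gamma G v) (mv_neg (Gamma G v) s) (mv_nmult (Gamma G v) (n - 1) (h x)) =
            mv_neg (Gamma G v) (h x)"
          using arg_cong[OF x(3), of h] x a by (simp add: mv_hom_simps[OF h] mv_hom_nmult[OF h M(1)])
      qed
      then show ?thesis using x by (auto simp: S_def)
    qed
    obtain n :: nat where n: "n \<ge> 1" "\<phi> y [^]\<^bsub>G\<^esub> n \<in> K"
      using G.epi_power_in_subgroup[OF epi L(1) \<phi> K _ v(2) y] SK by (auto simp: S_def h_def)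
    have g: "\<phi> y \<in> carrier G" "lg_le G \<one>\<^bsub>G\<^esub> (\<phi> y)" "lg_le G (\<phi> y) v"
      using mv_hom_simps(1)[OF \<phi> y] by (auto simp: Gamma_simps)
    obtain s m where s: "s \<in> S" "\<phi> y [^]\<^bsub>G\<^esub> n = s \<otimes>\<^bsub>G\<^esub> v [^]\<^bsub>G\<^esub> (m::int)"
      using n by (auto simp: K_def G.unit_hull_def)
    \<comment> \<open>The unit v has to be divided by n as well, since n may fail to divide
      m.\<close>
    have "v \<in> S" using KS K v G.le_refl[OF v(1)] by (auto simp: Gamma_def)
    obtain t w where tw: "t \<in> S" "w \<in> S" "t [^]\<^bsub>G\<^esub> n = s" "w [^]\<^bsub>G\<^esub> n = v"
      using root[OF n(1) s(1)] root[OF n(1) \<open>v \<in> S\<close>] by blast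
    have c: "t \<in> carrier G" "w \<in> carrier G" using tw SK by auto
    have "(t \<otimes>\<^bsub>G\<^esub> w [^]\<^bsub>G\<^esub> m) [^]\<^bsub>G\<^esub> n = t [^]\<^bsub>G\<^esub> n \<otimes>\<^bsub>G\<^esub> (w [^]\<^bsub>G\<^esub> m) [^]\<^bsub>G\<^esub> n"
      using c by (simp add: G.pow_mult_distrib G.m_comm)
    also have "(w [^]\<^bsub>G\<^esub> m) [^]\<^bsub>G\<^esub> n = (w [^]\<^bsub>G\<^esub> n) [^]\<^bsub>G\<^esub> m"
      using c by (simp add: G.int_pow_pow mult.commute flip: int_pow_int)
    finally have "(t \<otimes>\<^bsub>G\<^esub> w [^]\<^bsub>G\<^esub> m) [^]\<^bsub>G\<^esub> n = \<phi> y [^]\<^bsub>G\<^esub> n" using tw s by simp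
    then have "\<phi> y = t \<otimes>\<^bsub>G\<^esub> w [^]\<^bsub>G\<^esub> m" using G.pow_eq_iff[OF _ g(1) n(1)] c by simp
    also have "\<dots> \<in> K"
      using SK tw G.subgroup_int_pow_closed[OF K(1), of w m] subgroup.m_closed[OF K(1)] by blast
    finally have "\<phi> y \<in> S" using g KS by (auto simp: Gamma_def)
    then obtain x where "x \<in> carrier M" "\<phi> y = \<phi> (f x)" by (auto simp: S_def h_def)
    then have "y = f x" using inj_onD[OF inj _ y, of "f x"] mv_hom_simps(1)[OF f] by auto
    then show ?thesis using \<open>x \<in> carrier M\<close> by simp
  qed
  then show ?thesis using mv_hom_simps(1)[OF f] by auto
qed

section \<open>Epimorphisms out of divisible MV-algebras\<close>

lemma mv_epi_cancel:
  fixes K :: "'c mv"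
  assumes "mv_epi M N f" "mv_algebra K" "\<alpha> \<in> mv_hom N K" "\<beta> \<in> mv_hom N K"
    and "\<And>x. x \<in> carrier M \<Longrightarrow> \<alpha> (f x) = \<beta> (f x)" "y \<in> carrier N"
  shows "\<alpha> y = \<beta> y"
proof -
  have "\<forall>(K :: 'c mv) \<alpha> \<beta>. mv_algebra K \<longrightarrow> \<alpha> \<in> mv_hom N K \<longrightarrow> \<beta> \<in> mv_hom N K \<longrightarrow>
      (\<forall>x\<in>carrier M. \<alpha> (f x) = \<beta> (f x)) \<longrightarrow> (\<forall>y\<in>carrier N. \<alpha> y = \<beta> y)"
    using mv_epi_wrt_any[OF assms(1), where 'c = 'c] unfolding mv_epi_wrt_def by (rule conjunct2)
  from this[rule_format, OF assms(2-6)] show ?thesis .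
qed

text \<open>\<open>mv_epi\<close> tests at a type determined by the codomain, which changes from N
  to K here; \<open>mv_epi_cancel\<close>, free in the type of the target, bridges the two.\<close>

lemma mv_epi_comp_surj:
  fixes K :: "('c, 'k) mv_scheme"
  assumes epi: "mv_epi M N f" and g: "g \<in> mv_hom N K" and surj: "g ` carrier N = carrier K"
  shows "mv_epi M K (\<lambda>x. g (f x))"
  unfolding mv_epi_def mv_epi_wrt_def
proof (intro conjI allI impI ballI)
  have "f \<in> mv_hom M N" using epi unfolding mv_epi_def mv_epi_wrt_def by (rule conjunct1)
  then show "(\<lambda>x. g (f x)) \<in> mv_hom M K" using g by (rule mv_hom_comp)
  fix T :: "('c + 'c) mv_term mv" and \<alpha> \<beta> y
  assume *: "mv_algebra T" "\<alpha> \<in> mv_hom K T" "\<beta> \<in> mv_hom K T"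
    "\<forall>x\<in>carrier M. \<alpha> (g (f x)) = \<beta> (g (f x))" "y \<in> carrier K"
  obtain x where x: "x \<in> carrier N" "y = g x" using *(5) unfolding surj[symmetric] by (rule imageE)
  show "\<alpha> y = \<beta> y"
    using mv_epi_cancel[OF epi *(1) mv_hom_comp[OF g *(2)] mv_hom_comp[OF g *(3)] _ x(1)] *(4)
    unfolding x(2) by (rule meta_mp) (erule bspec)
qed

section \<open>Recovering an element of the codomain from its values at prime ideals\<close>

lemma mv_subalgebra:
  assumes A: "mv_algebra A" and S: "S \<subseteq> carrier A" "mv_zero A \<in> S"
    "\<And>x. x \<in> S \<Longrightarrow> mv_neg A x \<in> S" "\<And>x y. \<lbrakk>x \<in> S; y \<in> S\<rbrakk> \<Longrightarrow> mv_plus A x y \<in> S"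
  shows "mv_algebra (A\<lparr>carrier := S\<rparr>)"
proof -
  interpret A: mv_algebra A by (rule A)
  have one: "mv_one (A\<lparr>carrier := S\<rparr>) = mv_one A" unfolding mv_one_def by simp
  have c: "x \<in> carrier A" if "x \<in> S" for x using S(1) that by blast
  show ?thesis
  proof (rule mv_algebraI, unfold one)
    fix x y assume "x \<in> carrier (A\<lparr>carrier := S\<rparr>)" "y \<in> carrier (A\<lparr>carrier := S\<rparr>)"
    then have *: "x \<in> S" "y \<in> S" by simp_all
    show "mv_plus (A\<lparr>carrier := S\<rparr>) x y = mv_plus (A\<lparr>carrier := S\<rparr>) y x"
      using A.plus_comm[OF c c, OF *] by simp
    show "mv_plus (A\<lparr>carrier := S\<rparr>) x (mv_neg (A\<lparr>carrier := S\<rparr>)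
          (mv_plus (A\<lparr>carrier := S\<rparr>) x (mv_neg (A\<lparr>carrier := S\<rparr>) y))) =
        mv_plus (A\<lparr>carrier := S\<rparr>) y (mv_neg (A\<lparr>carrier := S\<rparr>)
          (mv_plus (A\<lparr>carrier := S\<rparr>) y (mv_neg (A\<lparr>carrier := S\<rparr>) x)))"
      using A.lukasiewicz[OF c c, OF *] by simp
  qed (use S(2-4) c in \<open>simp_all add: A.plus_assoc\<close>)
qed

text \<open>Here \<open>M\<close> is the codomain A of the overview, and the abbreviation
  \<open>A\<close> below is its subalgebra on \<open>S\<close>. \<open>cancel\<close> says that the
  dominion of \<open>S\<close> is everything, tested at the type that carries the quotients of the
  subalgebra; \<open>onto_primes\<close> is the chain case.\<close>

locale mv_dominion = mv_algebra M for M :: "('a, 'm) mv_scheme" +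
  fixes S
  assumes S_sub: "S \<subseteq> carrier M" and S_zero: "mv_zero M \<in> S"
    and S_neg: "x \<in> S \<Longrightarrow> mv_neg M x \<in> S"
    and S_plus: "\<lbrakk>x \<in> S; y \<in> S\<rbrakk> \<Longrightarrow> mv_plus M x y \<in> S"
    and cancel: "\<And>(K :: 'a set mv) \<alpha> \<beta> y. \<lbrakk>mv_algebra K; \<alpha> \<in> mv_hom M K; \<beta> \<in> mv_hom M K;
      \<And>x. x \<in> S \<Longrightarrow> \<alpha> x = \<beta> x; y \<in> carrier M\<rbrakk> \<Longrightarrow> \<alpha> y = \<beta> y"
    and onto_primes: "\<And>P y. \<lbrakk>mv_algebra.mv_prime M P; y \<in> carrier M\<rbrakk> \<Longrightarrow>
      \<exists>s\<in>S. mv_algebra.mcong M P s y"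
begin

lemma S_carrier: "x \<in> S \<Longrightarrow> x \<in> carrier M" using S_sub by blast

abbreviation "A \<equiv> M\<lparr>carrier := S\<rparr>"

lemma sub: "mv_algebra A"
  by (rule mv_subalgebra[OF mv_algebra_axioms S_sub S_zero S_neg S_plus])

sublocale A: mv_algebra A by (rule sub)

lemma sub_simps: "A.ominus x y = x \<ominus> y" "mv_le A x y \<longleftrightarrow> x \<lesssim> y"
  unfolding ominus_def A.ominus_def mv_le_def mv_one_def by simp_all

lemma S_ominus: "\<lbrakk>x \<in> S; y \<in> S\<rbrakk> \<Longrightarrow> x \<ominus> y \<in> S"
  by (simp add: ominus_def S_neg S_plus)

lemma S_mjoin: "\<lbrakk>x \<in> S; y \<in> S\<rbrakk> \<Longrightarrow> mjoin x y \<in> S"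
  by (simp add: mjoin_def S_ominus S_plus)

lemma S_mmeet: "\<lbrakk>x \<in> S; y \<in> S\<rbrakk> \<Longrightarrow> mmeet x y \<in> S"
  by (simp add: mmeet_def S_mjoin S_neg)

text \<open>The ideal r of the overview: the join of P \<inter> S and Q \<inter> S among the ideals
  of the subalgebra.\<close>

definition hull_ideal where
  "hull_ideal P Q = {z \<in> S. \<exists>x\<in>P \<inter> S. \<exists>y\<in>Q \<inter> S. z \<lesssim> x \<oplus> y}"

lemma hull_ideal:
  assumes P: "mv_ideal P" and Q: "mv_ideal Q"
  shows "A.mv_ideal (hull_ideal P Q)"
  unfolding A.mv_ideal_def
proof (intro conjI ballI impI)
  show "hull_ideal P Q \<subseteq> carrier A" by (auto simp: hull_ideal_def)
  show "mv_zero A \<in> hull_ideal P Q"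
    using ideal_zero[OF P] ideal_zero[OF Q] S_zero by (auto simp: hull_ideal_def intro!: bexI[of _ \<zero>])
next
  fix z w assume "z \<in> hull_ideal P Q" "w \<in> hull_ideal P Q"
  then obtain x y x' y' where *: "z \<in> S" "w \<in> S" "x \<in> P" "x \<in> S" "y \<in> Q" "y \<in> S" "z \<lesssim> x \<oplus> y"
    "x' \<in> P" "x' \<in> S" "y' \<in> Q" "y' \<in> S" "w \<lesssim> x' \<oplus> y'"
    by (auto simp: hull_ideal_def)
  have "z \<oplus> w \<lesssim> (x \<oplus> y) \<oplus> (x' \<oplus> y')" using * S_carrier by (intro plus_mono) auto
  also have "(x \<oplus> y) \<oplus> (x' \<oplus> y') = (x \<oplus> x') \<oplus> (y \<oplus> y')" using * S_carrier by (simp add: plus_ac)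
  finally show "mv_plus A z w \<in> hull_ideal P Q"
    using * ideal_plus[OF P, of x x'] ideal_plus[OF Q, of y y'] S_plus by (auto simp: hull_ideal_def)
next
  fix z w assume zw: "z \<in> carrier A" "w \<in> hull_ideal P Q" "mv_le A z w"
  then obtain x y where *: "w \<in> S" "x \<in> P" "x \<in> S" "y \<in> Q" "y \<in> S" "w \<lesssim> x \<oplus> y"
    by (auto simp: hull_ideal_def)
  have "z \<lesssim> x \<oplus> y"
    using mle_trans[of z w "x \<oplus> y"] zw * S_carrier by (simp add: sub_simps)
  then show "z \<in> hull_ideal P Q" using zw * by (auto simp: hull_ideal_def)
qed

lemma hull_ideal_incl:
  assumes "mv_ideal P" "mv_ideal Q"
  shows "P \<inter> S \<subseteq> hull_ideal P Q" "Q \<inter> S \<subseteq> hull_ideal P Q"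
proof -
  have "x \<lesssim> x \<oplus> \<zero>" "x \<lesssim> \<zero> \<oplus> x" if "x \<in> S" for x using S_carrier[OF that] by simp_all
  then show "P \<inter> S \<subseteq> hull_ideal P Q" "Q \<inter> S \<subseteq> hull_ideal P Q"
    using ideal_zero[OF assms(1)] ideal_zero[OF assms(2)] S_zero
    unfolding hull_ideal_def by blast+
qed

text \<open>Since S meets every class modulo P, the quotient by P is S/(P \<inter> S), which maps
  onto S/I. The map picks a representative in S; two such representatives differ by elements of P
  \<inter> S, so the class modulo I is well defined.\<close>

lemma quot_lift:
  assumes P: "mv_prime P" and I: "A.mv_ideal I" "P \<inter> S \<subseteq> I"
  obtains \<alpha> where "\<alpha> \<in> mv_hom M (A.mv_quot I)"
    "\<And>s y. \<lbrakk>s \<in> S; mcong P s y\<rbrakk> \<Longrightarrow> \<alpha> y = A.mclass I s"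
proof
  have PI: "mv_ideal P" using P by (simp add: mv_prime_def)
  define r where "r y = (SOME s. s \<in> S \<and> mcong P s y)" for y
  have r: "r y \<in> S" "mcong P (r y) y" if "y \<in> carrier M" for y
    using someI_ex[of "\<lambda>s. s \<in> S \<and> mcong P s y"] onto_primes[OF P that] by (auto simp: r_def)
  show eq: "A.mclass I (r y) = A.mclass I s" if s: "s \<in> S" "mcong P s y" for s y
  proof -
    have y: "y \<in> carrier M" using s by (simp add: mcong_def)
    have "mcong P (r y) s" using mcong_trans[OF PI r(2)[OF y] mcong_sym[OF s(2)]] .
    then have "A.mcong I (r y) s"
      using r(1)[OF y] s(1) I(2) S_ominus by (auto simp: A.mcong_def mcong_def sub_simps)
    then show ?thesis using A.mclass_eq_iff[OF I(1)] r(1)[OF y] by simp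
  qed
  show "(\<lambda>y. A.mclass I (r y)) \<in> mv_hom M (A.mv_quot I)"
    unfolding mv_hom_def
  proof (intro CollectI conjI ballI)
    show "(\<lambda>y. A.mclass I (r y)) \<in> carrier M \<rightarrow> carrier (A.mv_quot I)"
      using r by (auto simp: A.quot_simps[OF I(1)])
    fix x y assume x: "x \<in> carrier M" and y: "y \<in> carrier M"
    show "A.mclass I (r (x \<oplus> y)) =
        mv_plus (A.mv_quot I) (A.mclass I (r x)) (A.mclass I (r y))"
      using A.quot_simps(4)[OF I(1), of "r x" "r y"] r[OF x] r[OF y] S_plus
        eq[of "r x \<oplus> r y" "x \<oplus> y"] mcong_plus[OF PI] by simp
  next
    fix x assume x: "x \<in> carrier M"
    show "A.mclass I (r (neg x)) = mv_neg (A.mv_quot I) (A.mclass I (r x))"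
      using A.quot_simps(3)[OF I(1), of "r x"] r[OF x] S_neg eq[of "neg (r x)" "neg x"]
        mcong_neg by simp
  next
    show "A.mclass I (r \<zero>) = mv_zero (A.mv_quot I)"
      using eq[OF S_zero mcong_refl[OF PI]] by (simp add: A.quot_simps[OF I(1)])
  qed
qed

text \<open>The lifts through P and through Q both restrict on S to the quotient map, so
  \<open>cancel\<close> makes them equal at a; one sends a to the class of s, the other to that of
  t.\<close>

lemma hull_ideal_diff:
  assumes P: "mv_prime P" and Q: "mv_prime Q"
    and s: "s \<in> S" "mcong P s a" and t: "t \<in> S" "mcong Q t a"
  shows "s \<ominus> t \<in> hull_ideal P Q"
proof -
  have PI: "mv_ideal P" and QI: "mv_ideal Q" using P Q by (simp_all add: mv_prime_def)
  let ?I = "hull_ideal P Q"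
  note I = hull_ideal[OF PI QI] and incl = hull_ideal_incl[OF PI QI]
  obtain \<alpha> where \<alpha>: "\<alpha> \<in> mv_hom M (A.mv_quot ?I)"
    "\<And>s y. \<lbrakk>s \<in> S; mcong P s y\<rbrakk> \<Longrightarrow> \<alpha> y = A.mclass ?I s"
    using quot_lift[OF P I incl(1)] by blast
  obtain \<beta> where \<beta>: "\<beta> \<in> mv_hom M (A.mv_quot ?I)"
    "\<And>s y. \<lbrakk>s \<in> S; mcong Q s y\<rbrakk> \<Longrightarrow> \<beta> y = A.mclass ?I s"
    using quot_lift[OF Q I incl(2)] by blast
  have "\<alpha> x = \<beta> x" if "x \<in> S" for x
    using \<alpha>(2)[OF that mcong_refl[OF PI S_carrier[OF that]]]
      \<beta>(2)[OF that mcong_refl[OF QI S_carrier[OF that]]] by simp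
  then have "\<alpha> a = \<beta> a"
    using cancel[OF A.quot_mv_algebra[OF I] \<alpha>(1) \<beta>(1)] s by (auto simp: mcong_def)
  then have "A.mclass ?I s = A.mclass ?I t" using \<alpha>(2)[OF s] \<beta>(2)[OF t] by simp
  then show ?thesis using A.mclass_eq_iff[OF I] s(1) by (simp add: A.mcong_def sub_simps)
qed

text \<open>Take s and t in S matching a at P and at Q, with \<open>s \<ominus> t\<close> below x +
  y, x in P and y in Q. Lowering s by x changes nothing modulo P and brings it below t, hence below
  a, modulo Q.\<close>

lemma interpolation:
  assumes P: "mv_prime P" and Q: "mv_prime Q" and a: "a \<in> carrier M"
  shows "\<exists>s\<in>S. mcong P s a \<and> s \<ominus> a \<in> Q"
proof -
  have PI: "mv_ideal P" and QI: "mv_ideal Q" using P Q by (simp_all add: mv_prime_def)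
  obtain s t where st: "s \<in> S" "mcong P s a" "t \<in> S" "mcong Q t a"
    using onto_primes[OF P a] onto_primes[OF Q a] by blast
  obtain x y where xy: "x \<in> P" "x \<in> S" "y \<in> Q" "y \<in> S" "s \<ominus> t \<lesssim> x \<oplus> y"
    using hull_ideal_diff[OF P Q st] by (auto simp: hull_ideal_def)
  note c = S_carrier[OF st(1)] S_carrier[OF st(3)] S_carrier[OF xy(2)] S_carrier[OF xy(4)] a
  let ?s = "s \<ominus> x"
  have "?s \<ominus> s = \<zero>" using ominus_mle[of s x] c by (simp add: ominus_eq_zero_iff)
  moreover have "s \<ominus> ?s \<in> P"
    using ideal_ominusI[OF PI _ xy(1), of s ?s] mle_ominus_plus[of s x] c by (simp add: plus_comm)
  ultimately have "mcong P ?s s" using c ideal_zero[OF PI] by (simp add: mcong_def)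
  then have "mcong P ?s a" using st(2) by (rule mcong_trans[OF PI])
  moreover have "?s \<ominus> t \<in> Q"
  proof (rule ideal_ominusI[OF QI _ xy(3)])
    have "s \<lesssim> t \<oplus> (x \<oplus> y)" using xy(5) c by (simp add: ominus_mle_iff)
    then show "?s \<lesssim> t \<oplus> y" using c by (simp add: ominus_mle_iff plus_ac)
  qed (use c in auto)
  then have "?s \<ominus> a \<in> Q"
    using ideal_ominus_trans[OF QI _ _ _ _, of ?s t a] st(4) c by (simp add: mcong_def)
  ultimately show ?thesis using S_ominus st xy by blast
qed

text \<open>The excesses over a of all s in S that match a at P are directed downwards, by meets. If
  none were zero, a prime Q would avoid all of them, against \<open>interpolation\<close> at P and
  Q.\<close>

lemma lower_interpolation:
  assumes P: "mv_prime P" and a: "a \<in> carrier M"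
  shows "\<exists>s\<in>S. mcong P s a \<and> s \<lesssim> a"
proof (rule ccontr)
  assume neg: "\<not> ?thesis"
  have PI: "mv_ideal P" using P by (simp add: mv_prime_def)
  define X where "X = {s \<ominus> a | s. s \<in> S \<and> mcong P s a}"
  have "X \<subseteq> carrier M" using a S_carrier by (auto simp: X_def)
  moreover have "X \<noteq> {}" using onto_primes[OF P a] by (auto simp: X_def)
  moreover have "\<zero> \<notin> X"
  proof
    assume "\<zero> \<in> X"
    then obtain s where "s \<in> S" "mcong P s a" "s \<ominus> a = \<zero>" by (auto simp: X_def)
    then show False using neg ominus_eq_zero_iff[of s a] S_carrier[of s] a by auto
  qed
  moreover have "\<exists>z\<in>X. z \<lesssim> x \<and> z \<lesssim> y" if xy: "x \<in> X" "y \<in> X" for x y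
  proof -
    obtain s t where st: "s \<in> S" "mcong P s a" "t \<in> S" "mcong P t a" "x = s \<ominus> a" "y = t \<ominus> a"
      using xy by (auto simp: X_def)
    note c = S_carrier[OF st(1)] S_carrier[OF st(3)] a
    let ?m = "mmeet s t"
    have 1: "?m \<ominus> a \<lesssim> x" "?m \<ominus> a \<lesssim> y"
      using c mmeet_lower[of s t] by (auto simp: st intro!: ominus_mono)
    then have "?m \<ominus> a \<in> P"
      using ideal_down[OF PI, of x "?m \<ominus> a"] st c by (auto simp: mcong_def)
    \<comment> \<open>The deficit of the meet is bounded by the sum of the two deficits, which lies
      in P.\<close>
    moreover have "a \<ominus> ?m \<in> P"
    proof (rule ideal_ominusI[OF PI _ ideal_plus[OF PI, of "a \<ominus> s" "a \<ominus> t"]])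
      let ?p = "(a \<ominus> s) \<oplus> (a \<ominus> t)"
      have "a \<ominus> ?p \<lesssim> s"
      proof -
        have "a \<lesssim> s \<oplus> (a \<ominus> s)" "s \<oplus> (a \<ominus> s) \<lesssim> s \<oplus> ?p"
          using c by (auto intro!: mle_ominus_plus plus_mono mle_plus)
        then have "a \<lesssim> s \<oplus> ?p" using c mle_trans[of a "s \<oplus> (a \<ominus> s)" "s \<oplus> ?p"] by simp
        then show ?thesis using c by (simp add: ominus_mle_iff plus_comm)
      qed
      moreover have "a \<ominus> ?p \<lesssim> t"
      proof -
        have "a \<lesssim> t \<oplus> (a \<ominus> t)" "t \<oplus> (a \<ominus> t) \<lesssim> t \<oplus> ?p"
          using c by (auto intro!: mle_ominus_plus plus_mono mle_plus')
        then have "a \<lesssim> t \<oplus> ?p" using c mle_trans[of a "t \<oplus> (a \<ominus> t)" "t \<oplus> ?p"] by simp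
        then show ?thesis using c by (simp add: ominus_mle_iff plus_comm)
      qed
      ultimately have "a \<ominus> ?p \<lesssim> ?m" using c by (intro mmeet_greatest) auto
      then show "a \<lesssim> ?m \<oplus> ?p" using c by (simp add: ominus_mle_iff plus_comm)
    qed (use st c in \<open>auto simp: mcong_def\<close>)
    ultimately have "mcong P ?m a" using c by (simp add: mcong_def)
    then have "?m \<ominus> a \<in> X" using S_mmeet[OF st(1,3)] by (auto simp: X_def)
    then show ?thesis using 1 by blast
  qed
  ultimately obtain Q where Q: "mv_prime Q" "Q \<inter> X = {}" using prime_ideal_avoiding[of X] by blast
  then show False using interpolation[OF P Q(1) a] by (auto simp: X_def)
qed

text \<open>The dual argument: the deficits of the elements of S below a are directed downwards by
  joins, and a prime avoiding all of them would contradict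
  \<open>lower_interpolation\<close>.\<close>

theorem dominion_eq: "S = carrier M"
proof (intro equalityI S_sub subsetI)
  fix a assume a: "a \<in> carrier M"
  define Y where "Y = {a \<ominus> s | s. s \<in> S \<and> s \<lesssim> a}"
  have "\<zero> \<in> Y"
  proof (rule ccontr)
    assume "\<zero> \<notin> Y"
    moreover have "Y \<subseteq> carrier M" using a S_carrier by (auto simp: Y_def)
    moreover have "a \<ominus> \<zero> \<in> Y" using S_zero a by (auto simp: Y_def)
    moreover have "\<exists>z\<in>Y. z \<lesssim> x \<and> z \<lesssim> y" if xy: "x \<in> Y" "y \<in> Y" for x y
    proof -
      obtain s t where st: "s \<in> S" "s \<lesssim> a" "t \<in> S" "t \<lesssim> a" "x = a \<ominus> s" "y = a \<ominus> t"
        using xy by (auto simp: Y_def)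
      note c = S_carrier[OF st(1)] S_carrier[OF st(3)] a
      have "a \<ominus> mjoin s t \<in> Y"
        using S_mjoin[OF st(1,3)] mjoin_least[OF st(2,4) c] by (auto simp: Y_def)
      moreover have "a \<ominus> mjoin s t \<lesssim> x" "a \<ominus> mjoin s t \<lesssim> y"
        using c mjoin_upper[of s t] by (auto simp: st intro!: ominus_mono)
      ultimately show ?thesis by blast
    qed
    ultimately obtain P where P: "mv_prime P" "P \<inter> Y = {}" using prime_ideal_avoiding[of Y] by blast
    then show False using lower_interpolation[OF P(1) a] by (auto simp: Y_def mcong_def)
  qed
  then obtain s where s: "s \<in> S" "s \<lesssim> a" "a \<ominus> s = \<zero>" by (auto simp: Y_def)
  then have "a \<lesssim> s" using ominus_eq_zero_iff[of a s] S_carrier a by simp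
  then show "a \<in> S" using mle_antisym[of a s] s S_carrier a by simp
qed

end

text \<open>Following f by a surjection keeps it an epimorphism, so the chain case applies to the
  quotient by every prime and supplies \<open>onto_primes\<close>.\<close>

theorem divisible_epi_surj:
  assumes M: "mv_algebra M" "mv_divisible M" and A: "mv_algebra A" and epi: "mv_epi M A f"
  shows "f ` carrier M = carrier A"
proof -
  interpret A: mv_algebra A by (rule A)
  have f: "f \<in> mv_hom M A" using epi by (simp add: mv_epi_def mv_epi_wrt_def)
  note SI = mv_hom_image_closed[OF M(1) f]
  interpret D: mv_dominion A "f ` carrier M"
  proof unfold_locales
    show "\<alpha> y = \<beta> y"
      if *: "mv_algebra K" "\<alpha> \<in> mv_hom A K" "\<beta> \<in> mv_hom A K"
        "\<And>x. x \<in> f ` carrier M \<Longrightarrow> \<alpha> x = \<beta> x" "y \<in> carrier A" for K :: "'c set mv" and \<alpha> \<beta> y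
      using mv_epi_cancel[OF epi *(1-3) _ *(5)] *(4) by blast
    fix P y assume P: "A.mv_prime P" and y: "y \<in> carrier A"
    have I: "A.mv_ideal P" using P by (simp add: A.mv_prime_def)
    have "mv_epi M (A.mv_quot P) (\<lambda>x. A.mclass P (f x))"
      by (rule mv_epi_comp_surj[OF epi A.mclass_hom[OF I]]) (simp add: A.quot_simps[OF I])
    from divisible_epi_chain_surj[OF M A.quot_mv_algebra[OF I] A.quot_linear[OF P] this]
    have "A.mclass P y \<in> (\<lambda>x. A.mclass P (f x)) ` carrier M"
      using y by (simp add: A.quot_simps[OF I])
    then obtain x where "x \<in> carrier M" "A.mclass P y = A.mclass P (f x)" by auto
    then show "\<exists>s\<in>f ` carrier M. A.mcong P s y"
      using A.mclass_eq_iff[OF I y] A.mcong_sym by blast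
  qed (use SI in auto)
  show ?thesis by (rule D.dominion_eq)
qed

section \<open>The divisible hull of the image, and epicompleteness\<close>

theorem theorem3p18:
  fixes M :: "'a mv"
  assumes "mv_algebra M"
  shows
    "(\<forall>(L :: 'b mv) f (H :: 'h lgroup) v \<phi>.
        mv_algebra L \<and> mv_linear L \<and> mv_epi M L f \<and>
        abelian_lgroup H \<and> strong_unit H v \<and> \<phi> \<in> mv_iso L (Gamma H v) \<longrightarrow>
        (\<exists>K. unit_lsubgroup H v (\<phi> ` f ` carrier M) K \<and>
             dhull_emb H ` \<phi> ` carrier L \<subseteq> carrier (Gamma (dhull_sub H K) (dhull_emb H v)))) \<and>
     (mv_divisible M \<longrightarrow> mv_epicomplete TYPE('c) M)"
proof (intro conjI allI impI)
  fix L :: "'b mv" and f and H :: "'h lgroup" and v \<phi>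
  assume "mv_algebra L \<and> mv_linear L \<and> mv_epi M L f \<and>
    abelian_lgroup H \<and> strong_unit H v \<and> \<phi> \<in> mv_iso L (Gamma H v)"
  then have L: "mv_algebra L" "mv_linear L" and epi: "mv_epi M L f" and H: "abelian_lgroup H"
    and v: "strong_unit H v" and \<phi>: "\<phi> \<in> mv_hom L (Gamma H v)"
    and surj: "carrier (Gamma H v) = \<phi> ` carrier L"
    by (auto simp: mv_iso_def bij_betw_def)
  have f: "f \<in> mv_hom M L" using epi by (simp add: mv_epi_def mv_epi_wrt_def)
  have vH: "v \<in> carrier H" "lg_le H \<one>\<^bsub>H\<^esub> v" using v by (auto simp: strong_unit_def)
  have "mv_linear (Gamma H v)"
  proof -
    have "mv_le (Gamma H v) (\<phi> x) (\<phi> y)" if "x \<in> carrier L" "y \<in> carrier L" "mv_le L x y" for x y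
      using that mv_hom_one[OF \<phi> L(1)] mv_hom_simps(2)[OF \<phi>, of "mv_neg L x" y]
        mv_hom_simps(3)[OF \<phi>, of x] mv_algebra.neg_closed[OF L(1)]
      by (simp add: mv_le_def)
    then show ?thesis using L(2) unfolding mv_linear_def surj by blast
  qed
  then interpret H: linear_lgroup H
    using abelian_lgroup.linear_lgroup_of_Gamma[OF H v] by simp
  define h where "h = (\<lambda>x. \<phi> (f x))"
  have h: "h \<in> mv_hom M (Gamma H v)" unfolding h_def by (rule mv_hom_comp[OF f \<phi>])
  \<comment> \<open>By \<open>unit_lsubgroup_unique\<close> this is the only possible
    witness.\<close>
  define K where "K = H.unit_hull v (h ` carrier M)"
  have img: "h ` carrier M = \<phi> ` f ` carrier M" by (auto simp: h_def)
  note SI = mv_hom_image_closed[OF assms h]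
  have K: "unit_lsubgroup H v (h ` carrier M) K"
    unfolding K_def using vH SI by (intro H.unit_lsubgroup_unit_hull) (auto simp: Gamma_simps(4))
  then have KH: "subgroup K H" "v \<in> K" and KS: "h ` carrier M \<subseteq> K"
    by (auto simp: unit_lsubgroup_def lsubgroup_def Gamma_def)
  have "dhull_emb H (\<phi> y) \<in> carrier (Gamma (dhull_sub H K) (dhull_emb H v))" if y: "y \<in> carrier L" for y
  proof -
    have g: "\<phi> y \<in> carrier H" "lg_le H \<one>\<^bsub>H\<^esub> (\<phi> y)" "lg_le H (\<phi> y) v"
      using mv_hom_simps(1)[OF \<phi> y] by (auto simp: Gamma_simps)
    obtain n :: nat where n: "n \<ge> 1" "\<phi> y [^]\<^bsub>H\<^esub> n \<in> K"
      using H.epi_power_in_subgroup[OF epi L(1) \<phi> KH _ vH(2) y] KS by (auto simp: h_def)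
    \<comment> \<open>Expanding the fraction \<phi>(y)/1 by n gives it the numerator n \<phi>(y),
      which lies in K.\<close>
    have "dhull_emb H (\<phi> y) = dfrac H (\<phi> y [^]\<^bsub>H\<^esub> n) n"
      using H.dfrac_expand[of "\<phi> y" 1 n] g n by (simp add: dhull_emb_def)
    then have "dhull_emb H (\<phi> y) \<in> carrier (dhull_sub H K)"
      using n by (auto simp: dhull_sub_def)
    moreover have "lg_le (dhull H) \<one>\<^bsub>dhull H\<^esub> (dhull_emb H (\<phi> y))"
      using H.dhull_emb(3)[of "\<one>\<^bsub>H\<^esub>" "\<phi> y"] g by (simp add: dhull_emb_def dhull_def)
    moreover have "lg_le (dhull H) (dhull_emb H (\<phi> y)) (dhull_emb H v)"
      using H.dhull_emb(3) g vH by blast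
    ultimately show ?thesis by (simp add: Gamma_def dhull_sub_def)
  qed
  then show "\<exists>K. unit_lsubgroup H v (\<phi> ` f ` carrier M) K \<and>
      dhull_emb H ` \<phi> ` carrier L \<subseteq> carrier (Gamma (dhull_sub H K) (dhull_emb H v))"
    using K unfolding img by blast
next
  assume "mv_divisible M"
  then show "mv_epicomplete TYPE('c) M"
    unfolding mv_epicomplete_def using divisible_epi_surj[OF assms] by blast
qed

end
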